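(* Let $A$ be a pseudo-ASL over a field $R$ with a pseudo-ASL term order $\preceq$ and an algebra of leading terms $A_{lt}$ for $(A,\preceq)$. Given $(A,\preceq,A_{lt})$ and a finite set $G\subseteq A$, there is an algorithm that computes a set $G'$ that is both an Ann-closure and an S-closure of $G$ relative to $(\preceq,A_{lt})$. In particular, when $A$ is a domain, $G'$ is a pseudo-ASL Gröbner basis for $\langle G\rangle$.
   Context: All algebras are commutative, associative, unital; $R$ is a field; $\mathbb W=\{0,1,2,\dots\}$; for finite $H$, $\mathbb W^H$ is the monoid of monomials on $H$ (written multiplicatively), and an ideal of $\mathbb W^H$ is a subset closed under multiplication by $\mathbb W^H$. Pseudo-ASL $(A,H,\Sigma)$: an $R$-algebra $A$, a finite generating set $H$, an ideal $\Sigma\subseteq\mathbb W^H$ with $H\cap\Sigma=\emptyset$, such that the products $\prod_{h}h^{m(h)}$, $m\in\mathbb W^H\setminus\Sigma$ (the standard monomials), form an $R$-basis of $A$. Standard terms are $R$-multiples of standard monomials. $LM,LC,LT$ denote leading monomial, coefficient, term for a given total order on standard monomials; $LT(0)=LM(0)=0$, regarded as smaller than every standard monomial. Pseudo-ASL term order: a total order $\preceq$ on standard monomials with $1\preceq m$ for all $m$, and $LM(fh)\prec LM(gk)$ whenever $f,g,h,k$ are standard monomials with $f\prec g$, $h\preceq k$, $fh\neq0\neq gk$. Algebra of leading terms for $(A,\preceq)$: a pseudo-ASL $A_{lt}$ with the same $(H,\Sigma)$ such that, with $\pi_{lt}:A\to A_{lt}$ the $R$-linear bijection that is the identity on standard monomials,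 $\pi_{lt}(m)\pi_{lt}(m')\in\{0,\pi_{lt}(LT(mm'))\}$ for all standard monomials $m,m'$. Pseudo-ASL Gröbner basis of an ideal $I\subseteq A$ (with respect to $(\preceq,A_{lt})$): a subset $G\subseteq I$ with $\langle\pi_{lt}(LT(f)):f\in I\rangle=\langle\pi_{lt}(LT(g)):g\in G\rangle$ in $A_{lt}$. For standard terms, $t\mid_{lt}t'$ means $\pi_{lt}(t)$ divides $\pi_{lt}(t')$ in $A_{lt}$, and $t'/_{lt}\,t\in A_{lt}$ is then the unique standard term with $(t'/_{lt}t)\pi_{lt}(t)=\pi_{lt}(t')$. Standard monomials $m,m'$ are compatible if $\pi_{lt}(m)\pi_{lt}(m')\neq0$, and incompatible otherwise; $h\in A$ is compatible with $m'$ if every standard monomial occurring in $h$ is. Standard expression for $f$ relative to $g_1,\dots,g_k$ with remainder $r$: $f=r+\sum h_ig_i$ where no standard term of $r$ is $\mid_{lt}$-divisible by any $LT(g_i)$, $LM(h_ig_i)\preceq LM(f)$ for all $i$, and each $h_i$ is compatible with $LT(g_i)$. S-closed: for $f,g\in A$, let $L$ be the set of standard monomials of $A_{lt}$ that are common multiples of $\pi_{lt}(LT(f)),\pi_{lt}(LT(g))$ and minimal under divisibility, and $S(f,g)=\{\pi_{lt}^{-1}(l/_{lt}LT(f))f-\pi_{lt}^{-1}(l/_{lt}LT(g))g : l\in L\}$. $G$ is S-closed if for all $g,g'\in G$ every element of $S(g,g')$ has a standard expression relative to $G$ with remainder $0$. Ann-closed: for $g_0\in G$ and a standard monomial $m_0$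 that is incompatible with $LT(g_0)$, a compatibility syzygy for $(m_0,g_0)$ relative to $G$ is $m_0e_{g_0}-\sum_{g\in G}\ell_ge_g$ (in the free $A$-module on symbols $e_g$) where $m_0g_0=\sum\ell_gg$ is a standard expression (remainder $0$). $G$ is Ann-closed if there is a set $S$ of compatibility syzygies relative to $G$ such that for all $g\in G$: (i) for every standard monomial $\pi_{lt}(s)\in A_{lt}$ division-minimal among the standard monomials annihilating $\pi_{lt}(LT(g))$, $S$ contains a compatibility syzygy for $(s,g)$; (ii) for every standard monomial $m$ occurring in the coefficient $\ell_g$ of any syzygy in $S$, and every standard monomial $t$ (identified with an element of $A$ via $\pi_{lt}$) in the unique minimal standard-monomial generating set of the colon ideal $(\mathrm{Ann}(\pi_{lt}(LT(g))):\pi_{lt}(m))\subseteq A_{lt}$, $S$ contains a compatibility syzygy for $(LM(tm),g)$. $G'$ is an S-closure (resp. Ann-closure) of $G$ if $G\subseteq G'\subseteq\langle G\rangle$ and $G'$ is S-closed (resp. Ann-closed). Computational conventions: field operations of $R$ are computable; one is given $H$, a finite minimal set of generators of $\Sigma$, algorithms for multiplying standard monomials in $A$ and in $A_{lt}$ and for deciding $\preceq$, and generators of $\ker(R[H]\to A_{lt})$ each having at most two monomials.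
   Formalization: In Ann-closed (ii), if LM(tm) is compatible with LT(g), S must contain the trivial syzygy LM(tm)e_g − LM(tm)e_g instead of a compatibility syzygy, and nothing is required if tm = 0; read literally, no finite Ann-closure need exist (4th Veronese of k[a,b], G = {x0}). *)

theory Defs
  imports "HOL-Algebra.Algebra" "HOL-Library.Multiset"
begin

section \<open>Pseudo-ASLs\<close>

text \<open>
  Monomials on \<open>H\<close> are multisets over \<open>H\<close>, so the product of monomials is multiset union and
  the monomial 1 is \<open>{#}\<close>.  The map \<open>gen\<close> realises the elements of \<open>H\<close> as elements of \<open>A\<close>, so
  that \<open>A\<close> and its algebra of leading terms can have the same \<open>H\<close> and \<open>\<Sigma>\<close>.
\<close>

locale monomials_in_algebra = field R + A?: algebra R A
  for R :: "'r ring" (structure) and A :: "('r, 'a) module" (structure) +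
  fixes gen :: "'h \<Rightarrow> 'a" and H :: "'h set" and \<Sigma> :: "'h multiset set"
  assumes finite_H: "finite H"
    and gen_closed: "gen \<in> H \<rightarrow> carrier A"
begin

definition Mon :: "'h multiset set" where
  "Mon = {m. set_mset m \<subseteq> H}"

definition Std :: "'h multiset set" where
  "Std = Mon - \<Sigma>"

definition mon :: "'h multiset \<Rightarrow> 'a" where
  "mon m = (\<Otimes>\<^bsub>A\<^esub>h\<in>H. gen h [^]\<^bsub>A\<^esub> count m h)"

definition lincomb :: "('h multiset \<Rightarrow> 'r) \<Rightarrow> 'a" where
  "lincomb c = (\<Oplus>\<^bsub>A\<^esub>m\<in>{m. c m \<noteq> \<zero>\<^bsub>R\<^esub>}. c m \<odot>\<^bsub>A\<^esub> mon m)"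

definition coords :: "('h multiset \<Rightarrow> 'r) set" where
  "coords = {c. (\<forall>m. c m \<in> carrier R) \<and> finite {m. c m \<noteq> \<zero>\<^bsub>R\<^esub>} \<and> {m. c m \<noteq> \<zero>\<^bsub>R\<^esub>} \<subseteq> Std}"

definition coord :: "'a \<Rightarrow> 'h multiset \<Rightarrow> 'r" where
  "coord a = (THE c. c \<in> coords \<and> lincomb c = a)"

text \<open>The standard monomials occurring in an element.\<close>

definition supp :: "'a \<Rightarrow> 'h multiset set" where
  "supp a = {m. coord a m \<noteq> \<zero>\<^bsub>R\<^esub>}"

definition std_terms :: "'a set" where
  "std_terms = {c \<odot>\<^bsub>A\<^esub> mon m | c m. c \<in> carrier R \<and> m \<in> Std}"

end

text \<open>That \<open>H\<close> generates \<open>A\<close> is part of \<open>basis\<close>.\<close>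

locale pseudo_ASL = monomials_in_algebra R A gen H \<Sigma>
  for R :: "'r ring" (structure) and A :: "('r, 'a) module" (structure)
    and gen :: "'h \<Rightarrow> 'a" and H :: "'h set" and \<Sigma> :: "'h multiset set" +
  assumes \<Sigma>_monomials: "\<Sigma> \<subseteq> Mon"
    and \<Sigma>_ideal: "\<And>m u. m \<in> \<Sigma> \<Longrightarrow> u \<in> Mon \<Longrightarrow> m + u \<in> \<Sigma>"
    and H_disjoint: "\<And>h. h \<in> H \<Longrightarrow> {#h#} \<notin> \<Sigma>"
    and basis: "\<And>a. a \<in> carrier A \<Longrightarrow> \<exists>!c. c \<in> coords \<and> lincomb c = a"


section \<open>Term orders\<close>

text \<open>A total order on standard monomials is a relation on \<open>Std\<close>.  Leading monomials are of
  option type, where \<open>None\<close> is \<open>LM(0) = 0\<close>, smaller than every standard monomial.\<close>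

fun lm_le :: "'h multiset rel \<Rightarrow> 'h multiset option \<Rightarrow> 'h multiset option \<Rightarrow> bool" where
  "lm_le r None _ = True"
| "lm_le r (Some m) None = False"
| "lm_le r (Some m) (Some n) = ((m, n) \<in> r)"

context pseudo_ASL
begin

definition LM :: "'h multiset rel \<Rightarrow> 'a \<Rightarrow> 'h multiset option" where
  "LM r a = (if a = \<zero>\<^bsub>A\<^esub> then None
             else Some (THE m. m \<in> supp a \<and> (\<forall>m'\<in>supp a. (m', m) \<in> r)))"

definition LC :: "'h multiset rel \<Rightarrow> 'a \<Rightarrow> 'r" where
  "LC r a = (case LM r a of None \<Rightarrow> \<zero>\<^bsub>R\<^esub> | Some m \<Rightarrow> coord a m)"

definition LT :: "'h multiset rel \<Rightarrow> 'a \<Rightarrow> 'a" where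
  "LT r a = (case LM r a of None \<Rightarrow> \<zero>\<^bsub>A\<^esub> | Some m \<Rightarrow> LC r a \<odot>\<^bsub>A\<^esub> mon m)"

end

locale pseudo_ASL_term_order = pseudo_ASL R A gen H \<Sigma>
  for R :: "'r ring" (structure) and A :: "('r, 'a) module" (structure)
    and gen :: "'h \<Rightarrow> 'a" and H :: "'h set" and \<Sigma> :: "'h multiset set" +
  fixes r :: "'h multiset rel"
  assumes linear_order: "linear_order_on Std r"
    and one_least: "\<And>m. m \<in> Std \<Longrightarrow> ({#}, m) \<in> r"
    and mult_strict_mono:
      "\<And>f g h k. \<lbrakk>f \<in> Std; g \<in> Std; h \<in> Std; k \<in> Std; (f, g) \<in> r; f \<noteq> g; (h, k) \<in> r;
          mon f \<otimes>\<^bsub>A\<^esub> mon h \<noteq> \<zero>\<^bsub>A\<^esub>; mon g \<otimes>\<^bsub>A\<^esub> mon k \<noteq> \<zero>\<^bsub>A\<^esub>\<rbrakk> \<Longrightarrow>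
        lm_le r (LM r (mon f \<otimes>\<^bsub>A\<^esub> mon h)) (LM r (mon g \<otimes>\<^bsub>A\<^esub> mon k)) \<and>
        LM r (mon f \<otimes>\<^bsub>A\<^esub> mon h) \<noteq> LM r (mon g \<otimes>\<^bsub>A\<^esub> mon k)"


section \<open>The algebra of leading terms, Groebner bases and closures\<close>

locale leading_term_algebra =
  pseudo_ASL_term_order R A gen H \<Sigma> r + Lt: pseudo_ASL R B gen_lt H \<Sigma>
  for R :: "'r ring" (structure) and A :: "('r, 'a) module" (structure)
    and gen :: "'h \<Rightarrow> 'a" and H :: "'h set" and \<Sigma> :: "'h multiset set"
    and r :: "'h multiset rel"
    and B :: "('r, 'b) module" (structure) and gen_lt :: "'h \<Rightarrow> 'b" +
  assumes lt_mult: "\<And>m m'. m \<in> Std \<Longrightarrow> m' \<in> Std \<Longrightarrow>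
      Lt.mon m \<otimes>\<^bsub>B\<^esub> Lt.mon m'
        \<in> {\<zero>\<^bsub>B\<^esub>, Lt.lincomb (coord (LT r (mon m \<otimes>\<^bsub>A\<^esub> mon m')))}"
begin

definition pi_lt :: "'a \<Rightarrow> 'b" where
  "pi_lt a = Lt.lincomb (coord a)"

definition groebner_basis :: "'a set \<Rightarrow> 'a set \<Rightarrow> bool" where
  "groebner_basis I G \<longleftrightarrow> ideal I A \<and> G \<subseteq> I \<and>
     Idl\<^bsub>B\<^esub> ((\<lambda>f. pi_lt (LT r f)) ` I) = Idl\<^bsub>B\<^esub> ((\<lambda>g. pi_lt (LT r g)) ` G)"

text \<open>Here \<open>l\<close> is already an element of the algebra of leading terms.\<close>

definition lt_quot :: "'b \<Rightarrow> 'a \<Rightarrow> 'b" where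
  "lt_quot l t = (THE q. q \<in> Lt.std_terms \<and> q \<otimes>\<^bsub>B\<^esub> pi_lt t = l)"

definition compatible_with_LT :: "'h multiset \<Rightarrow> 'a \<Rightarrow> bool" where
  "compatible_with_LT m g \<longleftrightarrow> Lt.mon m \<otimes>\<^bsub>B\<^esub> pi_lt (LT r g) \<noteq> \<zero>\<^bsub>B\<^esub>"

text \<open>\<open>std_expr f G \<l> rem\<close>: the family \<open>\<l>\<close> of coefficients (only its values on \<open>G\<close> matter) gives a
  standard expression for \<open>f\<close> relative to \<open>G\<close> with remainder \<open>rem\<close>.\<close>

definition std_expr :: "'a \<Rightarrow> 'a set \<Rightarrow> ('a \<Rightarrow> 'a) \<Rightarrow> 'a \<Rightarrow> bool" where
  "std_expr f G \<l> rem \<longleftrightarrow>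
     rem \<in> carrier A \<and> \<l> \<in> G \<rightarrow> carrier A \<and> finite {g \<in> G. \<l> g \<noteq> \<zero>\<^bsub>A\<^esub>} \<and>
     f = rem \<oplus>\<^bsub>A\<^esub> (\<Oplus>\<^bsub>A\<^esub>g\<in>{g \<in> G. \<l> g \<noteq> \<zero>\<^bsub>A\<^esub>}. \<l> g \<otimes>\<^bsub>A\<^esub> g) \<and>
     (\<forall>m\<in>supp rem. \<forall>g\<in>G. \<not> pi_lt (LT r g) divides\<^bsub>B\<^esub> pi_lt (coord rem m \<odot>\<^bsub>A\<^esub> mon m)) \<and>
     (\<forall>g\<in>G. lm_le r (LM r (\<l> g \<otimes>\<^bsub>A\<^esub> g)) (LM r f)) \<and>
     (\<forall>g\<in>G. \<forall>m\<in>supp (\<l> g). compatible_with_LT m g)"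

definition common_multiples :: "'a \<Rightarrow> 'a \<Rightarrow> 'b set" where
  "common_multiples f g = {l \<in> Lt.mon ` Std.
     pi_lt (LT r f) divides\<^bsub>B\<^esub> l \<and> pi_lt (LT r g) divides\<^bsub>B\<^esub> l}"

definition S_set :: "'a \<Rightarrow> 'a \<Rightarrow> 'a set" where
  "S_set f g =
     {inv_into (carrier A) pi_lt (lt_quot l (LT r f)) \<otimes>\<^bsub>A\<^esub> f
        \<ominus>\<^bsub>A\<^esub> inv_into (carrier A) pi_lt (lt_quot l (LT r g)) \<otimes>\<^bsub>A\<^esub> g | l.
      l \<in> common_multiples f g \<and>
      (\<forall>l'\<in>common_multiples f g. l' divides\<^bsub>B\<^esub> l \<longrightarrow> l' = l)}"

definition S_closed :: "'a set \<Rightarrow> bool" where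
  "S_closed G \<longleftrightarrow> (\<forall>g\<in>G. \<forall>g'\<in>G. \<forall>x\<in>S_set g g'. \<exists>\<l>. std_expr x G \<l> \<zero>\<^bsub>A\<^esub>)"

text \<open>The syzygy \<open>m\<^sub>0 e\<^bsub>g\<^sub>0\<^esub> - \<Sum>\<^bsub>g\<in>G\<^esub> \<l>\<^sub>g e\<^sub>g\<close> is represented by the triple \<open>(m\<^sub>0, g\<^sub>0, \<l>)\<close>, since it is
  referred to through \<open>m\<^sub>0\<close>, \<open>g\<^sub>0\<close> and the coefficients \<open>\<l>\<^sub>g\<close>.\<close>

definition compatibility_syzygy ::
    "'a set \<Rightarrow> 'h multiset \<times> 'a \<times> ('a \<Rightarrow> 'a) \<Rightarrow> bool" where
  "compatibility_syzygy G = (\<lambda>(m\<^sub>0, g\<^sub>0, \<l>).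
     m\<^sub>0 \<in> Std \<and> g\<^sub>0 \<in> G \<and> \<not> compatible_with_LT m\<^sub>0 g\<^sub>0 \<and>
     std_expr (mon m\<^sub>0 \<otimes>\<^bsub>A\<^esub> g\<^sub>0) G \<l> \<zero>\<^bsub>A\<^esub>)"

text \<open>For compatible \<open>m\<^sub>0\<close>, the formal syzygy \<open>m\<^sub>0 e\<^bsub>g\<^sub>0\<^esub> - m\<^sub>0 e\<^bsub>g\<^sub>0\<^esub>\<close>.\<close>

definition trivial_syzygy ::
    "'a set \<Rightarrow> 'h multiset \<times> 'a \<times> ('a \<Rightarrow> 'a) \<Rightarrow> bool" where
  "trivial_syzygy G = (\<lambda>(m\<^sub>0, g\<^sub>0, \<l>).
     m\<^sub>0 \<in> Std \<and> g\<^sub>0 \<in> G \<and> compatible_with_LT m\<^sub>0 g\<^sub>0 \<and>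
     \<l> = (\<lambda>g. if g = g\<^sub>0 then mon m\<^sub>0 else \<zero>\<^bsub>A\<^esub>))"

definition Ann :: "'b \<Rightarrow> 'b set" where
  "Ann x = {a \<in> carrier B. a \<otimes>\<^bsub>B\<^esub> x = \<zero>\<^bsub>B\<^esub>}"

definition colon :: "'b set \<Rightarrow> 'b \<Rightarrow> 'b set" where
  "colon J x = {a \<in> carrier B. a \<otimes>\<^bsub>B\<^esub> x \<in> J}"

definition min_std_gens :: "'b set \<Rightarrow> 'b set" where
  "min_std_gens J = (THE T. T \<subseteq> Lt.mon ` Std \<and> Idl\<^bsub>B\<^esub> T = J \<and> (\<forall>T'\<subset>T. Idl\<^bsub>B\<^esub> T' \<noteq> J))"

definition min_annihilators :: "'a \<Rightarrow> 'h multiset set" where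
  "min_annihilators g = {s \<in> Std. Lt.mon s \<in> Ann (pi_lt (LT r g)) \<and>
     (\<forall>s'\<in>Std. Lt.mon s' \<in> Ann (pi_lt (LT r g)) \<and> Lt.mon s' divides\<^bsub>B\<^esub> Lt.mon s
        \<longrightarrow> s' = s)}"

text \<open>
  In the second clause \<open>n = LM(tm)\<close>.  If \<open>tm = 0\<close> there is no such \<open>n\<close> and nothing is required.
  Even when \<open>tm \<noteq> 0\<close>, the product of \<open>t\<close> and \<open>m\<close> may vanish in the algebra of leading terms, and
  then \<open>LM(tm)\<close> may be compatible with \<open>LT(g)\<close>, so that no compatibility syzygy for \<open>(LM(tm), g)\<close>
  exists.  In this case the formal trivial syzygy is the one required; since its coefficient
  at \<open>e\<^sub>g\<close> is \<open>LM(tm)\<close>, the second clause applies to it in turn.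
\<close>

definition Ann_closed :: "'a set \<Rightarrow> bool" where
  "Ann_closed G \<longleftrightarrow> (\<exists>S.
     (\<forall>z\<in>S. compatibility_syzygy G z \<or> trivial_syzygy G z) \<and>
     (\<forall>g\<in>G.
        (\<forall>s\<in>min_annihilators g. \<exists>\<l>. (s, g, \<l>) \<in> S) \<and>
        (\<forall>(m\<^sub>0, g\<^sub>0, \<l>)\<in>S. \<forall>m\<in>supp (\<l> g). \<forall>t\<in>Std.
           Lt.mon t \<in> min_std_gens (colon (Ann (pi_lt (LT r g))) (Lt.mon m)) \<longrightarrow>
           (\<forall>n. LM r (mon t \<otimes>\<^bsub>A\<^esub> mon m) = Some n \<longrightarrow> (\<exists>\<l>'. (n, g, \<l>') \<in> S)))))"

definition S_closure :: "'a set \<Rightarrow> 'a set \<Rightarrow> bool" where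
  "S_closure G G' \<longleftrightarrow> G \<subseteq> G' \<and> G' \<subseteq> Idl\<^bsub>A\<^esub> G \<and> S_closed G'"

definition Ann_closure :: "'a set \<Rightarrow> 'a set \<Rightarrow> bool" where
  "Ann_closure G G' \<longleftrightarrow> G \<subseteq> G' \<and> G' \<subseteq> Idl\<^bsub>A\<^esub> G \<and> Ann_closed G'"

end


section \<open>The polynomial ring on \<open>H\<close>\<close>

definition mpoly_mult ::
    "('r, 's) ring_scheme \<Rightarrow> ('h multiset \<Rightarrow> 'r) \<Rightarrow> ('h multiset \<Rightarrow> 'r) \<Rightarrow> 'h multiset \<Rightarrow> 'r" where
  "mpoly_mult R p q m = (\<Oplus>\<^bsub>R\<^esub>u\<in>{u. u \<subseteq># m}. p u \<otimes>\<^bsub>R\<^esub> q (m - u))"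

definition mpoly_ring :: "('r, 's) ring_scheme \<Rightarrow> 'h set \<Rightarrow> ('h multiset \<Rightarrow> 'r) ring" where
  "mpoly_ring R H =
     \<lparr>carrier = ring.indexed_pset R H (carrier R),
      monoid.mult = mpoly_mult R,
      monoid.one = ring.indexed_const R \<one>\<^bsub>R\<^esub>,
      ring.zero = ring.indexed_const R \<zero>\<^bsub>R\<^esub>,
      ring.add = ring.indexed_padd R\<rparr>"

lemma finite_submset: "finite {u. u \<subseteq># (m :: 'h multiset)}"
proof (rule finite_subset)
  show "{u. u \<subseteq># m} \<subseteq> mset ` {xs. set xs \<subseteq> set_mset m \<and> length xs \<le> size m}"
  proof
    fix u assume "u \<in> {u. u \<subseteq># m}"
    moreover obtain xs where "mset xs = u" using ex_mset by blast
    ultimately show "u \<in> mset ` {xs. set xs \<subseteq> set_mset m \<and> length xs \<le> size m}"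
      using size_mset_mono set_mset_mono by (force simp flip: set_mset_mset size_mset)
  qed
qed (simp add: finite_lists_length_le)

text \<open>The following shows that \<^term>\<open>mpoly_ring R H\<close> is a ring; otherwise ideals generated in it
  would be meaningless.\<close>

context cring
begin

lemma pset_coeff: "p \<in> indexed_pset H (carrier R) \<Longrightarrow> carrier_coeff p"
  by (induction rule: indexed_pset.induct)
    (auto simp: carrier_coeff_def indexed_const_def indexed_padd_def indexed_pmult_def)

lemma coeffD [simp]: "carrier_coeff p \<Longrightarrow> p m \<in> carrier R"
  by (simp add: carrier_coeff_def)

lemma mpoly_mult_closed_pt: "carrier_coeff p \<Longrightarrow> carrier_coeff q \<Longrightarrow> carrier_coeff (mpoly_mult R p q)"
  unfolding carrier_coeff_def [of "mpoly_mult R p q"] mpoly_mult_def by (intro allI finsum_closed) auto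

lemma mpoly_mult_const:
  assumes "k \<in> carrier R" and q: "carrier_coeff q"
  shows "mpoly_mult R (indexed_const k) q = (\<lambda>m. k \<otimes> q m)"
proof
  fix m
  have "mpoly_mult R (indexed_const k) q m = (\<Oplus>u\<in>{u. u \<subseteq># m}. if {#} = u then k \<otimes> q (m - u) else \<zero>)"
    unfolding mpoly_mult_def using assms by (intro finsum_cong') (auto simp: indexed_const_def)
  also have "\<dots> = k \<otimes> q m"
    using assms finite_submset[of m] by (subst finsum_singleton) auto
  finally show "mpoly_mult R (indexed_const k) q m = k \<otimes> q m" .
qed

lemma mpoly_mult_add_left:
  assumes "carrier_coeff p" "carrier_coeff p'" "carrier_coeff q"
  shows "mpoly_mult R (indexed_padd p p') q = indexed_padd (mpoly_mult R p q) (mpoly_mult R p' q)"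
  unfolding indexed_padd_def mpoly_mult_def using assms finite_submset
  by (intro ext, subst finsum_addf [symmetric]) (auto simp: l_distr intro!: finsum_cong')

lemma mpoly_mult_add_right:
  assumes "carrier_coeff p" "carrier_coeff p'" "carrier_coeff q"
  shows "mpoly_mult R q (indexed_padd p p') = indexed_padd (mpoly_mult R q p) (mpoly_mult R q p')"
  unfolding indexed_padd_def mpoly_mult_def using assms finite_submset
  by (intro ext, subst finsum_addf [symmetric]) (auto simp: r_distr intro!: finsum_cong')

lemma mpoly_mult_var:
  assumes p: "carrier_coeff p" and q: "carrier_coeff q"
  shows "mpoly_mult R (indexed_pmult p i) q = indexed_pmult (mpoly_mult R p q) i"
proof
  fix m
  show "mpoly_mult R (indexed_pmult p i) q m = indexed_pmult (mpoly_mult R p q) i m"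
  proof (cases "i \<in># m")
    case False
    have "mpoly_mult R (indexed_pmult p i) q m = (\<Oplus>u\<in>{u. u \<subseteq># m}. \<zero>)"
      unfolding mpoly_mult_def using False q by (intro finsum_cong') (auto simp: indexed_pmult_def dest: mset_subset_eqD)
    with False show ?thesis by (simp add: indexed_pmult_def)
  next
    case True
    define S where "S = add_mset i ` {u. u \<subseteq># m - {#i#}}"
    have S: "S \<subseteq> {u. u \<subseteq># m}"
      unfolding S_def using True by (auto simp: insert_subset_eq_iff)
    have out: "u \<notin> S \<Longrightarrow> u \<subseteq># m \<Longrightarrow> i \<notin># u" for u
    proof
      assume "u \<notin> S" "u \<subseteq># m" "i \<in># u"
      then have "u = add_mset i (u - {#i#})" "u - {#i#} \<subseteq># m - {#i#}"
        using \<open>i \<in># m\<close> by (auto simp: subset_eq_diff_conv)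
      with \<open>u \<notin> S\<close> show False unfolding S_def by blast
    qed
    have "mpoly_mult R (indexed_pmult p i) q m = (\<Oplus>u\<in>S. indexed_pmult p i u \<otimes> q (m - u))"
      unfolding mpoly_mult_def using S out p q finite_submset[of m]
      by (intro add.finprod_mono_neutral_cong_right) (auto simp: indexed_pmult_def)
    also have "\<dots> = (\<Oplus>u\<in>{u. u \<subseteq># m - {#i#}}. indexed_pmult p i (add_mset i u) \<otimes> q (m - add_mset i u))"
      unfolding S_def using p q by (subst finsum_reindex) (auto simp: indexed_pmult_def inj_on_def)
    also have "\<dots> = mpoly_mult R p q (m - {#i#})"
      unfolding mpoly_mult_def using p q by (intro finsum_cong') (auto simp: indexed_pmult_def)
    finally show ?thesis using True by (simp add: indexed_pmult_def)
  qed
qed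

lemma smult_pset:
  assumes "k \<in> carrier R" "q \<in> indexed_pset H (carrier R)"
  shows "(\<lambda>m. k \<otimes> q m) \<in> indexed_pset H (carrier R)"
  using assms(2)
proof induction
  case (indexed_const c)
  then have "(\<lambda>m. k \<otimes> indexed_const c m) = indexed_const (k \<otimes> c)"
    using assms(1) by (auto simp: indexed_const_def)
  then show ?case using indexed_const assms(1) by (metis indexed_pset.indexed_const m_closed)
next
  case (indexed_padd P Q)
  then have "(\<lambda>m. k \<otimes> indexed_padd P Q m) = indexed_padd (\<lambda>m. k \<otimes> P m) (\<lambda>m. k \<otimes> Q m)"
    using assms(1) pset_coeff [OF indexed_padd.hyps(1)] pset_coeff [OF indexed_padd.hyps(2)]
    by (auto simp: indexed_padd_def r_distr)
  then show ?case using indexed_padd by (auto intro: indexed_pset.indexed_padd)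
next
  case (indexed_pmult P i)
  then have "(\<lambda>m. k \<otimes> indexed_pmult P i m) = indexed_pmult (\<lambda>m. k \<otimes> P m) i"
    using assms(1) by (auto simp: indexed_pmult_def)
  then show ?case using indexed_pmult by (auto intro: indexed_pset.indexed_pmult)
qed

lemma mpoly_mult_pset:
  assumes "p \<in> indexed_pset H (carrier R)" and q: "q \<in> indexed_pset H (carrier R)"
  shows "mpoly_mult R p q \<in> indexed_pset H (carrier R)"
  using assms(1)
proof induction
  case (indexed_const k)
  then show ?case
    unfolding mpoly_mult_const [OF indexed_const pset_coeff [OF q]] using q by (rule smult_pset)
next
  case (indexed_padd P Q)
  note P = pset_coeff [OF indexed_padd.hyps(1)] and Q = pset_coeff [OF indexed_padd.hyps(2)]
  show ?case
    unfolding mpoly_mult_add_left [OF P Q pset_coeff [OF q]]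
    using indexed_padd.IH by (rule indexed_pset.indexed_padd)
next
  case (indexed_pmult P i)
  note P = pset_coeff [OF indexed_pmult.hyps(1)]
  show ?case
    unfolding mpoly_mult_var [OF P pset_coeff [OF q]]
    using indexed_pmult.IH indexed_pmult.hyps(2) by (rule indexed_pset.indexed_pmult)
qed

lemma mpoly_mult_smult:
  assumes "k \<in> carrier R" "carrier_coeff q" "carrier_coeff s"
  shows "mpoly_mult R (\<lambda>m. k \<otimes> q m) s = (\<lambda>m. k \<otimes> mpoly_mult R q s m)"
  unfolding mpoly_mult_def using assms finite_submset
  by (intro ext, subst finsum_rdistr) (auto simp: m_assoc intro!: finsum_cong')

lemma mpoly_mult_assoc:
  assumes "p \<in> indexed_pset H (carrier R)" and q: "carrier_coeff q" and s: "carrier_coeff s"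
  shows "mpoly_mult R (mpoly_mult R p q) s = mpoly_mult R p (mpoly_mult R q s)"
  using assms(1)
proof induction
  case (indexed_const k)
  have c: "carrier_coeff (mpoly_mult R q s)" using q s by (rule mpoly_mult_closed_pt)
  show ?case
    using mpoly_mult_smult[OF indexed_const q s]
    by (simp only: fun_cong [OF mpoly_mult_const [OF indexed_const q]] mpoly_mult_const [OF indexed_const c])
next
  case (indexed_padd P Q)
  note P = pset_coeff [OF indexed_padd.hyps(1)] and Q = pset_coeff [OF indexed_padd.hyps(2)]
  have c: "carrier_coeff (mpoly_mult R q s)" using q s by (rule mpoly_mult_closed_pt)
  have cP: "carrier_coeff (mpoly_mult R P q)" using P q by (rule mpoly_mult_closed_pt)
  have cQ: "carrier_coeff (mpoly_mult R Q q)" using Q q by (rule mpoly_mult_closed_pt)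
  show ?case
    unfolding mpoly_mult_add_left[OF P Q q] mpoly_mult_add_left[OF P Q c] mpoly_mult_add_left[OF cP cQ s]
    by (simp only: indexed_padd.IH)
next
  case (indexed_pmult P i)
  note P = pset_coeff [OF indexed_pmult.hyps(1)]
  have c: "carrier_coeff (mpoly_mult R q s)" using q s by (rule mpoly_mult_closed_pt)
  have cP: "carrier_coeff (mpoly_mult R P q)" using P q by (rule mpoly_mult_closed_pt)
  show ?case
    unfolding mpoly_mult_var[OF P q] mpoly_mult_var[OF P c] mpoly_mult_var[OF cP s]
    by (simp only: indexed_pmult.IH)
qed

lemma const_coeff: "k \<in> carrier R \<Longrightarrow> carrier_coeff (indexed_const k)"
  by (simp add: carrier_coeff_def indexed_const_def)

lemma mpoly_mult_one_right:
  assumes "p \<in> indexed_pset H (carrier R)"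
  shows "mpoly_mult R p (indexed_const \<one>) = p"
  using assms
proof induction
  case (indexed_const k)
  then show ?case
    by (subst mpoly_mult_const) (auto simp: const_coeff, auto simp: indexed_const_def)
next
  case (indexed_padd P Q)
  note P = pset_coeff [OF indexed_padd.hyps(1)] and Q = pset_coeff [OF indexed_padd.hyps(2)]
  show ?case
    unfolding mpoly_mult_add_left[OF P Q const_coeff[OF one_closed]] by (simp only: indexed_padd.IH)
next
  case (indexed_pmult P i)
  note P = pset_coeff [OF indexed_pmult.hyps(1)]
  show ?case
    unfolding mpoly_mult_var[OF P const_coeff[OF one_closed]] by (simp only: indexed_pmult.IH)
qed

lemma mpoly_mult_one_left:
  assumes "carrier_coeff p"
  shows "mpoly_mult R (indexed_const \<one>) p = p"
  using mpoly_mult_const[OF one_closed assms] assms by auto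

lemma mpoly_ring_ring: "ring (mpoly_ring R H)"
proof (rule ringI)
  let ?P = "indexed_pset H (carrier R)"
  note [simp] = mpoly_ring_def pset_coeff
  show "abelian_group (mpoly_ring R H)"
  proof (rule abelian_groupI)
    fix p assume p: "p \<in> carrier (mpoly_ring R H)"
    have "indexed_padd (\<lambda>m. (\<ominus> \<one>) \<otimes> p m) p = indexed_const \<zero>"
    proof
      fix m
      have "p m \<in> carrier R" using p by simp
      then show "indexed_padd (\<lambda>m. (\<ominus> \<one>) \<otimes> p m) p m = indexed_const \<zero> m"
        by (simp add: indexed_padd_def indexed_const_def l_minus l_neg)
    qed
    then show "\<exists>y\<in>carrier (mpoly_ring R H). y \<oplus>\<^bsub>mpoly_ring R H\<^esub> p = \<zero>\<^bsub>mpoly_ring R H\<^esub>"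
      using p by (auto intro!: bexI[of _ "\<lambda>m. (\<ominus> \<one>) \<otimes> p m"] smult_pset)
  next
    fix p q s
    assume "p \<in> carrier (mpoly_ring R H)" "q \<in> carrier (mpoly_ring R H)" "s \<in> carrier (mpoly_ring R H)"
    then show "p \<oplus>\<^bsub>mpoly_ring R H\<^esub> q \<oplus>\<^bsub>mpoly_ring R H\<^esub> s = p \<oplus>\<^bsub>mpoly_ring R H\<^esub> (q \<oplus>\<^bsub>mpoly_ring R H\<^esub> s)"
      by (auto simp: indexed_padd_def a_assoc)
  next
    fix p q
    assume "p \<in> carrier (mpoly_ring R H)" "q \<in> carrier (mpoly_ring R H)"
    then show "p \<oplus>\<^bsub>mpoly_ring R H\<^esub> q = q \<oplus>\<^bsub>mpoly_ring R H\<^esub> p"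
      by (auto simp: indexed_padd_def a_comm)
  next
    fix p
    assume "p \<in> carrier (mpoly_ring R H)"
    then show "\<zero>\<^bsub>mpoly_ring R H\<^esub> \<oplus>\<^bsub>mpoly_ring R H\<^esub> p = p"
      by (auto simp: indexed_padd_def indexed_const_def)
  qed (auto intro: indexed_pset.intros)
  show "monoid (mpoly_ring R H)"
  proof (rule monoidI)
    fix p q s
    assume "p \<in> carrier (mpoly_ring R H)" "q \<in> carrier (mpoly_ring R H)" "s \<in> carrier (mpoly_ring R H)"
    then have "p \<in> ?P" "carrier_coeff q" "carrier_coeff s" by auto
    from mpoly_mult_assoc[OF this]
    show "p \<otimes>\<^bsub>mpoly_ring R H\<^esub> q \<otimes>\<^bsub>mpoly_ring R H\<^esub> s = p \<otimes>\<^bsub>mpoly_ring R H\<^esub> (q \<otimes>\<^bsub>mpoly_ring R H\<^esub> s)"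
      by simp
  next
    fix p assume p: "p \<in> carrier (mpoly_ring R H)"
    then show "\<one>\<^bsub>mpoly_ring R H\<^esub> \<otimes>\<^bsub>mpoly_ring R H\<^esub> p = p"
      using mpoly_mult_one_left[of p] by simp
    show "p \<otimes>\<^bsub>mpoly_ring R H\<^esub> \<one>\<^bsub>mpoly_ring R H\<^esub> = p"
      using mpoly_mult_one_right[of p H] p by simp
  next
    fix p q assume "p \<in> carrier (mpoly_ring R H)" "q \<in> carrier (mpoly_ring R H)"
    then show "p \<otimes>\<^bsub>mpoly_ring R H\<^esub> q \<in> carrier (mpoly_ring R H)"
      using mpoly_mult_pset[of p H q] by simp
  qed (auto intro: indexed_pset.intros)
  fix p q s
  assume "p \<in> carrier (mpoly_ring R H)" "q \<in> carrier (mpoly_ring R H)" "s \<in> carrier (mpoly_ring R H)"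
  then have c: "carrier_coeff p" "carrier_coeff q" "carrier_coeff s" by auto
  show "(p \<oplus>\<^bsub>mpoly_ring R H\<^esub> q) \<otimes>\<^bsub>mpoly_ring R H\<^esub> s =
      p \<otimes>\<^bsub>mpoly_ring R H\<^esub> s \<oplus>\<^bsub>mpoly_ring R H\<^esub> q \<otimes>\<^bsub>mpoly_ring R H\<^esub> s"
    using mpoly_mult_add_left[OF c] by simp
  show "s \<otimes>\<^bsub>mpoly_ring R H\<^esub> (p \<oplus>\<^bsub>mpoly_ring R H\<^esub> q) =
      s \<otimes>\<^bsub>mpoly_ring R H\<^esub> p \<oplus>\<^bsub>mpoly_ring R H\<^esub> s \<otimes>\<^bsub>mpoly_ring R H\<^esub> q"
    using mpoly_mult_add_right[OF c] by simp
qed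
declare coeffD [simp del]

end


section \<open>Algorithms\<close>

text \<open>
  Programs compute with natural numbers, elements of the field (which are atomic) and pairs.
  They are pure syntax that mentions neither the field nor the algebra, so that one program can
  serve all of them.  The operations of the field and the three given algorithms, which
  multiply standard monomials in the two algebras and decide the order, are primitives whose
  meaning is given by a machine.
\<close>

datatype 'r val = Num nat | Scal 'r | Tup "'r val" "'r val"

record 'r machine =
  scalars :: "'r ring"
  mul_std :: "'r val \<Rightarrow> 'r val"
  mul_std_lt :: "'r val \<Rightarrow> 'r val"
  le_std :: "'r val \<Rightarrow> 'r val"

datatype prim =
    Lit nat | Succ | Pred | Fst | Snd | IsNum
  | ScalZero | ScalOne | ScalAdd | ScalNeg | ScalMul | ScalInv | ScalIsZero
  | MulStd | MulStdLt | LeStd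

fun run_prim :: "'r machine \<Rightarrow> prim \<Rightarrow> 'r val \<Rightarrow> 'r val option" where
  "run_prim M (Lit n) v = Some (Num n)"
| "run_prim M Succ (Num n) = Some (Num (n + 1))"
| "run_prim M Pred (Num n) = Some (Num (n - 1))"
| "run_prim M Fst (Tup v w) = Some v"
| "run_prim M Snd (Tup v w) = Some w"
| "run_prim M IsNum v = Some (Num (case v of Num n \<Rightarrow> 1 | _ \<Rightarrow> 0))"
| "run_prim M ScalZero v = Some (Scal \<zero>\<^bsub>scalars M\<^esub>)"
| "run_prim M ScalOne v = Some (Scal \<one>\<^bsub>scalars M\<^esub>)"
| "run_prim M ScalAdd (Tup (Scal x) (Scal y)) = Some (Scal (x \<oplus>\<^bsub>scalars M\<^esub> y))"
| "run_prim M ScalNeg (Scal x) = Some (Scal (\<ominus>\<^bsub>scalars M\<^esub> x))"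
| "run_prim M ScalMul (Tup (Scal x) (Scal y)) = Some (Scal (x \<otimes>\<^bsub>scalars M\<^esub> y))"
| "run_prim M ScalInv (Scal x) =
     (if x = \<zero>\<^bsub>scalars M\<^esub> then None else Some (Scal (inv\<^bsub>scalars M\<^esub> x)))"
| "run_prim M ScalIsZero (Scal x) = Some (Num (if x = \<zero>\<^bsub>scalars M\<^esub> then 1 else 0))"
| "run_prim M MulStd v = Some (mul_std M v)"
| "run_prim M MulStdLt v = Some (mul_std_lt M v)"
| "run_prim M LeStd v = Some (le_std M v)"
| "run_prim M _ _ = None"

text \<open>In a branching instruction, \<open>Num 0\<close> counts as false and every other value as true.\<close>

datatype prog =
  Prim prim | Skip | Seq prog prog | Fork prog prog | Cond prog prog | While prog

inductive exec :: "'r machine \<Rightarrow> prog \<Rightarrow> 'r val \<Rightarrow> 'r val \<Rightarrow> bool" for M where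
  Prim: "run_prim M q v = Some w \<Longrightarrow> exec M (Prim q) v w"
| Skip: "exec M Skip v v"
| Seq: "exec M p u v \<Longrightarrow> exec M q v w \<Longrightarrow> exec M (Seq p q) u w"
| Fork: "exec M p u v \<Longrightarrow> exec M q u w \<Longrightarrow> exec M (Fork p q) u (Tup v w)"
| Cond_true: "b \<noteq> Num 0 \<Longrightarrow> exec M p v w \<Longrightarrow> exec M (Cond p q) (Tup b v) w"
| Cond_false: "exec M q v w \<Longrightarrow> exec M (Cond p q) (Tup (Num 0) v) w"
| While_true: "b \<noteq> Num 0 \<Longrightarrow> exec M p (Tup b u) v \<Longrightarrow> exec M (While p) v w
    \<Longrightarrow> exec M (While p) (Tup b u) w"
| While_false: "exec M (While p) (Tup (Num 0) u) (Tup (Num 0) u)"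

inductive_cases exec_PrimE: "exec M (Prim q) v w"
inductive_cases exec_SkipE: "exec M Skip v w"
inductive_cases exec_SeqE: "exec M (Seq p q) v w"
inductive_cases exec_ForkE: "exec M (Fork p q) v w"
inductive_cases exec_CondE: "exec M (Cond p q) v w"
inductive_cases exec_WhileE: "exec M (While p) v w"

lemma exec_deterministic: "exec M p v w \<Longrightarrow> exec M p v w' \<Longrightarrow> w = w'"
proof (induction arbitrary: w' rule: exec.induct)
  case Prim
  then show ?case by (metis exec_PrimE option.inject)
next
  case Skip
  then show ?case by (metis exec_SkipE)
next
  case Seq
  then show ?case by (metis exec_SeqE)
next
  case Fork
  then show ?case by (metis exec_ForkE)
next
  case Cond_true
  then show ?case by (metis exec_CondE val.inject(3))
next
  case Cond_false
  then show ?case by (metis exec_CondE val.inject(3))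
next
  case While_true
  then show ?case by (metis exec_WhileE val.inject(3))
next
  case While_false
  then show ?case by (metis exec_WhileE val.inject(3))
qed


subsection \<open>Representation of the data\<close>

text \<open>A monomial is represented by its exponents along an enumeration \<open>hs\<close> of \<open>H\<close>; a polynomial,
  or the family of coefficients of an element of a pseudo-ASL, by a list of its nonzero terms
  in any order; a finite set by any list of representations of its elements.\<close>

fun enc_list :: "'r val list \<Rightarrow> 'r val" where
  "enc_list [] = Num 0"
| "enc_list (v # vs) = Tup v (enc_list vs)"

definition enc_mon :: "'h list \<Rightarrow> 'h multiset \<Rightarrow> 'r val" where
  "enc_mon hs m = enc_list (map (\<lambda>h. Num (count m h)) hs)"

definition repr_terms :: "'r ring \<Rightarrow> 'h list \<Rightarrow> ('h multiset \<Rightarrow> 'r) \<Rightarrow> 'r val \<Rightarrow> bool" where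
  "repr_terms R hs c v \<longleftrightarrow> (\<exists>ts. distinct ts \<and> set ts = {(m, c m) | m. c m \<noteq> \<zero>\<^bsub>R\<^esub>} \<and>
     v = enc_list (map (\<lambda>(m, x). Tup (enc_mon hs m) (Scal x)) ts))"

definition repr_set :: "('x \<Rightarrow> 'r val \<Rightarrow> bool) \<Rightarrow> 'x set \<Rightarrow> 'r val \<Rightarrow> bool" where
  "repr_set P Y v \<longleftrightarrow> (\<exists>xs vs. set xs = Y \<and> list_all2 P xs vs \<and> v = enc_list vs)"

context leading_term_algebra
begin

definition repr_elem :: "'h list \<Rightarrow> 'a \<Rightarrow> 'r val \<Rightarrow> bool" where
  "repr_elem hs a v \<longleftrightarrow> repr_terms R hs (coord a) v"

definition machine_for :: "'h list \<Rightarrow> 'r machine \<Rightarrow> bool" where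
  "machine_for hs M \<longleftrightarrow> scalars M = R \<and>
     (\<forall>m\<in>Std. \<forall>m'\<in>Std.
        repr_terms R hs (coord (mon m \<otimes>\<^bsub>A\<^esub> mon m'))
          (mul_std M (Tup (enc_mon hs m) (enc_mon hs m'))) \<and>
        repr_terms R hs (Lt.coord (Lt.mon m \<otimes>\<^bsub>B\<^esub> Lt.mon m'))
          (mul_std_lt M (Tup (enc_mon hs m) (enc_mon hs m'))) \<and>
        le_std M (Tup (enc_mon hs m) (enc_mon hs m')) = Num (if (m, m') \<in> r then 1 else 0))"

definition generates_\<Sigma> :: "'h multiset set \<Rightarrow> bool" where
  "generates_\<Sigma> T \<longleftrightarrow> {t + u | t u. t \<in> T \<and> u \<in> Mon} = \<Sigma>"

text \<open>\<open>Lt.lincomb\<close>, restricted to the polynomial ring, is the canonical map from \<open>R[H]\<close> to the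
  algebra of leading terms.\<close>

definition input_for :: "'h list \<Rightarrow> 'a set \<Rightarrow> 'r val \<Rightarrow> bool" where
  "input_for hs G v \<longleftrightarrow> (\<exists>T F vT vF vG.
     finite T \<and> generates_\<Sigma> T \<and> (\<forall>T'\<subset>T. \<not> generates_\<Sigma> T') \<and>
     finite F \<and> F \<subseteq> carrier (mpoly_ring R H) \<and>
     Idl\<^bsub>mpoly_ring R H\<^esub> F = a_kernel (mpoly_ring R H) B Lt.lincomb \<and>
     (\<forall>p\<in>F. card {m. p m \<noteq> \<zero>\<^bsub>R\<^esub>} \<le> 2) \<and>
     repr_set (\<lambda>m w. w = enc_mon hs m) T vT \<and>
     repr_set (repr_terms R hs) F vF \<and>
     repr_set (repr_elem hs) G vG \<and>
     v = Tup (Num (length hs)) (Tup vT (Tup vF vG)))"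

end

end

theory Submission
  imports Defs
begin

text \<open>
  Let \<open>W\<close> be a finite set with \<open>G \<subseteq> W \<subseteq> \<langle>G\<rangle>\<close>.  Each element of \<open>\<langle>G\<rangle>\<close> has a standard
  expression relative to \<open>W\<close> with remainder 0 as soon as, for every
  \<open>g\<close> in \<open>W\<close> and every standard monomial \<open>w\<close>, the product \<open>w g\<close> reduces to 0 modulo \<open>W\<close>, where one
  only divides by leading monomials contained in the given monomial as multisets.  Then all
  compatibility syzygies exist, and together they witness that \<open>W\<close> is Ann-closed.

  Finitely many of these reductions suffice.  Suppose that \<open>w\<^sub>0 g\<close> reduces to 0 and has leading
  monomial \<open>v\<close>, that \<open>w = w\<^sub>0 + d\<close>, and that \<open>v + d\<close> is standard with the same first divisor
  in \<open>W\<close> as \<open>v\<close>.  Multiplying the expression of \<open>w\<^sub>0 g\<close> by \<open>d\<close> gives one of \<open>w g\<close> with leading monomial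
  \<open>v + d\<close>, up to products \<open>\<tau> g'\<close> with smaller leading monomials, so induction on the leading
  monomial applies.  Finitely many \<open>w\<^sub>0\<close> serve all \<open>w\<close>: by Dickson's lemma for the pairs
  \<open>(w, LM(w g))\<close> it is enough that \<open>w = w\<^sub>0 + d\<close> and \<open>LM(w g) = LM(w\<^sub>0 g) + d'\<close> imply \<open>d = d'\<close>, which
  strict monotonicity of the order yields.  That a given box of \<open>w\<^sub>0\<close> serves all \<open>w\<close> depends only
  on exponents up to a bound and is decidable.

  The program adds nonzero remainders of the products \<open>w g\<close>, for \<open>w\<close> in growing boxes, until this
  test succeeds.
\<close>

section \<open>Coordinates and leading monomials\<close>

text \<open>What shapes the proof is that a product of standard monomials may vanish or break up
  into several terms, so that \<open>LM(w g)\<close> need not come from \<open>LM(g)\<close>, and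
  monotonicity is available only between nonzero products. Dividing only where
  \<open>m + LM(g)\<close> is standard keeps single steps safe: there \<open>m LM(g)\<close> is one
  basis monomial, in the given algebra as in the algebra of leading terms, so
  \<open>LM(m g) = m + LM(g)\<close> and \<open>m\<close> is compatible with \<open>LT(g)\<close>.
  Multiplying a whole reduction by \<open>d\<close> leaves this safe range, and the certificate
  controls only its leading step; the other products are harmless because they are smaller, whatever
  shape they take. Taking the first divisor in a list gives each monomial one fixed multiple that
  cancels it. Reductions can then be added by merging coefficients, and the divisor is a label with
  finitely many values. Dickson's lemma needs a second label, the monomial \<open>y\<close> of
  \<open>g\<close> with \<open>LM(w g) = LM(w y)\<close>, since the paddings \<open>d\<close> and
  \<open>d'\<close> are compared for one common \<open>y\<close>.\<close>

no_notation lesspoll (infixl \<open>\<prec>\<close> 50)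

text \<open>In \<open>pseudo_ASL\<close> the unqualified ring facts are those of \<open>A\<close>; the names below keep some of \<open>R\<close> accessible.\<close>

lemma (in field) field_add_cancel: "x \<in> carrier R \<Longrightarrow> y \<in> carrier R \<Longrightarrow> x = x \<oplus> y \<longleftrightarrow> y = \<zero>"
  by (rule add.l_cancel_one')

lemma (in field) field_inv_unique:
  "s \<in> carrier R \<Longrightarrow> x \<in> carrier R \<Longrightarrow> s \<otimes> x = \<one> \<Longrightarrow> s = inv x"
  by (metis comm_inv_char m_comm)

lemma (in field) field_assoc:
  "x \<in> carrier R \<Longrightarrow> y \<in> carrier R \<Longrightarrow> z \<in> carrier R \<Longrightarrow> x \<otimes> y \<otimes> z = x \<otimes> (y \<otimes> z)"
  by (rule m_assoc)

context pseudo_ASL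
begin

lemma mon_closed [simp]: "mon m \<in> carrier A"
  unfolding mon_def using gen_closed by (intro A.finprod_closed) auto

text \<open>Exponents add in the product over \<open>H\<close>, also for monomials in \<Sigma>. Only
  the expansion of such a product in the basis is not determined by the exponents.\<close>

lemma mon_add:
  "mon (m + m') = mon m \<otimes>\<^bsub>A\<^esub> mon m'"
proof -
  have "mon (m + m') =
      (\<Otimes>\<^bsub>A\<^esub>h\<in>H. gen h [^]\<^bsub>A\<^esub> count m h \<otimes>\<^bsub>A\<^esub> gen h [^]\<^bsub>A\<^esub> count m' h)"
    unfolding mon_def using gen_closed
    by (intro A.finprod_cong') (auto simp: A.nat_pow_mult Pi_iff)
  also have "\<dots> = mon m \<otimes>\<^bsub>A\<^esub> mon m'"
    unfolding mon_def using gen_closed by (intro A.finprod_multf) auto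
  finally show ?thesis .
qed

lemma Std_Mon: "m \<in> Std \<Longrightarrow> m \<in> Mon"
  by (simp add: Std_def)

lemma Mon_add: "u + v \<in> Mon \<longleftrightarrow> u \<in> Mon \<and> v \<in> Mon"
  by (auto simp: Mon_def)

lemma Mon_subset: "u \<subseteq># v \<Longrightarrow> v \<in> Mon \<Longrightarrow> u \<in> Mon"
  by (auto simp: Mon_def dest: mset_subset_eqD)

lemma Std_subset: "u \<subseteq># v \<Longrightarrow> v \<in> Std \<Longrightarrow> u \<in> Std"
proof -
  assume uv: "u \<subseteq># v" "v \<in> Std"
  then have "u \<in> Mon" "v - u \<in> Mon" "v = u + (v - u)"
    using Mon_subset[OF uv(1)] Mon_subset[OF diff_subset_eq_self] by (auto simp: Std_def)
  with uv show "u \<in> Std"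
    using \<Sigma>_ideal[of u "v - u"] by (auto simp: Std_def)
qed

lemma Std_addD: "u + v \<in> Std \<Longrightarrow> u \<in> Std \<and> v \<in> Std"
  using Std_subset[of u "u + v"] Std_subset[of v "u + v"] by simp

lemma lincomb_superset:
  assumes "c \<in> coords" "finite U" "{m. c m \<noteq> \<zero>\<^bsub>R\<^esub>} \<subseteq> U"
  shows "lincomb c = (\<Oplus>\<^bsub>A\<^esub>m\<in>U. c m \<odot>\<^bsub>A\<^esub> mon m)"
  unfolding lincomb_def using assms
  by (intro A.M.add.finprod_mono_neutral_cong_left) (auto simp: coords_def)

lemma lincomb_closed [simp]: "c \<in> coords \<Longrightarrow> lincomb c \<in> carrier A"
  unfolding lincomb_def coords_def by (intro A.M.finsum_closed) auto

lemma coords_add: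
  assumes "c \<in> coords" "d \<in> coords"
  shows "(\<lambda>m. c m \<oplus>\<^bsub>R\<^esub> d m) \<in> coords"
    and "lincomb (\<lambda>m. c m \<oplus>\<^bsub>R\<^esub> d m) = lincomb c \<oplus>\<^bsub>A\<^esub> lincomb d"
proof -
  let ?U = "{m. c m \<noteq> \<zero>\<^bsub>R\<^esub>} \<union> {m. d m \<noteq> \<zero>\<^bsub>R\<^esub>}"
  have U: "finite ?U" and sub: "{m. c m \<oplus>\<^bsub>R\<^esub> d m \<noteq> \<zero>\<^bsub>R\<^esub>} \<subseteq> ?U" and std: "?U \<subseteq> Std"
    and cl: "c m \<in> carrier R" "d m \<in> carrier R" for m
    using assms by (auto simp: coords_def)
  show cd: "(\<lambda>m. c m \<oplus>\<^bsub>R\<^esub> d m) \<in> coords"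
    using cl sub std finite_subset[OF sub U] by (auto simp: coords_def)
  have "lincomb (\<lambda>m. c m \<oplus>\<^bsub>R\<^esub> d m) = (\<Oplus>\<^bsub>A\<^esub>m\<in>?U. c m \<odot>\<^bsub>A\<^esub> mon m \<oplus>\<^bsub>A\<^esub> d m \<odot>\<^bsub>A\<^esub> mon m)"
    using lincomb_superset[OF cd U sub] cl by (simp add: A.smult_l_distr)
  also have "\<dots> = (\<Oplus>\<^bsub>A\<^esub>m\<in>?U. c m \<odot>\<^bsub>A\<^esub> mon m) \<oplus>\<^bsub>A\<^esub> (\<Oplus>\<^bsub>A\<^esub>m\<in>?U. d m \<odot>\<^bsub>A\<^esub> mon m)"
    using cl by (intro A.M.finsum_addf) auto
  also have "\<dots> = lincomb c \<oplus>\<^bsub>A\<^esub> lincomb d"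
    using lincomb_superset[OF assms(1) U] lincomb_superset[OF assms(2) U] by simp
  finally show "lincomb (\<lambda>m. c m \<oplus>\<^bsub>R\<^esub> d m) = lincomb c \<oplus>\<^bsub>A\<^esub> lincomb d" .
qed

lemma coords_smult:
  assumes "k \<in> carrier R" "c \<in> coords"
  shows "(\<lambda>m. k \<otimes>\<^bsub>R\<^esub> c m) \<in> coords"
    and "lincomb (\<lambda>m. k \<otimes>\<^bsub>R\<^esub> c m) = k \<odot>\<^bsub>A\<^esub> lincomb c"
proof -
  let ?U = "{m. c m \<noteq> \<zero>\<^bsub>R\<^esub>}"
  have U: "finite ?U" and sub: "{m. k \<otimes>\<^bsub>R\<^esub> c m \<noteq> \<zero>\<^bsub>R\<^esub>} \<subseteq> ?U" and std: "?U \<subseteq> Std"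
    and cl: "c m \<in> carrier R" for m
    using assms by (auto simp: coords_def)
  show cd: "(\<lambda>m. k \<otimes>\<^bsub>R\<^esub> c m) \<in> coords"
    using cl sub std finite_subset[OF sub U] assms(1) by (auto simp: coords_def)
  have "lincomb (\<lambda>m. k \<otimes>\<^bsub>R\<^esub> c m) = (\<Oplus>\<^bsub>A\<^esub>m\<in>?U. k \<odot>\<^bsub>A\<^esub> (c m \<odot>\<^bsub>A\<^esub> mon m))"
    using lincomb_superset[OF cd U sub] cl assms by (simp add: A.smult_assoc1)
  also have "\<dots> = k \<odot>\<^bsub>A\<^esub> lincomb c"
    unfolding lincomb_def using cl assms U by (subst A.finsum_smult_ldistr) auto
  finally show "lincomb (\<lambda>m. k \<otimes>\<^bsub>R\<^esub> c m) = k \<odot>\<^bsub>A\<^esub> lincomb c" .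
qed

lemma coords_single:
  assumes "k \<in> carrier R" "u \<in> Std"
  shows "(\<lambda>m. if m = u then k else \<zero>\<^bsub>R\<^esub>) \<in> coords"
    and "lincomb (\<lambda>m. if m = u then k else \<zero>\<^bsub>R\<^esub>) = k \<odot>\<^bsub>A\<^esub> mon u"
proof -
  have sub: "{m. (if m = u then k else \<zero>\<^bsub>R\<^esub>) \<noteq> \<zero>\<^bsub>R\<^esub>} \<subseteq> {u}" by auto
  show cd: "(\<lambda>m. if m = u then k else \<zero>\<^bsub>R\<^esub>) \<in> coords"
    using assms finite_subset[OF sub] by (auto simp: coords_def)
  show "lincomb (\<lambda>m. if m = u then k else \<zero>\<^bsub>R\<^esub>) = k \<odot>\<^bsub>A\<^esub> mon u"
    using lincomb_superset[OF cd _ sub] assms by (simp add: A.M.finsum_insert)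
qed

lemma coord_lincomb: "c \<in> coords \<Longrightarrow> coord (lincomb c) = c"
  unfolding coord_def using basis[OF lincomb_closed] by (intro the1_equality) auto

lemma coord_in_coords: "a \<in> carrier A \<Longrightarrow> coord a \<in> coords"
  and lincomb_coord: "a \<in> carrier A \<Longrightarrow> lincomb (coord a) = a"
  using theI'[OF basis] unfolding coord_def by auto

lemma coord_closed [simp]: "a \<in> carrier A \<Longrightarrow> coord a m \<in> carrier R"
  using coord_in_coords by (auto simp: coords_def)

text \<open>Uniqueness in \<open>basis\<close> makes coordinates linear: the pointwise sum is again
  an admissible family, and it evaluates to the sum of the elements.\<close>

lemma coord_add: "a \<in> carrier A \<Longrightarrow> b \<in> carrier A \<Longrightarrow>
    coord (a \<oplus>\<^bsub>A\<^esub> b) = (\<lambda>m. coord a m \<oplus>\<^bsub>R\<^esub> coord b m)"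
  using coord_lincomb[OF coords_add(1)[OF coord_in_coords coord_in_coords, of a b]]
    coords_add(2)[OF coord_in_coords coord_in_coords, of a b] by (simp add: lincomb_coord)

lemma coord_smult: "k \<in> carrier R \<Longrightarrow> a \<in> carrier A \<Longrightarrow>
    coord (k \<odot>\<^bsub>A\<^esub> a) = (\<lambda>m. k \<otimes>\<^bsub>R\<^esub> coord a m)"
  using coord_lincomb[OF coords_smult(1)[OF _ coord_in_coords, of k a]]
    coords_smult(2)[OF _ coord_in_coords, of k a] by (simp add: lincomb_coord)

lemma coord_term: "k \<in> carrier R \<Longrightarrow> u \<in> Std \<Longrightarrow>
    coord (k \<odot>\<^bsub>A\<^esub> mon u) = (\<lambda>m. if m = u then k else \<zero>\<^bsub>R\<^esub>)"
  using coord_lincomb[OF coords_single(1)] coords_single(2) by simp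

lemma coord_mon: "u \<in> Std \<Longrightarrow> coord (mon u) = (\<lambda>m. if m = u then \<one>\<^bsub>R\<^esub> else \<zero>\<^bsub>R\<^esub>)"
  using coord_term[of "\<one>\<^bsub>R\<^esub>" u] by simp

lemma coord_zero: "coord \<zero>\<^bsub>A\<^esub> = (\<lambda>m. \<zero>\<^bsub>R\<^esub>)"
  using coord_smult[of "\<zero>\<^bsub>R\<^esub>" "\<zero>\<^bsub>A\<^esub>"] by (simp add: coord_closed)

lemma coord_inj: "a \<in> carrier A \<Longrightarrow> b \<in> carrier A \<Longrightarrow> coord a = coord b \<Longrightarrow> a = b"
  using lincomb_coord by metis

lemma supp_Std: "a \<in> carrier A \<Longrightarrow> supp a \<subseteq> Std"
  and finite_supp: "a \<in> carrier A \<Longrightarrow> finite (supp a)"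
  using coord_in_coords by (auto simp: supp_def coords_def)

lemma supp_zero: "supp \<zero>\<^bsub>A\<^esub> = {}"
  by (simp add: supp_def coord_zero)

lemma supp_empty_iff: "a \<in> carrier A \<Longrightarrow> supp a = {} \<longleftrightarrow> a = \<zero>\<^bsub>A\<^esub>"
  using coord_inj[of a "\<zero>\<^bsub>A\<^esub>"] by (auto simp: supp_def coord_zero)

lemma supp_mon: "u \<in> Std \<Longrightarrow> supp (mon u) = {u}"
  by (simp add: supp_def coord_mon)

lemma mon_nonzero: "u \<in> Std \<Longrightarrow> mon u \<noteq> \<zero>\<^bsub>A\<^esub>"
  using supp_mon supp_zero by force

lemma supp_add: "a \<in> carrier A \<Longrightarrow> b \<in> carrier A \<Longrightarrow> supp (a \<oplus>\<^bsub>A\<^esub> b) \<subseteq> supp a \<union> supp b"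
  by (auto simp: supp_def coord_add)

lemma supp_smult: "k \<in> carrier R \<Longrightarrow> k \<noteq> \<zero>\<^bsub>R\<^esub> \<Longrightarrow> a \<in> carrier A \<Longrightarrow> supp (k \<odot>\<^bsub>A\<^esub> a) = supp a"
  by (auto simp: supp_def coord_smult integral_iff)

lemma split_term:
  assumes "a \<in> carrier A" "u \<in> supp a"
  obtains b where "b \<in> carrier A" "a = coord a u \<odot>\<^bsub>A\<^esub> mon u \<oplus>\<^bsub>A\<^esub> b" "supp b = supp a - {u}"
proof -
  have u: "u \<in> Std" using assms supp_Std by blast
  let ?t = "coord a u \<odot>\<^bsub>A\<^esub> mon u"
  define b where "b = a \<ominus>\<^bsub>A\<^esub> ?t"
  have b: "b \<in> carrier A" using assms by (simp add: b_def)
  have ab: "a = ?t \<oplus>\<^bsub>A\<^esub> b"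
    using assms(1) by (simp add: b_def a_minus_def A.M.a_lcomm A.M.r_neg)
  have "coord a = coord (?t \<oplus>\<^bsub>A\<^esub> b)" using ab by simp
  also have "\<dots> = (\<lambda>m. (if m = u then coord a u else \<zero>\<^bsub>R\<^esub>) \<oplus>\<^bsub>R\<^esub> coord b m)"
    using assms(1) b u by (simp add: coord_add coord_term)
  finally have c: "coord a m = (if m = u then coord a u else \<zero>\<^bsub>R\<^esub>) \<oplus>\<^bsub>R\<^esub> coord b m" for m
    by (rule fun_cong)
  have "coord b u = \<zero>\<^bsub>R\<^esub>"
    using c[of u] assms(1) b field_add_cancel[of "coord a u" "coord b u"] by simp
  moreover have "coord a m = coord b m" if "m \<noteq> u" for m
    using c[of m] b that by simp
  ultimately have "v \<in> supp b \<longleftrightarrow> v \<in> supp a - {u}" for v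
    by (cases "v = u") (simp_all add: supp_def)
  then have "supp b = supp a - {u}" by blast
  then show thesis using b ab that by blast
qed

text \<open>Induction on the number of terms. The step remembers that \<open>u\<close> occurs in the
  original \<open>a\<close>, so hypotheses about the monomials of \<open>a\<close> stay
  usable.\<close>

lemma elem_induct [consumes 1, case_names zero step]:
  assumes "a \<in> carrier A"
    and "P \<zero>\<^bsub>A\<^esub>"
    and "\<And>k u b. k \<in> carrier R \<Longrightarrow> k \<noteq> \<zero>\<^bsub>R\<^esub> \<Longrightarrow> u \<in> Std \<Longrightarrow> u \<in> supp a \<Longrightarrow> b \<in> carrier A \<Longrightarrow>
      supp b \<subseteq> supp a \<Longrightarrow> P b \<Longrightarrow> P (k \<odot>\<^bsub>A\<^esub> mon u \<oplus>\<^bsub>A\<^esub> b)"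
  shows "P a"
proof -
  have "supp b \<subseteq> supp a \<Longrightarrow> b \<in> carrier A \<Longrightarrow> P b" for b
  proof (induction "card (supp b)" arbitrary: b rule: less_induct)
    case less
    show ?case
    proof (cases "b = \<zero>\<^bsub>A\<^esub>")
      case False
      then obtain u where u: "u \<in> supp b" using supp_empty_iff less.prems by blast
      obtain b' where b': "b' \<in> carrier A" "b = coord b u \<odot>\<^bsub>A\<^esub> mon u \<oplus>\<^bsub>A\<^esub> b'" "supp b' = supp b - {u}"
        using split_term[OF less.prems(2) u] by blast
      have "card (supp b') < card (supp b)"
        using b'(3) u finite_supp[OF less.prems(2)] by (metis card_Diff1_less)
      then have "P b'" using less.hyps[of b'] b'(1,3) less.prems(1) by blast
      moreover have "coord b u \<noteq> \<zero>\<^bsub>R\<^esub>" using u by (simp add: supp_def)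
      ultimately show ?thesis
        using b' assms(3)[of "coord b u" u b'] less.prems u supp_Std by (metis Diff_subset coord_closed order_trans subsetD)
    qed (simp add: assms(2))
  qed
  then show ?thesis using assms(1) by blast
qed

lemma supp_smult_subset: "k \<in> carrier R \<Longrightarrow> a \<in> carrier A \<Longrightarrow> supp (k \<odot>\<^bsub>A\<^esub> a) \<subseteq> supp a"
  by (auto simp: supp_def coord_smult)

lemma mult_term_add:
  "a \<in> carrier A \<Longrightarrow> k \<in> carrier R \<Longrightarrow> x \<in> carrier A \<Longrightarrow> b \<in> carrier A \<Longrightarrow>
    a \<otimes>\<^bsub>A\<^esub> (k \<odot>\<^bsub>A\<^esub> x \<oplus>\<^bsub>A\<^esub> b) = k \<odot>\<^bsub>A\<^esub> (a \<otimes>\<^bsub>A\<^esub> x) \<oplus>\<^bsub>A\<^esub> a \<otimes>\<^bsub>A\<^esub> b"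
  by (simp add: A.r_distr A.m_comm[of a] A.smult_assoc2)

lemma supp_mult:
  assumes "b \<in> carrier A" "a \<in> carrier A"
  shows "supp (b \<otimes>\<^bsub>A\<^esub> a) \<subseteq> (\<Union>y\<in>supp a. supp (b \<otimes>\<^bsub>A\<^esub> mon y))"
proof -
  define U where "U = (\<Union>y\<in>supp a. supp (b \<otimes>\<^bsub>A\<^esub> mon y))"
  from assms(2) have "supp (b \<otimes>\<^bsub>A\<^esub> a) \<subseteq> U"
  proof (induction rule: elem_induct)
    case zero
    then show ?case using assms by (simp add: supp_zero)
  next
    case (step k u a')
    then have "supp (b \<otimes>\<^bsub>A\<^esub> mon u) \<subseteq> U" by (auto simp: U_def)
    with step show ?case
      using supp_add[of "k \<odot>\<^bsub>A\<^esub> (b \<otimes>\<^bsub>A\<^esub> mon u)" "b \<otimes>\<^bsub>A\<^esub> a'"] assms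
        supp_smult[of k "b \<otimes>\<^bsub>A\<^esub> mon u"]
      by (auto simp: mult_term_add)
  qed
  then show ?thesis by (simp add: U_def)
qed

end

context pseudo_ASL_term_order
begin

definition le :: "'h multiset \<Rightarrow> 'h multiset \<Rightarrow> bool" (infix \<open>\<preceq>\<close> 50)
  where "u \<preceq> v \<longleftrightarrow> (u, v) \<in> r"

definition lt :: "'h multiset \<Rightarrow> 'h multiset \<Rightarrow> bool" (infix \<open>\<prec>\<close> 50)
  where "u \<prec> v \<longleftrightarrow> (u, v) \<in> r \<and> u \<noteq> v"

text \<open>Dropping the option type makes inequalities readable, at the price that
  \<open>lm\<close> of zero is an arbitrary value; uses of \<open>lm\<close> and \<open>pm\<close>
  must ensure that the element does not vanish.\<close>

definition lm :: "'a \<Rightarrow> 'h multiset"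
  where "lm a = the (LM r a)"

definition pm :: "'h multiset \<Rightarrow> 'h multiset \<Rightarrow> 'h multiset"
  where "pm u v = lm (mon u \<otimes>\<^bsub>A\<^esub> mon v)"

definition nz :: "'h multiset \<Rightarrow> 'h multiset \<Rightarrow> bool"
  where "nz u v \<longleftrightarrow> mon u \<otimes>\<^bsub>A\<^esub> mon v \<noteq> \<zero>\<^bsub>A\<^esub>"

lemma le_Std: "u \<preceq> v \<Longrightarrow> u \<in> Std \<and> v \<in> Std"
  using linear_order
  by (auto simp: le_def linear_order_on_def partial_order_on_def preorder_on_def refl_on_def)

lemma le_refl: "u \<in> Std \<Longrightarrow> u \<preceq> u"
  using linear_order
  by (auto simp: le_def linear_order_on_def partial_order_on_def preorder_on_def refl_on_def)

lemma le_trans: "u \<preceq> v \<Longrightarrow> v \<preceq> w \<Longrightarrow> u \<preceq> w"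
  using linear_order
  by (auto simp: le_def linear_order_on_def partial_order_on_def preorder_on_def elim: transE)

lemma le_antisym: "u \<preceq> v \<Longrightarrow> v \<preceq> u \<Longrightarrow> u = v"
  using linear_order
  by (auto simp: le_def linear_order_on_def partial_order_on_def elim: antisymD)

lemma le_total: "u \<in> Std \<Longrightarrow> v \<in> Std \<Longrightarrow> u \<preceq> v \<or> v \<prec> u"
  using linear_order le_refl[of u]
  by (cases "u = v") (auto simp: le_def lt_def linear_order_on_def total_on_def)

lemma lt_le: "u \<prec> v \<Longrightarrow> u \<preceq> v"
  by (simp add: le_def lt_def)

lemma le_lt_trans: "u \<preceq> v \<Longrightarrow> v \<prec> w \<Longrightarrow> u \<prec> w"
  using le_trans le_antisym unfolding le_def lt_def by blast

lemma lt_irrefl: "\<not> u \<prec> u"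
  by (simp add: lt_def)

lemma le_eq_or_lt: "u \<preceq> v \<Longrightarrow> u = v \<or> u \<prec> v"
  by (auto simp: le_def lt_def)

lemma finite_has_max:
  "finite U \<Longrightarrow> U \<noteq> {} \<Longrightarrow> U \<subseteq> Std \<Longrightarrow> \<exists>u\<in>U. \<forall>v\<in>U. v \<preceq> u"
proof (induction U rule: finite_ne_induct)
  case (insert x U)
  then obtain u where u: "u \<in> U" "\<forall>v\<in>U. v \<preceq> u" by auto
  show ?case
  proof (cases "x \<preceq> u")
    case False
    then have "u \<preceq> x" "x \<preceq> x" using insert.prems u le_total lt_le le_refl by blast+
    with u le_trans show ?thesis by blast
  qed (use u in blast)
qed (use le_refl in auto)

lemma LM_eqI:
  assumes "a \<in> carrier A" "u \<in> supp a" "\<And>v. v \<in> supp a \<Longrightarrow> v \<preceq> u"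
  shows "LM r a = Some u"
proof -
  have "a \<noteq> \<zero>\<^bsub>A\<^esub>" using assms(2) by (auto simp: supp_zero)
  moreover have "(THE m. m \<in> supp a \<and> (\<forall>m'\<in>supp a. (m', m) \<in> r)) = u"
    using assms(2,3) le_antisym by (intro the_equality) (auto simp: le_def)
  ultimately show ?thesis by (simp add: LM_def)
qed

lemma lm_props:
  assumes "a \<in> carrier A" "a \<noteq> \<zero>\<^bsub>A\<^esub>"
  shows LM_eq: "LM r a = Some (lm a)"
    and lm_supp: "lm a \<in> supp a"
    and lm_max: "v \<in> supp a \<Longrightarrow> v \<preceq> lm a"
proof -
  obtain u where u: "u \<in> supp a" "\<forall>v\<in>supp a. v \<preceq> u"
    using finite_has_max[of "supp a"] assms finite_supp supp_Std supp_empty_iff by blast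
  then have "LM r a = Some u" using LM_eqI assms(1) by blast
  with u show "LM r a = Some (lm a)" "lm a \<in> supp a" "v \<in> supp a \<Longrightarrow> v \<preceq> lm a"
    by (auto simp: lm_def)
qed

lemma lm_Std: "a \<in> carrier A \<Longrightarrow> a \<noteq> \<zero>\<^bsub>A\<^esub> \<Longrightarrow> lm a \<in> Std"
  using lm_supp supp_Std by blast

lemma lm_eqI:
  assumes "a \<in> carrier A" "u \<in> supp a" "\<And>v. v \<in> supp a \<Longrightarrow> v \<preceq> u"
  shows "lm a = u"
  using LM_eqI[OF assms] by (simp add: lm_def)

lemma LM_zero: "LM r \<zero>\<^bsub>A\<^esub> = None"
  by (simp add: LM_def)

text \<open>The form in which bounds on leading monomials are proved: a bound on all monomials of
  \<open>a\<close> survives sums with cancellation and is empty for \<open>a = 0\<close>.\<close>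

lemma lm_le_iff:
  assumes "a \<in> carrier A" "b \<in> carrier A" "b \<noteq> \<zero>\<^bsub>A\<^esub>"
  shows "lm_le r (LM r a) (LM r b) \<longleftrightarrow> (\<forall>v\<in>supp a. v \<preceq> lm b)"
proof (cases "a = \<zero>\<^bsub>A\<^esub>")
  case False
  then show ?thesis using assms lm_props[of a] le_trans
    by (auto simp: LM_eq le_def)
qed (simp add: LM_zero supp_zero)

lemma lm_mon: "u \<in> Std \<Longrightarrow> lm (mon u) = u"
  by (intro lm_eqI) (auto simp: supp_mon le_refl)

text \<open>If \<open>u + v\<close> is standard, the product is the single basis element
  \<open>mon (u + v)\<close>; this is the situation in which leading monomials simply add.\<close>

lemma nz_add: "u + v \<in> Std \<Longrightarrow> nz u v"
  and pm_add: "u + v \<in> Std \<Longrightarrow> pm u v = u + v"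
  by (simp_all add: nz_def pm_def mon_nonzero lm_mon flip: mon_add)

lemma nz_commute: "nz u v \<longleftrightarrow> nz v u"
  and pm_commute: "pm u v = pm v u"
  by (simp_all add: nz_def pm_def A.m_comm)

lemma pm_Std: "nz u v \<Longrightarrow> pm u v \<in> Std"
  by (simp add: nz_def pm_def lm_Std)

lemma pm_max: "v \<in> supp (mon x \<otimes>\<^bsub>A\<^esub> mon y) \<Longrightarrow> nz x y \<and> v \<preceq> pm x y"
  unfolding pm_def nz_def using lm_max[of "mon x \<otimes>\<^bsub>A\<^esub> mon y" v]
  by (cases "mon x \<otimes>\<^bsub>A\<^esub> mon y = \<zero>\<^bsub>A\<^esub>") (auto simp: supp_zero)

lemma pm_less_le: "f \<prec> g \<Longrightarrow> h \<preceq> k \<Longrightarrow> nz f h \<Longrightarrow> nz g k \<Longrightarrow> pm f h \<prec> pm g k"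
  using mult_strict_mono[of f g h k] le_Std[of f g] le_Std[of h k] LM_eq
  unfolding nz_def pm_def lt_def le_def by simp

lemma pm_le_less: "f \<preceq> g \<Longrightarrow> h \<prec> k \<Longrightarrow> nz f h \<Longrightarrow> nz g k \<Longrightarrow> pm f h \<prec> pm g k"
  using pm_less_le[of h k f g] by (simp add: nz_commute pm_commute)

lemma pm_mono: "f \<preceq> g \<Longrightarrow> h \<preceq> k \<Longrightarrow> nz f h \<Longrightarrow> nz g k \<Longrightarrow> pm f h \<preceq> pm g k"
  using pm_less_le[of f g h k] pm_le_less[of f g h k] le_eq_or_lt[of f g] le_eq_or_lt[of h k]
    le_refl[OF pm_Std[of g k]] by (auto dest: lt_le)

text \<open>By totality two different \<open>f\<close>, \<open>g\<close> are strictly comparable,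
  and strict monotonicity keeps their products with \<open>h\<close> apart.\<close>

lemma pm_cancel: "f \<in> Std \<Longrightarrow> g \<in> Std \<Longrightarrow> h \<in> Std \<Longrightarrow> nz f h \<Longrightarrow> nz g h \<Longrightarrow> pm f h = pm g h \<Longrightarrow> f = g"
  by (metis le_eq_or_lt le_refl le_total lt_irrefl pm_less_le)

text \<open>Multiply 1 and \<open>v - u\<close> by \<open>u\<close>. This links the term order with
  Dickson's lemma.\<close>

lemma Std_subset_le: "u \<subseteq># v \<Longrightarrow> v \<in> Std \<Longrightarrow> u \<preceq> v"
proof -
  assume uv: "u \<subseteq># v" "v \<in> Std"
  then have sum: "u + (v - u) = v" by simp
  then have std: "u \<in> Std" "v - u \<in> Std" using uv Std_addD[of u "v - u"] by auto
  then have "{#} \<preceq> v - u" using one_least by (simp add: le_def)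
  then have "pm u {#} \<preceq> pm u (v - u)"
    using std uv sum by (intro pm_mono le_refl nz_add) auto
  then show ?thesis using pm_add[of u "{#}"] pm_add[of u "v - u"] std uv sum by simp
qed

lemma lm_add_dominant:
  assumes "a \<in> carrier A" "a \<noteq> \<zero>\<^bsub>A\<^esub>" "b \<in> carrier A" "\<And>v. v \<in> supp b \<Longrightarrow> v \<prec> lm a"
  shows "a \<oplus>\<^bsub>A\<^esub> b \<noteq> \<zero>\<^bsub>A\<^esub>" and "lm (a \<oplus>\<^bsub>A\<^esub> b) = lm a" and "lm a \<in> supp (a \<oplus>\<^bsub>A\<^esub> b)"
proof -
  have "coord b (lm a) = \<zero>\<^bsub>R\<^esub>" using assms(4)[of "lm a"] by (auto simp: supp_def lt_irrefl)
  then show in_supp: "lm a \<in> supp (a \<oplus>\<^bsub>A\<^esub> b)"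
    using lm_supp[OF assms(1,2)] assms by (simp add: supp_def coord_add)
  then show "a \<oplus>\<^bsub>A\<^esub> b \<noteq> \<zero>\<^bsub>A\<^esub>" by (auto simp: supp_zero)
  show "lm (a \<oplus>\<^bsub>A\<^esub> b) = lm a"
    using in_supp supp_add[OF assms(1,3)] assms lm_max lt_le by (intro lm_eqI) blast+
qed

lemma lm_smult:
  assumes "k \<in> carrier R" "k \<noteq> \<zero>\<^bsub>R\<^esub>" "a \<in> carrier A" "a \<noteq> \<zero>\<^bsub>A\<^esub>"
  shows "k \<odot>\<^bsub>A\<^esub> a \<noteq> \<zero>\<^bsub>A\<^esub>" and "lm (k \<odot>\<^bsub>A\<^esub> a) = lm a"
proof -
  show "k \<odot>\<^bsub>A\<^esub> a \<noteq> \<zero>\<^bsub>A\<^esub>"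
    using supp_smult[OF assms(1-3)] lm_supp[OF assms(3,4)] by (auto simp: supp_zero)
  show "lm (k \<odot>\<^bsub>A\<^esub> a) = lm a"
    using assms lm_supp lm_max by (intro lm_eqI) (auto simp: supp_smult)
qed

lemma split_lm:
  assumes "a \<in> carrier A" "a \<noteq> \<zero>\<^bsub>A\<^esub>"
  obtains b where "b \<in> carrier A" "a = coord a (lm a) \<odot>\<^bsub>A\<^esub> mon (lm a) \<oplus>\<^bsub>A\<^esub> b"
    "\<And>v. v \<in> supp b \<Longrightarrow> v \<prec> lm a"
  using split_term[OF assms(1) lm_supp[OF assms]] lm_max[OF assms] le_eq_or_lt by (metis DiffE insertI1)

text \<open>Let \<open>z\<close> be the largest monomial of \<open>a\<close> that \<open>w\<close>
  does not annihilate. All other surviving products lie strictly below \<open>pm w z\<close>, so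
  this term cannot cancel. The monomial \<open>z\<close> may be smaller than \<open>lm a\<close>,
  which \<open>w\<close> can kill.\<close>

lemma mon_mult_lead:
  assumes "w \<in> Std" "a \<in> carrier A" "y \<in> supp a" "nz w y"
  shows "mon w \<otimes>\<^bsub>A\<^esub> a \<noteq> \<zero>\<^bsub>A\<^esub>" and "pm w y \<preceq> lm (mon w \<otimes>\<^bsub>A\<^esub> a)"
    and "\<exists>z\<in>supp a. nz w z \<and> lm (mon w \<otimes>\<^bsub>A\<^esub> a) = pm w z"
proof -
  let ?U = "{y \<in> supp a. nz w y}"
  obtain z where z: "z \<in> ?U" "\<forall>y\<in>?U. y \<preceq> z"
    using finite_has_max[of ?U] assms finite_supp supp_Std by auto
  define k where "k = coord a z"
  obtain b where b: "b \<in> carrier A" "a = k \<odot>\<^bsub>A\<^esub> mon z \<oplus>\<^bsub>A\<^esub> b" "supp b = supp a - {z}"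
    unfolding k_def using split_term[OF assms(2), of z] z by blast
  have k: "k \<in> carrier R" "k \<noteq> \<zero>\<^bsub>R\<^esub>" using z assms by (auto simp: k_def supp_def)
  have nz: "mon w \<otimes>\<^bsub>A\<^esub> mon z \<noteq> \<zero>\<^bsub>A\<^esub>" using z by (simp add: nz_def)
  let ?t = "k \<odot>\<^bsub>A\<^esub> (mon w \<otimes>\<^bsub>A\<^esub> mon z)"
  have wa: "mon w \<otimes>\<^bsub>A\<^esub> a = ?t \<oplus>\<^bsub>A\<^esub> mon w \<otimes>\<^bsub>A\<^esub> b"
    using b k by (simp add: mult_term_add)
  have t: "?t \<noteq> \<zero>\<^bsub>A\<^esub>" "lm ?t = pm w z" "?t \<in> carrier A"
    using lm_smult[OF k _ nz] k by (auto simp: pm_def)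
  have "v \<prec> lm ?t" if v: "v \<in> supp (mon w \<otimes>\<^bsub>A\<^esub> b)" for v
  proof -
    obtain y where "y \<in> supp b" "v \<in> supp (mon w \<otimes>\<^bsub>A\<^esub> mon y)"
      using v supp_mult[of "mon w" b] b(1) by auto
    then have "y \<prec> z" "nz w y" "v \<preceq> pm w y"
      using pm_max[of v w y] z(2) b le_eq_or_lt by auto
    then show ?thesis using pm_le_less[of w w y z] le_refl assms z t le_lt_trans by auto
  qed
  note dom = lm_add_dominant[OF t(3,1) _ this]
  then have *: "mon w \<otimes>\<^bsub>A\<^esub> a \<noteq> \<zero>\<^bsub>A\<^esub>" "lm (mon w \<otimes>\<^bsub>A\<^esub> a) = pm w z"
    using b wa t by auto
  then show "mon w \<otimes>\<^bsub>A\<^esub> a \<noteq> \<zero>\<^bsub>A\<^esub>" "\<exists>z\<in>supp a. nz w z \<and> lm (mon w \<otimes>\<^bsub>A\<^esub> a) = pm w z"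
    using z by auto
  show "pm w y \<preceq> lm (mon w \<otimes>\<^bsub>A\<^esub> a)"
    unfolding * using assms z le_refl by (intro pm_mono) auto
qed

lemma mon_mult_lm:
  assumes "w \<in> Std" "a \<in> carrier A" "mon w \<otimes>\<^bsub>A\<^esub> a \<noteq> \<zero>\<^bsub>A\<^esub>"
  obtains z where "z \<in> supp a" "nz w z" "lm (mon w \<otimes>\<^bsub>A\<^esub> a) = pm w z"
proof -
  obtain v where "v \<in> supp (mon w \<otimes>\<^bsub>A\<^esub> a)" using lm_supp[OF _ assms(3)] assms(2) by auto
  then obtain y where "y \<in> supp a" "nz w y"
    using supp_mult[of "mon w" a] assms pm_max by fastforce
  then show thesis using mon_mult_lead(3) assms that by blast
qed

lemma mon_mult_lm_add:
  assumes "a \<in> carrier A" "a \<noteq> \<zero>\<^bsub>A\<^esub>" "w + lm a \<in> Std"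
  shows "mon w \<otimes>\<^bsub>A\<^esub> a \<noteq> \<zero>\<^bsub>A\<^esub>" and "lm (mon w \<otimes>\<^bsub>A\<^esub> a) = w + lm a"
proof -
  have w: "w \<in> Std" and nz: "nz w (lm a)" and pm: "pm w (lm a) = w + lm a"
    using Std_addD[OF assms(3)] nz_add[OF assms(3)] pm_add[OF assms(3)] by auto
  note lead = mon_mult_lead[OF w assms(1) lm_supp[OF assms(1,2)] nz]
  show "mon w \<otimes>\<^bsub>A\<^esub> a \<noteq> \<zero>\<^bsub>A\<^esub>" by (rule lead(1))
  obtain z where z: "z \<in> supp a" "nz w z" "lm (mon w \<otimes>\<^bsub>A\<^esub> a) = pm w z"
    using lead(3) by blast
  have "pm w z \<preceq> pm w (lm a)"
    by (rule pm_mono[OF le_refl[OF w] lm_max[OF assms(1,2) z(1)] z(2) nz])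
  with lead(2) z(3) pm show "lm (mon w \<otimes>\<^bsub>A\<^esub> a) = w + lm a" using le_antisym by metis
qed

text \<open>Multiplying \<open>w y\<close> by \<open>d\<close> and by \<open>d'\<close> gives the same leading monomial, the first product being
  \<open>(w + d) y\<close> with \<open>w + d\<close> standard; either order between \<open>d\<close> and \<open>d'\<close> contradicts strict
  monotonicity, applied to the factor \<open>w y\<close> or to the factor \<open>w\<close>.\<close>

lemma padding_unique:
  assumes "y \<in> Std" "w + d \<in> Std" "nz w y" "nz (w + d) y" "pm (w + d) y = pm w y + d'"
  shows "d' = d"
proof -
  have w: "w \<in> Std" and d: "d \<in> Std" using Std_addD[OF assms(2)] by auto
  have z': "pm w y + d' \<in> Std" using pm_Std[OF assms(4)] assms(5) by simp
  then have d': "d' \<in> Std" by (simp add: Std_addD[OF z'])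
  let ?x = "mon w \<otimes>\<^bsub>A\<^esub> mon y"
  have x: "?x \<in> carrier A" "?x \<noteq> \<zero>\<^bsub>A\<^esub>" "lm ?x = pm w y" using assms(3) by (auto simp: nz_def pm_def)
  have dx: "mon d \<otimes>\<^bsub>A\<^esub> ?x = mon (w + d) \<otimes>\<^bsub>A\<^esub> mon y"
    by (simp add: mon_add A.m_ac)
  have d'x: "mon d' \<otimes>\<^bsub>A\<^esub> ?x \<noteq> \<zero>\<^bsub>A\<^esub>" "lm (mon d' \<otimes>\<^bsub>A\<^esub> ?x) = pm w y + d'"
    using mon_mult_lm_add[of ?x d'] x z' by (auto simp: add.commute)
  have "\<not> d \<prec> d'"
  proof
    assume less: "d \<prec> d'"
    obtain v where v: "v \<in> supp ?x" "nz d v" "lm (mon d \<otimes>\<^bsub>A\<^esub> ?x) = pm d v"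
      using mon_mult_lm[of d ?x] d x assms(4) dx by (auto simp: nz_def)
    have "pm d v \<prec> pm d' (pm w y)"
      using less v lm_max[OF x(1,2) v(1)] x(3) nz_add[of d' "pm w y"] z'
      by (intro pm_less_le) (auto simp: add.commute)
    moreover have "pm d v = pm (w + d) y" using v(3) dx by (simp add: pm_def[of "w + d"])
    moreover have "pm d' (pm w y) = pm (w + d) y"
      using pm_add[of d' "pm w y"] z' assms(5) by (simp add: add.commute)
    ultimately show False using lt_irrefl by simp
  qed
  moreover have "\<not> d' \<prec> d"
  proof
    assume less: "d' \<prec> d"
    let ?c = "mon d' \<otimes>\<^bsub>A\<^esub> mon w"
    have cy: "mon y \<otimes>\<^bsub>A\<^esub> ?c = mon d' \<otimes>\<^bsub>A\<^esub> ?x" by (simp add: A.m_ac)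
    obtain t where t: "t \<in> supp ?c" "nz y t" "lm (mon y \<otimes>\<^bsub>A\<^esub> ?c) = pm y t"
      using mon_mult_lm[of y ?c] assms(1) d'x cy by auto
    \<comment> \<open>Cancelling \<open>y\<close> shows that \<open>w + d\<close> itself occurs in
      the product of \<open>d'\<close> and \<open>w\<close>; but every monomial there is at most
      \<open>pm d' w\<close>, which lies strictly below \<open>pm d w\<close>, that is, below
      \<open>w + d\<close>.\<close>
    have "t = w + d"
      using t d'x cy assms pm_cancel[of t "w + d" y] supp_Std[of ?c]
      by (auto simp: pm_commute nz_commute)
    moreover have "nz d' w" "t \<preceq> pm d' w" using pm_max[OF t(1)] by auto
    moreover have "pm d' w \<prec> pm d w"
      using less calculation(2) le_refl[OF w] nz_add[of d w] assms(2)
      by (intro pm_less_le) (auto simp: add.commute)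
    ultimately show False
      using pm_add[of d w] assms(2) le_lt_trans lt_irrefl by (metis add.commute)
  qed
  ultimately show ?thesis using le_total[OF d d'] le_eq_or_lt by blast
qed

end

section \<open>Dickson's lemma and division\<close>

text \<open>A monotone subsequence exists; if it is nonincreasing, it is constant from the index
  \<open>N\<close> of its minimum on.\<close>

lemma nat_nondecreasing_subseq:
  fixes s :: "nat \<Rightarrow> nat"
  shows "\<exists>\<phi> :: nat \<Rightarrow> nat. strict_mono \<phi> \<and> (\<forall>i j. i \<le> j \<longrightarrow> s (\<phi> i) \<le> s (\<phi> j))"
proof -
  obtain \<phi> where \<phi>: "strict_mono (\<phi> :: nat \<Rightarrow> nat)" "monoseq (\<lambda>n. s (\<phi> n))"
    using seq_monosub by blast
  show ?thesis
  proof (cases "\<forall>i j. i \<le> j \<longrightarrow> s (\<phi> i) \<le> s (\<phi> j)")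
    case False
    with \<phi>(2) have dec: "i \<le> j \<Longrightarrow> s (\<phi> j) \<le> s (\<phi> i)" for i j
      unfolding monoseq_def by blast
    obtain N where N: "s (\<phi> N) \<le> s (\<phi> i)" for i
      using ex_has_least_nat[of "\<lambda>_. True" 0 "\<lambda>i. s (\<phi> i)"] by auto
    have "strict_mono (\<lambda>i. \<phi> (N + i))" using \<phi>(1) by (simp add: strict_mono_def)
    moreover have "s (\<phi> (N + i)) \<le> s (\<phi> (N + j))" for i j
      using dec[of N "N + i"] N[of "N + j"] by simp
    ultimately show ?thesis by (intro exI[of _ "\<lambda>i. \<phi> (N + i)"]) simp
  qed (use \<phi> in blast)
qed

text \<open>Subsequences are refined once per element of \<open>H\<close>. Producing a whole
  ascending subsequence, not just one pair, lets the result be applied again along it.\<close>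

lemma dickson_subseq:
  fixes s :: "nat \<Rightarrow> 'h multiset"
  assumes "finite H" "\<And>n. set_mset (s n) \<subseteq> H"
  shows "\<exists>\<phi> :: nat \<Rightarrow> nat. strict_mono \<phi> \<and> (\<forall>i j. i \<le> j \<longrightarrow> s (\<phi> i) \<subseteq># s (\<phi> j))"
proof -
  have "\<exists>\<phi> :: nat \<Rightarrow> nat. strict_mono \<phi> \<and> (\<forall>h\<in>H. \<forall>i j. i \<le> j \<longrightarrow> count (s (\<phi> i)) h \<le> count (s (\<phi> j)) h)"
    using assms(1)
  proof (induction H rule: finite_induct)
    case empty
    show ?case by (intro exI[of _ "\<lambda>n. n"]) (simp add: strict_mono_def)
  next
    case (insert x F)
    then obtain \<phi> where \<phi>: "strict_mono (\<phi> :: nat \<Rightarrow> nat)"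
        "\<forall>h\<in>F. \<forall>i j. i \<le> j \<longrightarrow> count (s (\<phi> i)) h \<le> count (s (\<phi> j)) h"
      by blast
    obtain \<psi> where \<psi>: "strict_mono (\<psi> :: nat \<Rightarrow> nat)" "\<forall>i j. i \<le> j \<longrightarrow> count (s (\<phi> (\<psi> i))) x \<le> count (s (\<phi> (\<psi> j))) x"
      using nat_nondecreasing_subseq[of "\<lambda>i. count (s (\<phi> i)) x"] by blast
    have "strict_mono (\<lambda>i. \<phi> (\<psi> i))" using \<phi>(1) \<psi>(1) by (simp add: strict_mono_def)
    moreover have "i \<le> j \<Longrightarrow> \<psi> i \<le> \<psi> j" for i j using \<psi>(1) by (simp add: strict_mono_less_eq)
    ultimately show ?case using \<phi> \<psi> by (intro exI[of _ "\<lambda>i. \<phi> (\<psi> i)"]) auto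
  qed
  then obtain \<phi> where \<phi>: "strict_mono (\<phi> :: nat \<Rightarrow> nat)"
    "\<forall>h\<in>H. \<forall>i j. i \<le> j \<longrightarrow> count (s (\<phi> i)) h \<le> count (s (\<phi> j)) h"
    by blast
  have "s (\<phi> i) \<subseteq># s (\<phi> j)" if "i \<le> j" for i j
  proof (rule mset_subset_eqI)
    show "count (s (\<phi> i)) h \<le> count (s (\<phi> j)) h" for h
    proof (cases "h \<in> H")
      case False
      then have "count (s (\<phi> i)) h = 0" using assms(2)[of "\<phi> i"] by (meson count_eq_zero_iff subsetD)
      then show ?thesis by simp
    qed (use \<phi>(2) that in blast)
  qed
  with \<phi>(1) show ?thesis by blast
qed

lemma constant_subseq:
  assumes "finite (range l)"
  shows "\<exists>\<phi>. strict_mono (\<phi> :: nat \<Rightarrow> nat) \<and> (\<forall>i j. l (\<phi> i) = l (\<phi> j))"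
proof -
  obtain y where "infinite (l -` {y} \<inter> UNIV)"
    using inf_img_fin_dom[OF assms infinite_UNIV_nat] by auto
  then have inf: "infinite {i. l i = y}" by (simp add: vimage_def)
  have "l (enumerate {i. l i = y} i) = y" for i using enumerate_in_set[OF inf, of i] by simp
  with strict_mono_enumerate[OF inf] show ?thesis by auto
qed

lemma dickson_pairs:
  fixes s t :: "nat \<Rightarrow> 'h multiset"
  assumes "finite H" "\<And>n. set_mset (s n) \<subseteq> H" "\<And>n. set_mset (t n) \<subseteq> H" "finite (range l)"
  shows "\<exists>i j. i < j \<and> s i \<subseteq># s j \<and> t i \<subseteq># t j \<and> l i = l j"
proof -
  obtain \<phi> where \<phi>: "strict_mono (\<phi> :: nat \<Rightarrow> nat)" "\<And>i j. l (\<phi> i) = l (\<phi> j)"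
    using constant_subseq[OF assms(4)] by blast
  obtain \<psi> where \<psi>: "strict_mono (\<psi> :: nat \<Rightarrow> nat)" "\<And>i j. i \<le> j \<Longrightarrow> s (\<phi> (\<psi> i)) \<subseteq># s (\<phi> (\<psi> j))"
    using dickson_subseq[OF assms(1), of "\<lambda>i. s (\<phi> i)"] assms(2) by blast
  obtain \<chi> where \<chi>: "strict_mono (\<chi> :: nat \<Rightarrow> nat)" "\<And>i j. i \<le> j \<Longrightarrow> t (\<phi> (\<psi> (\<chi> i))) \<subseteq># t (\<phi> (\<psi> (\<chi> j)))"
    using dickson_subseq[OF assms(1), of "\<lambda>i. t (\<phi> (\<psi> i))"] assms(3) by blast
  have "\<phi> (\<psi> (\<chi> 0)) < \<phi> (\<psi> (\<chi> 1))"
    using \<phi>(1) \<psi>(1) \<chi>(1) by (simp add: strict_mono_less)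
  moreover have "\<chi> 0 \<le> \<chi> 1" using \<chi>(1) by (simp add: strict_mono_less_eq)
  ultimately show ?thesis using \<phi>(2) \<psi>(2) \<chi>(2)[of 0 1] by (metis zero_le)
qed

text \<open>\<open>Q\<close> is an arbitrary relation, so minimal elements are of no use. If no
  finite \<open>Y\<close> served, one could choose again and again an element that no earlier choice
  dominates, and this sequence would contradict \<open>wqo\<close>.\<close>

lemma finite_basis_of_wqo:
  fixes Q :: "'c \<Rightarrow> 'c \<Rightarrow> bool"
  assumes wqo: "\<And>s :: nat \<Rightarrow> 'c. (\<And>n. s n \<in> D) \<Longrightarrow> \<exists>i j. i < j \<and> Q (s i) (s j)"
  shows "\<exists>Y. finite Y \<and> Y \<subseteq> D \<and> (\<forall>x\<in>D. \<exists>y\<in>Y. Q y x)"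
proof (rule ccontr)
  assume no: "\<not> (\<exists>Y. finite Y \<and> Y \<subseteq> D \<and> (\<forall>x\<in>D. \<exists>y\<in>Y. Q y x))"
  define bad where "bad Y = (SOME x. x \<in> D \<and> (\<forall>y\<in>Y. \<not> Q y x))" for Y
  have bad: "bad Y \<in> D \<and> (\<forall>y\<in>Y. \<not> Q y (bad Y))" if "finite Y" "Y \<subseteq> D" for Y
  proof -
    have "\<not> (finite Y \<and> Y \<subseteq> D \<and> (\<forall>x\<in>D. \<exists>y\<in>Y. Q y x))" by (rule no[unfolded not_ex, THEN spec])
    with that have "\<exists>x. x \<in> D \<and> (\<forall>y\<in>Y. \<not> Q y x)" by auto
    then show ?thesis unfolding bad_def by (rule someI_ex)
  qed
  define U where "U n = ((\<lambda>Y. insert (bad Y) Y) ^^ n) {}" for n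
  have U0: "U 0 = {}" and US: "U (Suc n) = insert (bad (U n)) (U n)" for n
    by (simp_all add: U_def)
  have U: "finite (U n) \<and> U n \<subseteq> D" for n
  proof (induction n)
    case (Suc n)
    then show ?case using bad[of "U n"] US[of n] by simp
  qed (simp add: U0)
  have mem: "bad (U i) \<in> U j" if "i < j" for i j
    using that
  proof (induction j)
    case (Suc j)
    then show ?case using US[of j] by (auto simp: less_Suc_eq)
  qed simp
  have "bad (U n) \<in> D" for n using bad[of "U n"] U[of n] by blast
  then obtain i j where ij: "i < j" "Q (bad (U i)) (bad (U j))"
    using wqo[of "\<lambda>n. bad (U n)"] by blast
  have "\<not> Q (bad (U i)) (bad (U j))" using bad[of "U j"] U[of j] mem[OF ij(1)] by blast
  with ij(2) show False by blast
qed

context pseudo_ASL_term_order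
begin

lemma Mon_iff: "m \<in> Mon \<longleftrightarrow> set_mset m \<subseteq> H"
  by (simp add: Mon_def)

text \<open>In a descending sequence Dickson's lemma finds an earlier monomial contained in a later
  one, and containment implies \<preceq>.\<close>

lemma wf_lt: "wfP (\<prec>)"
  unfolding wfp_def wf_iff_no_infinite_down_chain
proof
  assume "\<exists>f. \<forall>i. (f (Suc i), f i) \<in> {(x, y). x \<prec> y}"
  then obtain f where f: "\<And>i. f (Suc i) \<prec> f i" by blast
  have std: "f i \<in> Std" for i using le_Std[OF lt_le[OF f]] by blast
  have dec: "f j \<prec> f i" if "i < j" for i j
    using that
  proof (induction j)
    case (Suc j)
    then show ?case using f[of j] le_lt_trans[OF lt_le[OF f[of j]], of "f i"] by (auto simp: less_Suc_eq)
  qed simp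
  obtain \<phi> where \<phi>: "strict_mono (\<phi> :: nat \<Rightarrow> nat)" "\<And>i j. i \<le> j \<Longrightarrow> f (\<phi> i) \<subseteq># f (\<phi> j)"
    using dickson_subseq[OF finite_H, of f] Std_Mon[OF std] Mon_iff by blast
  have "f (\<phi> 0) \<preceq> f (\<phi> 1)" using \<phi>(2) std by (intro Std_subset_le) auto
  moreover have "f (\<phi> 1) \<prec> f (\<phi> 0)" using dec \<phi>(1) by (simp add: strict_mono_less)
  ultimately show False using le_lt_trans lt_irrefl by blast
qed

definition dv :: "'a list \<Rightarrow> 'h multiset \<Rightarrow> 'a option"
  where "dv W u = find (\<lambda>g. g \<noteq> \<zero>\<^bsub>A\<^esub> \<and> lm g \<subseteq># u) W"

text \<open>The multiple of the chosen divisor that cancels \<open>u\<close>. It is not normalised: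
  its leading coefficient is that of the divisor. Without a divisor it is an arbitrary
  value.\<close>

definition red :: "'a list \<Rightarrow> 'h multiset \<Rightarrow> 'a"
  where "red W u = mon (u - lm (the (dv W u))) \<otimes>\<^bsub>A\<^esub> the (dv W u)"

lemma dvD: "dv W u = Some g \<Longrightarrow> g \<in> set W \<and> g \<noteq> \<zero>\<^bsub>A\<^esub> \<and> lm g \<subseteq># u"
  unfolding dv_def by (auto simp: find_Some_iff)

lemma dv_None_iff: "dv W u = None \<longleftrightarrow> (\<forall>g\<in>set W. g \<noteq> \<zero>\<^bsub>A\<^esub> \<longrightarrow> \<not> lm g \<subseteq># u)"
  unfolding dv_def by (auto simp: find_None_iff)

text \<open>Elements before \<open>g\<close> do not divide \<open>u\<close>, hence not
  \<open>v\<close> either; so \<open>g\<close> is first for \<open>v\<close> once it divides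
  \<open>v\<close>. The certificate test compares two divisors through this single
  containment.\<close>

lemma dv_eq_iff:
  assumes "dv W u = Some g" "v \<subseteq># u" "dv W v \<noteq> None"
  shows "dv W u = dv W v \<longleftrightarrow> lm g \<subseteq># v"
proof
  assume "lm g \<subseteq># v"
  then show "dv W u = dv W v" using assms unfolding dv_def
  proof (induction W)
    case (Cons a W)
    show ?case
    proof (cases "a \<noteq> \<zero>\<^bsub>A\<^esub> \<and> lm a \<subseteq># u")
      case True
      then show ?thesis using Cons.prems by simp
    next
      case False
      then have "\<not> (a \<noteq> \<zero>\<^bsub>A\<^esub> \<and> lm a \<subseteq># v)" using assms(2) subset_mset.order_trans by blast
      then have "find (\<lambda>g. g \<noteq> \<zero>\<^bsub>A\<^esub> \<and> lm g \<subseteq># v) (a # W) = find (\<lambda>g. g \<noteq> \<zero>\<^bsub>A\<^esub> \<and> lm g \<subseteq># v) W"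
        unfolding find.simps by (rule if_not_P)
      moreover have "find (\<lambda>g. g \<noteq> \<zero>\<^bsub>A\<^esub> \<and> lm g \<subseteq># u) (a # W) = find (\<lambda>g. g \<noteq> \<zero>\<^bsub>A\<^esub> \<and> lm g \<subseteq># u) W"
        using False unfolding find.simps by (rule if_not_P)
      ultimately show ?thesis using Cons by metis
    qed
  qed simp
qed (use assms dvD in auto)

text \<open>The elements that the division algorithm by \<open>W\<close>, cancelling leading terms with the first
  possible divisor in the list, reduces to zero.\<close>

inductive reduces :: "'a list \<Rightarrow> 'a \<Rightarrow> bool" for W where
  zero: "reduces W \<zero>\<^bsub>A\<^esub>"
| step: "u \<in> Std \<Longrightarrow> dv W u \<noteq> None \<Longrightarrow> k \<in> carrier R \<Longrightarrow> k \<noteq> \<zero>\<^bsub>R\<^esub> \<Longrightarrow> reduces W f \<Longrightarrow>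
    (\<forall>v\<in>supp f. v \<prec> u) \<Longrightarrow> reduces W (k \<odot>\<^bsub>A\<^esub> red W u \<oplus>\<^bsub>A\<^esub> f)"

lemma red_props:
  assumes "set W \<subseteq> carrier A" "u \<in> Std" "dv W u \<noteq> None"
  shows red_closed: "red W u \<in> carrier A" and red_nonzero: "red W u \<noteq> \<zero>\<^bsub>A\<^esub>" and lm_red: "lm (red W u) = u"
proof -
  obtain g where g: "dv W u = Some g" using assms by blast
  note d = dvD[OF g]
  have gc: "g \<in> carrier A" using d assms by blast
  have sum: "(u - lm g) + lm g \<in> Std" using d assms by simp
  show "red W u \<in> carrier A" "red W u \<noteq> \<zero>\<^bsub>A\<^esub>" "lm (red W u) = u"
    using mon_mult_lm_add[OF gc _ sum] d gc by (auto simp: red_def g)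
qed

context
  fixes W :: "'a list"
  assumes W: "set W \<subseteq> carrier A"
begin

lemma reduces_closed: "reduces W f \<Longrightarrow> f \<in> carrier A"
  by (induction rule: reduces.induct) (auto simp: red_closed[OF W])

lemma reduces_step_lm:
  assumes "u \<in> Std" "dv W u \<noteq> None" "k \<in> carrier R" "k \<noteq> \<zero>\<^bsub>R\<^esub>" "reduces W f" "\<forall>v\<in>supp f. v \<prec> u"
  shows "k \<odot>\<^bsub>A\<^esub> red W u \<oplus>\<^bsub>A\<^esub> f \<noteq> \<zero>\<^bsub>A\<^esub>" and "lm (k \<odot>\<^bsub>A\<^esub> red W u \<oplus>\<^bsub>A\<^esub> f) = u"
proof -
  note red = red_props[OF W assms(1,2)]
  have t: "k \<odot>\<^bsub>A\<^esub> red W u \<noteq> \<zero>\<^bsub>A\<^esub>" "lm (k \<odot>\<^bsub>A\<^esub> red W u) = u"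
    using lm_smult assms red by auto
  show "k \<odot>\<^bsub>A\<^esub> red W u \<oplus>\<^bsub>A\<^esub> f \<noteq> \<zero>\<^bsub>A\<^esub>" "lm (k \<odot>\<^bsub>A\<^esub> red W u \<oplus>\<^bsub>A\<^esub> f) = u"
    using lm_add_dominant[OF _ t(1) reduces_closed[OF assms(5)]] t(2) assms red(1) by auto
qed

lemma reduces_lm:
  assumes "reduces W f" "f \<noteq> \<zero>\<^bsub>A\<^esub>"
  obtains k f' where "dv W (lm f) \<noteq> None" "k \<in> carrier R" "k \<noteq> \<zero>\<^bsub>R\<^esub>" "reduces W f'"
    "\<forall>v\<in>supp f'. v \<prec> lm f" "f = k \<odot>\<^bsub>A\<^esub> red W (lm f) \<oplus>\<^bsub>A\<^esub> f'"
  using assms reduces_step_lm(2) by (cases rule: reduces.cases) auto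

lemma reduces_smult:
  assumes "reduces W f" "k \<in> carrier R"
  shows "reduces W (k \<odot>\<^bsub>A\<^esub> f)"
proof (cases "k = \<zero>\<^bsub>R\<^esub>")
  case True
  then show ?thesis using reduces_closed[OF assms(1)] by (simp add: reduces.zero)
next
  case False
  with assms(1) show ?thesis
  proof (induction rule: reduces.induct)
    case zero
    then show ?case using assms by (simp add: reduces.zero)
  next
    case (step u c f)
    note cl = red_closed[OF W step.hyps(1,2)] reduces_closed[OF step.hyps(5)]
    have "k \<odot>\<^bsub>A\<^esub> (c \<odot>\<^bsub>A\<^esub> red W u \<oplus>\<^bsub>A\<^esub> f) = (k \<otimes>\<^bsub>R\<^esub> c) \<odot>\<^bsub>A\<^esub> red W u \<oplus>\<^bsub>A\<^esub> k \<odot>\<^bsub>A\<^esub> f"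
      using assms step cl by (simp add: A.smult_r_distr A.smult_assoc1)
    then show ?case
      using step assms supp_smult_subset[of k f] cl
      by (auto intro!: reduces.step simp: integral_iff)
  qed
qed

text \<open>Compare \<open>u\<close> with the leading monomial \<open>u'\<close> of the reduction:
  the new step goes in front, further down, or onto the same \<open>red W u\<close>, where
  coefficients merge and may cancel. The last case relies on the divisor being a function of the
  monomial.\<close>

lemma reduces_insert:
  assumes "reduces W f" "u \<in> Std" "dv W u \<noteq> None" "k \<in> carrier R" "k \<noteq> \<zero>\<^bsub>R\<^esub>"
  shows "reduces W (k \<odot>\<^bsub>A\<^esub> red W u \<oplus>\<^bsub>A\<^esub> f)"
  using assms(1)
proof (induction rule: reduces.induct)
  case zero
  then show ?case using assms by (intro reduces.step reduces.zero) (auto simp: supp_zero)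
next
  case (step u' k' f)
  let ?t = "k \<odot>\<^bsub>A\<^esub> red W u" and ?t' = "k' \<odot>\<^bsub>A\<^esub> red W u'"
  note lm = reduces_step_lm[OF step.hyps]
  have f: "f \<in> carrier A" using step.hyps reduces_closed by blast
  have t: "?t \<in> carrier A" "?t' \<in> carrier A" using red_closed[OF W] assms step.hyps by auto
  have r': "reduces W (?t' \<oplus>\<^bsub>A\<^esub> f)" by (rule reduces.step[OF step.hyps])
  consider "u' \<prec> u" | "u \<prec> u'" | "u = u'" using le_total[of u u'] le_eq_or_lt assms step.hyps by blast
  then show ?case
  proof cases
    case 1
    have "\<forall>v\<in>supp (?t' \<oplus>\<^bsub>A\<^esub> f). v \<prec> u"
      using lm_max[of "?t' \<oplus>\<^bsub>A\<^esub> f"] lm t f 1 le_lt_trans by auto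
    then show ?thesis by (rule reduces.step[OF assms(2-5) r'])
  next
    case 2
    have eq: "?t \<oplus>\<^bsub>A\<^esub> (?t' \<oplus>\<^bsub>A\<^esub> f) = ?t' \<oplus>\<^bsub>A\<^esub> (?t \<oplus>\<^bsub>A\<^esub> f)" using t f by (rule A.M.a_lcomm)
    have "\<forall>v\<in>supp (?t \<oplus>\<^bsub>A\<^esub> f). v \<prec> u'"
    proof
      fix v assume "v \<in> supp (?t \<oplus>\<^bsub>A\<^esub> f)"
      then consider "v \<in> supp (red W u)" | "v \<in> supp f"
        using supp_add[OF t(1) f] supp_smult[OF assms(4,5) red_closed[OF W assms(2,3)]] by blast
      then show "v \<prec> u'"
        using 2 step.hyps(6) lm_max[OF red_props(1,2)[OF W assms(2,3)]] lm_red[OF W assms(2,3)]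
          le_lt_trans[of v u u'] by cases auto
    qed
    then show ?thesis unfolding eq by (rule reduces.step[OF step.hyps(1-4) step.IH])
  next
    case 3
    have eq: "?t \<oplus>\<^bsub>A\<^esub> (?t' \<oplus>\<^bsub>A\<^esub> f) = (k \<oplus>\<^bsub>R\<^esub> k') \<odot>\<^bsub>A\<^esub> red W u \<oplus>\<^bsub>A\<^esub> f"
      using assms step.hyps t f 3 red_closed[OF W assms(2,3)]
      by (simp add: A.smult_l_distr A.M.a_assoc)
    show ?thesis
    proof (cases "k \<oplus>\<^bsub>R\<^esub> k' = \<zero>\<^bsub>R\<^esub>")
      case True
      then show ?thesis unfolding eq using step.hyps f red_closed[OF W assms(2,3)] by simp
    next
      case False
      show ?thesis unfolding eq
        using step.hyps(4,6) 3 by (intro reduces.step[OF assms(2,3) _ False step.hyps(5)]) (auto simp: assms step.hyps)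
    qed
  qed
qed

lemma reduces_add:
  assumes "reduces W f" "reduces W g"
  shows "reduces W (f \<oplus>\<^bsub>A\<^esub> g)"
  using assms(1)
proof (induction rule: reduces.induct)
  case zero
  then show ?case using assms(2) reduces_closed by simp
next
  case (step u k f)
  have "k \<odot>\<^bsub>A\<^esub> red W u \<oplus>\<^bsub>A\<^esub> f \<oplus>\<^bsub>A\<^esub> g = k \<odot>\<^bsub>A\<^esub> red W u \<oplus>\<^bsub>A\<^esub> (f \<oplus>\<^bsub>A\<^esub> g)"
    using step.hyps red_closed[OF W] reduces_closed assms(2) by (simp add: A.M.a_assoc)
  then show ?case using step reduces_insert by simp
qed

lemma reduces_mult:
  assumes "a \<in> carrier A" "g \<in> carrier A" "\<And>t. t \<in> supp a \<Longrightarrow> reduces W (mon t \<otimes>\<^bsub>A\<^esub> g)"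
  shows "reduces W (a \<otimes>\<^bsub>A\<^esub> g)"
  using assms(1)
proof (induction rule: elem_induct)
  case zero
  then show ?case using assms by (simp add: reduces.zero)
next
  case (step k u b)
  have "(k \<odot>\<^bsub>A\<^esub> mon u \<oplus>\<^bsub>A\<^esub> b) \<otimes>\<^bsub>A\<^esub> g = k \<odot>\<^bsub>A\<^esub> (mon u \<otimes>\<^bsub>A\<^esub> g) \<oplus>\<^bsub>A\<^esub> b \<otimes>\<^bsub>A\<^esub> g"
    using step.hyps assms by (simp add: A.l_distr A.smult_assoc2)
  then show ?case using step assms reduces_add reduces_smult by simp
qed

end

end

section \<open>A finite certificate for the division algorithm\<close>

context pseudo_ASL_term_order
begin

text \<open>A vanishing product is allowed because then \<open>w g\<close> vanishes too. Otherwise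
  the second clause ensures that the leading step of a reduction of \<open>w\<^sub>0 g\<close>,
  multiplied by \<open>w - w\<^sub>0\<close>, is again a division step.\<close>

definition pads :: "'a list \<Rightarrow> 'a \<Rightarrow> 'h multiset \<Rightarrow> 'h multiset \<Rightarrow> bool"
  where "pads W g w\<^sub>0 w \<longleftrightarrow> w\<^sub>0 \<subseteq># w \<and> (mon w\<^sub>0 \<otimes>\<^bsub>A\<^esub> g = \<zero>\<^bsub>A\<^esub> \<or>
    lm (mon w\<^sub>0 \<otimes>\<^bsub>A\<^esub> g) + (w - w\<^sub>0) \<in> Std \<and>
    dv W (lm (mon w\<^sub>0 \<otimes>\<^bsub>A\<^esub> g) + (w - w\<^sub>0)) = dv W (lm (mon w\<^sub>0 \<otimes>\<^bsub>A\<^esub> g)))"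

context
  fixes W :: "'a list"
  assumes W: "set W \<subseteq> carrier A"
begin

text \<open>The expression of \<open>\<tau> g\<close> has small terms because \<open>d (m y)\<close> is bounded for every \<open>y\<close> in \<open>g\<close>,
  even if \<open>\<tau>\<close> annihilates the leading monomial of \<open>g\<close>.\<close>

lemma reduces_tail:
  assumes IH: "\<And>t g. t \<in> Std \<Longrightarrow> g \<in> set W \<Longrightarrow> mon t \<otimes>\<^bsub>A\<^esub> g \<noteq> \<zero>\<^bsub>A\<^esub> \<Longrightarrow> lm (mon t \<otimes>\<^bsub>A\<^esub> g) \<prec> d + v \<Longrightarrow>
      reduces W (mon t \<otimes>\<^bsub>A\<^esub> g)"
    and dv_Std: "d + v \<in> Std"
    and f: "reduces W f" "\<forall>x\<in>supp f. x \<prec> v"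
  shows "reduces W (mon d \<otimes>\<^bsub>A\<^esub> f)"
  using f
proof (induction rule: reduces.induct)
  case zero
  then show ?case by (simp add: reduces.zero)
next
  case (step u k f)
  have d: "d \<in> Std" using Std_addD[OF dv_Std] by simp
  note lm = reduces_step_lm[OF W step.hyps]
  have cl: "f \<in> carrier A" "red W u \<in> carrier A"
    using reduces_closed[OF W step.hyps(5)] red_closed[OF W step.hyps(1,2)] by auto
  have "u \<in> supp (k \<odot>\<^bsub>A\<^esub> red W u \<oplus>\<^bsub>A\<^esub> f)"
    using lm_supp[OF _ lm(1)] lm(2) cl step.hyps(3) by simp
  then have uv: "u \<prec> v" using step.prems by blast
  have "\<forall>x\<in>supp f. x \<prec> v" using step.hyps(6) uv le_lt_trans[OF lt_le] by blast
  then have f: "reduces W (mon d \<otimes>\<^bsub>A\<^esub> f)" by (rule step.IH)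
  obtain g where g: "dv W u = Some g" using step.hyps(2) by blast
  note gp = dvD[OF g]
  have gc: "g \<in> carrier A" using gp W by blast
  define m where "m = u - lm g"
  have m: "m + lm g = u" "m + lm g \<in> Std" "m \<in> Std" using gp step.hyps(1) Std_addD[of m "lm g"] by (auto simp: m_def)
  let ?c = "mon d \<otimes>\<^bsub>A\<^esub> mon m"
  \<comment> \<open>The product of \<open>d\<close> and \<open>m\<close> need not be a standard
    monomial; it is expanded, and \<open>IH\<close> is applied to \<open>t g\<close> for each of its
    monomials \<open>t\<close>.\<close>
  have "reduces W (?c \<otimes>\<^bsub>A\<^esub> g)"
  proof (rule reduces_mult[OF W _ gc])
    fix t assume t: "t \<in> supp ?c"
    have tS: "t \<in> Std" using t supp_Std[of ?c] by auto
    show "reduces W (mon t \<otimes>\<^bsub>A\<^esub> g)"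
    proof (cases "mon t \<otimes>\<^bsub>A\<^esub> g = \<zero>\<^bsub>A\<^esub>")
      case True
      then show ?thesis by (simp add: reduces.zero)
    next
      case False
      obtain y where y: "y \<in> supp g" "nz t y" "lm (mon t \<otimes>\<^bsub>A\<^esub> g) = pm t y"
        using mon_mult_lm[OF tS gc False] by blast
      have yS: "y \<in> Std" using y(1) supp_Std[OF gc] by blast
      \<comment> \<open>Reading \<open>y (d m)\<close> as \<open>d (m y)\<close> bounds the product:
        \<open>LM(t y)\<close> is at most \<open>LM(d (m y)) = LM(d z)\<close> for some
        \<open>z\<close> occurring in \<open>m y\<close>, and \<open>z\<close> is at most
        \<open>LM(m LM(g)) = u\<close>, which is below \<open>v\<close>.\<close>
      note lead = mon_mult_lead[of y ?c t, OF yS _ t] 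
      have cy: "mon y \<otimes>\<^bsub>A\<^esub> ?c = mon d \<otimes>\<^bsub>A\<^esub> (mon m \<otimes>\<^bsub>A\<^esub> mon y)" by (simp add: A.m_ac)
      have ne: "mon d \<otimes>\<^bsub>A\<^esub> (mon m \<otimes>\<^bsub>A\<^esub> mon y) \<noteq> \<zero>\<^bsub>A\<^esub>"
        and le1: "pm t y \<preceq> lm (mon d \<otimes>\<^bsub>A\<^esub> (mon m \<otimes>\<^bsub>A\<^esub> mon y))"
        using lead(1,2) y(2) cy by (simp_all add: nz_commute pm_commute)
      obtain z where z: "z \<in> supp (mon m \<otimes>\<^bsub>A\<^esub> mon y)" "nz d z"
          "lm (mon d \<otimes>\<^bsub>A\<^esub> (mon m \<otimes>\<^bsub>A\<^esub> mon y)) = pm d z"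
        using mon_mult_lm[OF d _ ne] by auto
      have zm: "nz m y" "z \<preceq> pm m y" using pm_max[OF z(1)] by auto
      have "pm m y \<preceq> pm m (lm g)"
        using pm_mono[OF le_refl[OF m(3)] lm_max[OF gc _ y(1)] zm(1) nz_add[OF m(2)]] gp by simp
      then have "z \<prec> v"
        using zm(2) pm_add[OF m(2)] m(1) uv le_trans le_lt_trans by metis
      then have "pm d z \<prec> pm d v" by (rule pm_le_less[OF le_refl[OF d] _ z(2) nz_add[OF dv_Std]])
      then have "lm (mon t \<otimes>\<^bsub>A\<^esub> g) \<prec> d + v"
        using le1 y(3) z(3) pm_add[OF dv_Std] le_lt_trans by metis
      then show ?thesis using IH[OF tS _ False] gp by blast
    qed
  qed simp
  moreover have "mon d \<otimes>\<^bsub>A\<^esub> red W u = ?c \<otimes>\<^bsub>A\<^esub> g"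
    using gc by (simp add: red_def g m_def A.m_assoc)
  ultimately have "reduces W (mon d \<otimes>\<^bsub>A\<^esub> red W u)" by simp
  then show ?case
    using f step.hyps(3) cl reduces_add[OF W reduces_smult[OF W]] by (simp add: mult_term_add)
qed

text \<open>The induction runs over \<open>l = LM(w g)\<close> with \<open>w\<close> and
  \<open>g\<close> both free, since the tail of one reduction produces multiples of other elements
  of \<open>W\<close>. Zero products have no leading monomial and are settled apart.\<close>

theorem reduces_multiples:
  assumes cert: "\<And>g w. g \<in> set W \<Longrightarrow> w \<in> Std \<Longrightarrow>
      \<exists>w\<^sub>0. pads W g w\<^sub>0 w \<and> reduces W (mon w\<^sub>0 \<otimes>\<^bsub>A\<^esub> g)"
    and "g \<in> set W" "w \<in> Std"
  shows "reduces W (mon w \<otimes>\<^bsub>A\<^esub> g)"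
proof -
  have "reduces W (mon w \<otimes>\<^bsub>A\<^esub> g)"
    if "w \<in> Std" "g \<in> set W" "mon w \<otimes>\<^bsub>A\<^esub> g \<noteq> \<zero>\<^bsub>A\<^esub>" "lm (mon w \<otimes>\<^bsub>A\<^esub> g) = l" for l w g
    using that
  proof (induction l arbitrary: w g rule: wfp_induct_rule[OF wf_lt])
    case (1 l)
    have gc: "g \<in> carrier A" using 1 W by blast
    obtain w0 where w0: "pads W g w0 w" "reduces W (mon w0 \<otimes>\<^bsub>A\<^esub> g)" using cert 1 by blast
    let ?x = "mon w0 \<otimes>\<^bsub>A\<^esub> g" and ?v = "lm (mon w0 \<otimes>\<^bsub>A\<^esub> g)"
    define d where "d = w - w0"
    have w: "w = d + w0" using w0(1) by (simp add: pads_def d_def)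
    have wg: "mon w \<otimes>\<^bsub>A\<^esub> g = mon d \<otimes>\<^bsub>A\<^esub> ?x" using gc by (simp add: w mon_add A.m_assoc)
    have x0: "?x \<noteq> \<zero>\<^bsub>A\<^esub>" using "1.prems"(3) wg by auto
    have "?v + (w - w0) \<in> Std \<and> dv W (?v + (w - w0)) = dv W ?v"
      using w0(1) x0 unfolding pads_def by blast
    then have std: "d + ?v \<in> Std" and dv: "dv W (d + ?v) = dv W ?v"
      by (simp_all only: d_def add.commute[of "w - w0"])
    have xc: "?x \<in> carrier A" using gc by simp
    have vS: "?v \<in> Std" using Std_addD[OF std] by simp
    have l: "l = d + ?v" using mon_mult_lm_add(2)[OF xc x0 std] wg "1.prems"(4) by simp
    obtain k f where kf: "dv W ?v \<noteq> None" "k \<in> carrier R" "k \<noteq> \<zero>\<^bsub>R\<^esub>" "reduces W f"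
        "\<forall>x\<in>supp f. x \<prec> ?v" "?x = k \<odot>\<^bsub>A\<^esub> red W ?v \<oplus>\<^bsub>A\<^esub> f"
      using reduces_lm[OF W w0(2) x0] by metis
    have tail: "reduces W (mon d \<otimes>\<^bsub>A\<^esub> f)"
      by (rule reduces_tail[OF _ std kf(4,5)]) (use "1.IH" l in blast)
    obtain g' where g': "dv W ?v = Some g'" using kf(1) by blast
    note gp = dvD[OF g']
    have g'c: "g' \<in> carrier A" using gp W by blast
    \<comment> \<open>Equality of the first divisors enters here: \<open>d\<close> times the leading
      step is literally the division step at \<open>d + ?v\<close>.\<close>
    have "mon d \<otimes>\<^bsub>A\<^esub> red W ?v = red W (d + ?v)"
      using gp g'c by (simp add: red_def dv g' A.m_assoc[symmetric] mon_add[symmetric])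
    then have "mon d \<otimes>\<^bsub>A\<^esub> ?x = k \<odot>\<^bsub>A\<^esub> red W (d + ?v) \<oplus>\<^bsub>A\<^esub> mon d \<otimes>\<^bsub>A\<^esub> f"
      using kf reduces_closed[OF W kf(4)] red_closed[OF W vS kf(1)] by (metis mon_closed mult_term_add)
    moreover have "reduces W (k \<odot>\<^bsub>A\<^esub> red W (d + ?v) \<oplus>\<^bsub>A\<^esub> mon d \<otimes>\<^bsub>A\<^esub> f)"
      using reduces_insert[OF W tail std _ kf(2,3)] kf(1) dv by simp
    ultimately show ?case using wg by simp
  qed
  then show ?thesis using assms(2,3) reduces.zero by metis
qed

text \<open>The elements that reduce to 0 form an ideal. For closure under multiplication by
  \<open>a\<close> the order of the steps is given up: each multiple of \<open>red W u\<close> by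
  \<open>a\<close> is a multiple of some element of \<open>W\<close>, hence reduces to 0, and the
  pieces are added.\<close>

lemma reduces_ideal:
  assumes all: "\<And>g w. g \<in> set W \<Longrightarrow> w \<in> Std \<Longrightarrow> reduces W (mon w \<otimes>\<^bsub>A\<^esub> g)"
    and f: "f \<in> Idl\<^bsub>A\<^esub> (set W)"
  shows "reduces W f"
proof -
  have mult: "reduces W (a \<otimes>\<^bsub>A\<^esub> g)" if "g \<in> set W" "a \<in> carrier A" for a g
    using reduces_mult[OF W that(2), of g] all that W supp_Std by blast
  have multf: "reduces W (a \<otimes>\<^bsub>A\<^esub> f)" if "reduces W f" "a \<in> carrier A" for a f
    using that(1)
  proof (induction rule: reduces.induct)
    case zero
    then show ?case using that by (simp add: reduces.zero)
  next
    case (step u k f)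
    obtain g where g: "dv W u = Some g" using step.hyps(2) by blast
    have gW: "g \<in> set W" "g \<in> carrier A" using dvD[OF g] W by auto
    have "a \<otimes>\<^bsub>A\<^esub> red W u = (a \<otimes>\<^bsub>A\<^esub> mon (u - lm g)) \<otimes>\<^bsub>A\<^esub> g"
      using gW that by (simp add: red_def g A.m_assoc)
    then have "reduces W (a \<otimes>\<^bsub>A\<^esub> red W u)" using mult gW that by simp
    then show ?case
      using step that reduces_add[OF W reduces_smult[OF W]] red_closed[OF W] reduces_closed[OF W]
      by (simp add: mult_term_add)
  qed
  have "ideal {f. reduces W f} A"
  proof (rule idealI)
    show "ring A" by (rule A.ring_axioms)
    show "subgroup {f. reduces W f} (add_monoid A)"
    proof (rule A.M.add.subgroupI)
      fix f assume "f \<in> {f. reduces W f}"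
      then have "reduces W ((\<ominus>\<^bsub>R\<^esub> \<one>\<^bsub>R\<^esub>) \<odot>\<^bsub>A\<^esub> f)" "f \<in> carrier A"
        using reduces_smult[OF W] reduces_closed[OF W] by auto
      then show "\<ominus>\<^bsub>A\<^esub> f \<in> {f. reduces W f}" by (simp add: A.smult_l_minus)
    qed (use reduces_closed[OF W] reduces_add[OF W] reduces.zero[of W] in \<open>blast+ | simp\<close>)
  qed (use multf reduces_closed[OF W] A.m_comm in auto)
  moreover have "set W \<subseteq> {f. reduces W f}"
  proof
    fix g assume "g \<in> set W"
    then have "reduces W (\<one>\<^bsub>A\<^esub> \<otimes>\<^bsub>A\<^esub> g)" "g \<in> carrier A" using mult W by auto
    then show "g \<in> {f. reduces W f}" by simp
  qed
  ultimately have "Idl\<^bsub>A\<^esub> (set W) \<subseteq> {f. reduces W f}" by (rule A.genideal_minimal)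
  then show ?thesis using f by blast
qed

text \<open>The label consists of a monomial \<open>y\<close> of \<open>g\<close> responsible for
  \<open>LM(w g)\<close> and of the divisor of \<open>LM(w g)\<close>. Equal \<open>y\<close> makes
  \<open>padding_unique\<close> applicable, equal divisors give the last clause of
  \<open>pads\<close>.\<close>

lemma pads_finite_basis:
  assumes all: "\<And>g w. g \<in> set W \<Longrightarrow> w \<in> Std \<Longrightarrow> reduces W (mon w \<otimes>\<^bsub>A\<^esub> g)" and g: "g \<in> set W"
  shows "\<exists>B. finite B \<and> B \<subseteq> Std \<and> (\<forall>w\<in>Std. \<exists>w\<^sub>0\<in>B. pads W g w\<^sub>0 w)"
proof (rule finite_basis_of_wqo)
  fix s :: "nat \<Rightarrow> 'h multiset" assume s: "\<And>n. s n \<in> Std"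
  have gc: "g \<in> carrier A" using g W by blast
  define x where "x n = mon (s n) \<otimes>\<^bsub>A\<^esub> g" for n
  have xc: "x n \<in> carrier A" for n using gc by (simp add: x_def)
  \<comment> \<open>The value \<open>{#}\<close> for zero products is a placeholder; their label
    \<open>None\<close> keeps them apart from all others.\<close>
  define t where "t n = (if x n = \<zero>\<^bsub>A\<^esub> then {#} else lm (x n))" for n
  define y where "y n = (SOME y. y \<in> supp g \<and> nz (s n) y \<and> lm (x n) = pm (s n) y)" for n
  define l where "l n = (if x n = \<zero>\<^bsub>A\<^esub> then None else Some (y n, dv W (lm (x n))))" for n
  have y: "y n \<in> supp g \<and> nz (s n) (y n) \<and> lm (x n) = pm (s n) (y n)" if "x n \<noteq> \<zero>\<^bsub>A\<^esub>" for n
    unfolding y_def by (rule someI_ex) (use mon_mult_lm[OF s gc] that x_def in metis)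
  have "range l \<subseteq> insert None (Some ` (supp g \<times> insert None (Some ` set W)))"
  proof
    fix z assume "z \<in> range l"
    then obtain n where "z = l n" by blast
    moreover have "dv W u \<in> insert None (Some ` set W)" for u using dvD[of W u] by (cases "dv W u") auto
    ultimately show "z \<in> insert None (Some ` (supp g \<times> insert None (Some ` set W)))"
      using y[of n] by (auto simp: l_def)
  qed
  then have "finite (range l)" by (rule finite_subset) (simp add: finite_supp[OF gc])
  moreover have "set_mset (s n) \<subseteq> H" "set_mset (t n) \<subseteq> H" for n
    using Std_Mon[OF s] Std_Mon[OF lm_Std[OF xc]] by (auto simp: t_def Mon_iff)
  ultimately obtain i j where ij: "i < j" "s i \<subseteq># s j" "t i \<subseteq># t j" "l i = l j"
    using dickson_pairs[OF finite_H, of s t l] by blast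
  have "pads W g (s i) (s j)"
  proof (cases "x i = \<zero>\<^bsub>A\<^esub>")
    case True
    then show ?thesis using ij(2) by (simp add: pads_def x_def)
  next
    case False
    have j: "x j \<noteq> \<zero>\<^bsub>A\<^esub>" "y i = y j" "dv W (lm (x i)) = dv W (lm (x j))"
      using ij(4) False by (auto simp: l_def split: if_splits)
    define e where "e = s j - s i"
    define e' where "e' = lm (x j) - lm (x i)"
    have sj: "s j = s i + e" using ij(2) by (simp add: e_def)
    have lj: "lm (x j) = lm (x i) + e'" using ij(3) False j(1) by (simp add: e'_def t_def)
    have "y j \<in> Std" using y[OF j(1)] supp_Std[OF gc] by blast
    then have "e' = e"
      using padding_unique[of "y j" "s i" e e'] y[OF False] y[OF j(1)] sj s[of j] lj j(2) by simp
    then have "lm (x i) + (s j - s i) = lm (x j)" using lj by (simp add: e_def)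
    then show ?thesis using ij(2) j lm_Std[OF xc j(1)] by (simp add: pads_def x_def)
  qed
  with ij(1) show "\<exists>i j. i < j \<and> pads W g (s i) (s j)" by blast
qed

end

definition box :: "nat \<Rightarrow> 'h multiset set"
  where "box N = {w \<in> Mon. \<forall>h. count w h \<le> N}"

text \<open>The tests in \<open>pads\<close> that involve \<open>w - w\<^sub>0\<close> ask whether
  some \<open>s\<close> with exponents at most \<open>N\<close> is contained in
  \<open>v + (w - w\<^sub>0)\<close>. An exponent of \<open>w\<close> above \<open>N + N\<close>
  leaves at least \<open>N\<close> after subtracting that of \<open>w\<^sub>0\<close>, so truncating
  \<open>w\<close> at \<open>N + N\<close> changes no answer.\<close>

lemma pads_box:
  assumes T: "{t + u | t u. t \<in> T \<and> u \<in> Mon} = \<Sigma>" "T \<subseteq> box N"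
    and lms: "\<And>g. g \<in> set W \<Longrightarrow> g \<noteq> \<zero>\<^bsub>A\<^esub> \<Longrightarrow> lm g \<in> box N"
    and pads: "\<And>w. w \<in> Std \<inter> box (N + N) \<Longrightarrow> \<exists>w\<^sub>0 \<in> Std \<inter> box N. pads W g w\<^sub>0 w"
    and g: "g \<in> carrier A" and w: "w \<in> Std"
  shows "\<exists>w\<^sub>0 \<in> Std \<inter> box N. pads W g w\<^sub>0 w"
proof -
  \<comment> \<open>Intersecting with \<open>C\<close> truncates every exponent at
    \<open>N + N\<close>.\<close>
  define C where "C = (\<Sum>h\<in>H. replicate_mset (N + N) h)"
  have C: "count C h = (if h \<in> H then N + N else 0)" for h
    using finite_H by (simp add: C_def count_sum)
  define w' where "w' = w \<inter># C"
  have w'w: "w' \<subseteq># w" by (simp add: w'_def)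
  have cw': "count w' h = min (count w h) (N + N)" for h
  proof (cases "h \<in> H")
    case False
    then have "count w h = 0" using Std_Mon[OF w] by (meson Mon_iff count_eq_zero_iff subsetD)
    then show ?thesis by (simp add: w'_def)
  qed (simp add: w'_def C)
  have "w' \<in> Std \<inter> box (N + N)"
    using Std_subset[OF w'w w] Std_Mon by (auto simp: box_def cw')
  then obtain w0 where w0: "w0 \<in> Std \<inter> box N" "pads W g w0 w'" using pads by blast
  have sub: "w0 \<subseteq># w'" "w0 \<subseteq># w" using w0(2) w'w subset_mset.order_trans by (auto simp: pads_def)
  have small: "s \<subseteq># v + (w - w0) \<longleftrightarrow> s \<subseteq># v + (w' - w0)" if "s \<in> box N" for s v
  proof -
    have "count s h \<le> count v h + (count w h - count w0 h) \<longleftrightarrow>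
        count s h \<le> count v h + (count w' h - count w0 h)" for h
    proof (cases "count w h \<le> N + N")
      case False
      moreover have "count s h \<le> N" "count w0 h \<le> N" using that w0(1) by (auto simp: box_def)
      ultimately show ?thesis using cw'[of h] by linarith
    qed (simp add: cw')
    then show ?thesis by (simp add: subseteq_mset_def)
  qed
  have "pads W g w0 w"
  proof (cases "mon w0 \<otimes>\<^bsub>A\<^esub> g = \<zero>\<^bsub>A\<^esub>")
    case True
    then show ?thesis using sub by (simp add: pads_def)
  next
    case False
    let ?v = "lm (mon w0 \<otimes>\<^bsub>A\<^esub> g)"
    have v: "?v + (w' - w0) \<in> Std" "dv W (?v + (w' - w0)) = dv W ?v"
      using w0(2) False by (auto simp: pads_def)
    have "?v \<in> Mon" "w - w0 \<in> Mon"
      using Std_Mon[OF lm_Std[OF _ False]] g Std_Mon[OF Std_subset[OF diff_subset_eq_self w]] by auto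
    then have Mon: "?v + (w - w0) \<in> Mon" by (simp add: Mon_add)
    have "?v + (w - w0) \<notin> \<Sigma>"
    proof
      assume "?v + (w - w0) \<in> \<Sigma>"
      then have "?v + (w - w0) \<in> {t + u | t u. t \<in> T \<and> u \<in> Mon}" by (simp only: T(1))
      then obtain t u where tu: "t \<in> T" "?v + (w - w0) = t + u" by blast
      then have "t \<subseteq># ?v + (w - w0)" by (metis mset_subset_eq_add_left)
      with tu(1) have t: "t \<in> T" "t \<subseteq># ?v + (w' - w0)" using small T(2) by auto
      have "?v + (w' - w0) = t + (?v + (w' - w0) - t)" using t by simp
      moreover have "?v + (w' - w0) - t \<in> Mon"
        using Mon_subset[OF diff_subset_eq_self Std_Mon[OF v(1)]] .
      ultimately have "?v + (w' - w0) \<in> {t + u | t u. t \<in> T \<and> u \<in> Mon}" using t(1) by blast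
      then have "?v + (w' - w0) \<in> \<Sigma>" by (simp only: T(1))
      then show False using v(1) by (simp add: Std_def)
    qed
    then have "?v + (w - w0) \<in> Std" using Mon by (simp add: Std_def)
    moreover have "dv W (?v + (w - w0)) = dv W (?v + (w' - w0))"
      unfolding dv_def by (rule find_cong) (use small lms in auto)
    ultimately show ?thesis using sub v by (simp add: pads_def)
  qed
  with w0(1) show ?thesis by blast
qed

end

section \<open>Standard expressions, closures and Groebner bases from reductions to 0\<close>

context leading_term_algebra
begin

lemma pi_lt_zero: "pi_lt \<zero>\<^bsub>A\<^esub> = \<zero>\<^bsub>B\<^esub>"
  using Lt.lincomb_coord[of "\<zero>\<^bsub>B\<^esub>"] by (simp add: pi_lt_def coord_zero Lt.coord_zero)

lemma pi_lt_LT_zero: "pi_lt (LT r \<zero>\<^bsub>A\<^esub>) = \<zero>\<^bsub>B\<^esub>"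
  by (simp add: LT_def LM_zero pi_lt_zero)

definition lc :: "'a \<Rightarrow> 'r"
  where "lc f = coord f (lm f)"

lemma lc_props:
  assumes "f \<in> carrier A" "f \<noteq> \<zero>\<^bsub>A\<^esub>"
  shows "lc f \<in> carrier R" "lc f \<noteq> \<zero>\<^bsub>R\<^esub>"
  using lm_supp[OF assms] assms by (auto simp: lc_def supp_def)

lemma pi_lt_term: "k \<in> carrier R \<Longrightarrow> u \<in> Std \<Longrightarrow> pi_lt (k \<odot>\<^bsub>A\<^esub> mon u) = k \<odot>\<^bsub>B\<^esub> Lt.mon u"
  by (simp add: pi_lt_def coord_term Lt.coords_single)

lemma pi_lt_LT:
  assumes "f \<in> carrier A" "f \<noteq> \<zero>\<^bsub>A\<^esub>"
  shows "pi_lt (LT r f) = lc f \<odot>\<^bsub>B\<^esub> Lt.mon (lm f)"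
  using LM_eq[OF assms] lm_Std[OF assms] lc_props[OF assms]
  by (simp add: LT_def LC_def lc_def pi_lt_term)

text \<open>Both algebras have the same \<Sigma>, so a standard \<open>m + lm g\<close> gives a
  basis element of the algebra of leading terms as well, and the product cannot vanish
  there.\<close>

lemma compatible_if_Std:
  assumes "g \<in> carrier A" "g \<noteq> \<zero>\<^bsub>A\<^esub>" "m + lm g \<in> Std"
  shows "compatible_with_LT m g"
proof -
  have "Lt.mon m \<otimes>\<^bsub>B\<^esub> pi_lt (LT r g) = lc g \<odot>\<^bsub>B\<^esub> Lt.mon (m + lm g)"
    using assms lc_props by (simp add: pi_lt_LT Lt.A.m_comm[of "Lt.mon m"] Lt.A.smult_assoc2 Lt.mon_add)
  moreover have "Lt.supp \<dots> = {m + lm g}"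
    using Lt.supp_smult[of "lc g" "Lt.mon (m + lm g)"] lc_props assms Lt.supp_mon by simp
  ultimately show ?thesis by (auto simp: compatible_with_LT_def Lt.supp_zero)
qed

text \<open>The quotients of the division are collected by divisor. Leading monomials fall from step
  to step, which bounds every product by \<open>LM(f)\<close>; compatibility holds because
  \<open>m + lm g\<close> is the standard monomial being cancelled.\<close>

lemma reduces_std_expr:
  assumes W: "set W \<subseteq> carrier A" and f: "reduces W f"
  shows "\<exists>l. std_expr f (set W) l \<zero>\<^bsub>A\<^esub>"
proof -
  \<comment> \<open>All monomials of the products are bounded, not only the leading ones, because
    contributions to the same \<open>g\<close> may cancel. The conjunct that \<open>f\<close> is
    nonzero guards against the arbitrary value \<open>lm\<close> of zero.\<close>
  have "\<exists>l. l \<in> set W \<rightarrow> carrier A \<and> f = (\<Oplus>\<^bsub>A\<^esub>g\<in>set W. l g \<otimes>\<^bsub>A\<^esub> g) \<and>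
      (\<forall>g\<in>set W. \<forall>v\<in>supp (l g \<otimes>\<^bsub>A\<^esub> g). f \<noteq> \<zero>\<^bsub>A\<^esub> \<and> v \<preceq> lm f) \<and>
      (\<forall>g\<in>set W. \<forall>m\<in>supp (l g). compatible_with_LT m g)"
    using f
  proof (induction rule: reduces.induct)
    case zero
    have "(\<Oplus>\<^bsub>A\<^esub>g\<in>set W. \<zero>\<^bsub>A\<^esub> \<otimes>\<^bsub>A\<^esub> g) = (\<Oplus>\<^bsub>A\<^esub>g\<in>set W. \<zero>\<^bsub>A\<^esub>)"
      using W by (intro A.M.finsum_cong') auto
    then show ?case using W by (intro exI[of _ "\<lambda>_. \<zero>\<^bsub>A\<^esub>"]) (auto simp: supp_zero)
  next
    case (step u k f)
    obtain l where l: "l \<in> set W \<rightarrow> carrier A" "f = (\<Oplus>\<^bsub>A\<^esub>g\<in>set W. l g \<otimes>\<^bsub>A\<^esub> g)"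
        "\<And>g v. g \<in> set W \<Longrightarrow> v \<in> supp (l g \<otimes>\<^bsub>A\<^esub> g) \<Longrightarrow> f \<noteq> \<zero>\<^bsub>A\<^esub> \<and> v \<preceq> lm f"
        "\<And>g m. g \<in> set W \<Longrightarrow> m \<in> supp (l g) \<Longrightarrow> compatible_with_LT m g"
      using step.IH by blast
    obtain g0 where g0: "dv W u = Some g0" using step.hyps(2) by blast
    note gp = dvD[OF g0]
    have gc: "g0 \<in> carrier A" using gp W by blast
    define m where "m = u - lm g0"
    have m: "m + lm g0 = u" using gp by (simp add: m_def)
    then have mS: "m \<in> Std" using Std_addD[of m "lm g0"] step.hyps(1) by simp
    have red: "red W u = mon m \<otimes>\<^bsub>A\<^esub> g0" by (simp add: red_def g0 m_def)
    let ?t = "k \<odot>\<^bsub>A\<^esub> mon m" and ?F = "k \<odot>\<^bsub>A\<^esub> red W u \<oplus>\<^bsub>A\<^esub> f"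
    define l' where "l' g = (if g = g0 then ?t \<oplus>\<^bsub>A\<^esub> l g else l g)" for g
    have fc: "f \<in> carrier A" by (rule reduces_closed[OF W step.hyps(5)])
    note F = reduces_step_lm[OF W step.hyps]
    have lc: "l g \<in> carrier A" if "g \<in> set W" for g using l(1) that by blast
    have tg: "?t \<otimes>\<^bsub>A\<^esub> g0 = k \<odot>\<^bsub>A\<^esub> red W u" using step.hyps(3) gc by (simp add: red A.smult_assoc2)
    have "(\<Oplus>\<^bsub>A\<^esub>g\<in>set W. l' g \<otimes>\<^bsub>A\<^esub> g) =
        (\<Oplus>\<^bsub>A\<^esub>g\<in>set W. (if g0 = g then ?t \<otimes>\<^bsub>A\<^esub> g0 else \<zero>\<^bsub>A\<^esub>) \<oplus>\<^bsub>A\<^esub> l g \<otimes>\<^bsub>A\<^esub> g)"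
      using W lc gc step.hyps(3) by (intro A.M.finsum_cong') (auto simp: l'_def A.l_distr)
    also have "\<dots> = (\<Oplus>\<^bsub>A\<^esub>g\<in>set W. if g0 = g then ?t \<otimes>\<^bsub>A\<^esub> g0 else \<zero>\<^bsub>A\<^esub>) \<oplus>\<^bsub>A\<^esub> f"
      unfolding l(2) using W lc gc step.hyps(3) by (intro A.M.finsum_addf) auto
    also have "(\<Oplus>\<^bsub>A\<^esub>g\<in>set W. if g0 = g then ?t \<otimes>\<^bsub>A\<^esub> g0 else \<zero>\<^bsub>A\<^esub>) = ?t \<otimes>\<^bsub>A\<^esub> g0"
      using gp gc step.hyps(3) by (intro A.M.finsum_singleton) auto
    finally have sum: "?F = (\<Oplus>\<^bsub>A\<^esub>g\<in>set W. l' g \<otimes>\<^bsub>A\<^esub> g)" using tg by simp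
    have bound: "v \<preceq> u" if "g \<in> set W" "v \<in> supp (l' g \<otimes>\<^bsub>A\<^esub> g)" for g v
    proof -
      have lf: "v \<preceq> u" if v: "v \<in> supp (l g \<otimes>\<^bsub>A\<^esub> g)" for v
      proof -
        have "f \<noteq> \<zero>\<^bsub>A\<^esub>" "v \<preceq> lm f" using l(3)[OF \<open>g \<in> set W\<close> v] by auto
        moreover have "lm f \<prec> u" using step.hyps(6) lm_supp[OF fc] calculation(1) by blast
        ultimately show ?thesis using le_lt_trans lt_le by blast
      qed
      show ?thesis
      proof (cases "g = g0")
        case True
        then have "v \<in> supp (k \<odot>\<^bsub>A\<^esub> red W u \<oplus>\<^bsub>A\<^esub> l g \<otimes>\<^bsub>A\<^esub> g)"
          using that lc gc step.hyps(3) tg by (simp add: l'_def A.l_distr)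
        then have "v \<in> supp (red W u) \<or> v \<in> supp (l g \<otimes>\<^bsub>A\<^esub> g)"
          using supp_add[of "k \<odot>\<^bsub>A\<^esub> red W u" "l g \<otimes>\<^bsub>A\<^esub> g"] lc[OF that(1)] that(1) W step.hyps(3,4)
            supp_smult[OF step.hyps(3,4) red_closed[OF W step.hyps(1,2)]] red_closed[OF W step.hyps(1,2)]
          by auto
        then show ?thesis
          using lf lm_max[OF red_props(1,2)[OF W step.hyps(1,2)]] lm_red[OF W step.hyps(1,2)] by auto
      qed (use that lf in \<open>simp add: l'_def\<close>)
    qed
    have compat: "compatible_with_LT x g" if "g \<in> set W" "x \<in> supp (l' g)" for g x
    proof (cases "g = g0 \<and> x \<notin> supp (l g)")
      case True
      then have "x \<in> supp ?t"
        using that supp_add[of ?t "l g"] lc step.hyps(3) by (auto simp: l'_def)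
      then have "x = m" using supp_smult[OF step.hyps(3,4), of "mon m"] supp_mon[OF mS] by simp
      then show ?thesis using compatible_if_Std[OF gc] gp m step.hyps(1) True by simp
    next
      case False
      then show ?thesis using l(4) that by (auto simp: l'_def split: if_splits)
    qed
    have "l' \<in> set W \<rightarrow> carrier A" using lc step.hyps(3) by (auto simp: l'_def)
    then show ?case using sum bound compat F by (intro exI[of _ l']) auto
  qed
  then obtain l where l: "l \<in> set W \<rightarrow> carrier A" "f = (\<Oplus>\<^bsub>A\<^esub>g\<in>set W. l g \<otimes>\<^bsub>A\<^esub> g)"
      "\<And>g v. g \<in> set W \<Longrightarrow> v \<in> supp (l g \<otimes>\<^bsub>A\<^esub> g) \<Longrightarrow> f \<noteq> \<zero>\<^bsub>A\<^esub> \<and> v \<preceq> lm f"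
      "\<And>g m. g \<in> set W \<Longrightarrow> m \<in> supp (l g) \<Longrightarrow> compatible_with_LT m g"
    by blast
  have fc: "f \<in> carrier A" by (rule reduces_closed[OF W f])
  let ?U = "{g \<in> set W. l g \<noteq> \<zero>\<^bsub>A\<^esub>}"
  have feq: "f = (\<Oplus>\<^bsub>A\<^esub>g\<in>?U. l g \<otimes>\<^bsub>A\<^esub> g)"
    unfolding l(2) using W l(1) by (intro A.M.add.finprod_mono_neutral_cong_right) auto
  have "(\<Oplus>\<^bsub>A\<^esub>g\<in>?U. l g \<otimes>\<^bsub>A\<^esub> g) \<in> carrier A" using W l(1) by (intro A.M.finsum_closed) auto
  then have "f = \<zero>\<^bsub>A\<^esub> \<oplus>\<^bsub>A\<^esub> (\<Oplus>\<^bsub>A\<^esub>g\<in>?U. l g \<otimes>\<^bsub>A\<^esub> g)" using A.M.l_zero feq by metis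
  moreover have "lm_le r (LM r (l g \<otimes>\<^bsub>A\<^esub> g)) (LM r f)" if g: "g \<in> set W" for g
  proof -
    have lg: "l g \<otimes>\<^bsub>A\<^esub> g \<in> carrier A" using g l(1) W by auto
    show ?thesis
    proof (cases "l g \<otimes>\<^bsub>A\<^esub> g = \<zero>\<^bsub>A\<^esub>")
      case False
      have "f \<noteq> \<zero>\<^bsub>A\<^esub>" using l(3)[OF g lm_supp[OF lg False]] by blast
      then show ?thesis using lm_le_iff[OF lg fc] l(3)[OF g] by blast
    qed (simp add: LM_zero)
  qed
  ultimately have "std_expr f (set W) l \<zero>\<^bsub>A\<^esub>"
    unfolding std_expr_def using l(1,4) supp_zero by (intro conjI) simp_all
  then show ?thesis by blast
qed

text \<open>The \<open>THE\<close> in \<open>lt_quot\<close> needs existence and uniqueness. By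
  \<open>lt_mult\<close> a nonzero product of standard monomials in the algebra of leading terms is
  a scalar times one basis monomial, given by \<open>pm\<close>; so some monomial \<open>y\<close>
  of the cofactor satisfies \<open>pm y m = u\<close>, and \<open>pm_cancel\<close> makes
  \<open>y\<close> unique.\<close>

lemma lt_quot_closed:
  assumes f: "f \<in> carrier A" and l: "l \<in> Lt.mon ` Std" "pi_lt (LT r f) divides\<^bsub>B\<^esub> l"
  shows "lt_quot l (LT r f) \<in> Lt.std_terms"
proof -
  obtain u where u: "u \<in> Std" "l = Lt.mon u" using l(1) by blast
  have l0: "l \<noteq> \<zero>\<^bsub>B\<^esub>" using u Lt.mon_nonzero by simp
  obtain b where b: "b \<in> carrier B" "l = pi_lt (LT r f) \<otimes>\<^bsub>B\<^esub> b" using l(2) by (auto simp: factor_def)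
  have f0: "f \<noteq> \<zero>\<^bsub>A\<^esub>" using b l0 pi_lt_LT_zero by auto
  define m where "m = lm f"
  define c where "c = lc f"
  have m: "m \<in> Std" and c: "c \<in> carrier R" "c \<noteq> \<zero>\<^bsub>R\<^esub>" and pf: "pi_lt (LT r f) = c \<odot>\<^bsub>B\<^esub> Lt.mon m"
    using lm_Std[OF f f0] lc_props[OF f f0] pi_lt_LT[OF f f0] by (auto simp: m_def c_def)
  have mult: "\<exists>k. k \<in> carrier R \<and> k \<noteq> \<zero>\<^bsub>R\<^esub> \<and> nz y m \<and>
      Lt.mon y \<otimes>\<^bsub>B\<^esub> Lt.mon m = k \<odot>\<^bsub>B\<^esub> Lt.mon (pm y m)"
    if y: "y \<in> Std" "Lt.mon y \<otimes>\<^bsub>B\<^esub> Lt.mon m \<noteq> \<zero>\<^bsub>B\<^esub>" for y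
  proof -
    let ?p = "mon y \<otimes>\<^bsub>A\<^esub> mon m"
    have "Lt.mon y \<otimes>\<^bsub>B\<^esub> Lt.mon m = pi_lt (LT r ?p)"
      using lt_mult[OF y(1) m] y(2) by (simp add: pi_lt_def)
    moreover have "?p \<noteq> \<zero>\<^bsub>A\<^esub>" using calculation y(2) pi_lt_LT_zero by auto
    moreover have "nz y m" using calculation by (simp add: nz_def)
    ultimately show ?thesis using pi_lt_LT[of ?p] lc_props[of ?p] by (auto simp: pm_def)
  qed
  have "u \<in> Lt.supp (Lt.mon m \<otimes>\<^bsub>B\<^esub> b)"
    using Lt.supp_mon[OF u(1)] b u(2) Lt.supp_smult[OF c, of "Lt.mon m \<otimes>\<^bsub>B\<^esub> b"]
    by (simp add: c pf Lt.A.smult_assoc2)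
  then obtain y where y: "y \<in> Lt.supp b" "u \<in> Lt.supp (Lt.mon m \<otimes>\<^bsub>B\<^esub> Lt.mon y)"
    using Lt.supp_mult[OF Lt.mon_closed[of m] b(1)] by blast
  have yS: "y \<in> Std" using y(1) Lt.supp_Std[OF b(1)] by blast
  have "Lt.mon y \<otimes>\<^bsub>B\<^esub> Lt.mon m \<noteq> \<zero>\<^bsub>B\<^esub>" using y(2) Lt.supp_zero by (auto simp: Lt.A.m_comm)
  then obtain k where k: "k \<in> carrier R" "k \<noteq> \<zero>\<^bsub>R\<^esub>" "nz y m"
      "Lt.mon y \<otimes>\<^bsub>B\<^esub> Lt.mon m = k \<odot>\<^bsub>B\<^esub> Lt.mon (pm y m)"
    using mult yS by blast
  have pu: "pm y m = u"
    using y(2) k Lt.supp_smult[OF k(1,2), of "Lt.mon (pm y m)"] Lt.supp_mon[OF pm_Std[OF k(3)]]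
    by (simp add: Lt.A.m_comm[of "Lt.mon m"])
  \<comment> \<open>The scalar undoes two factors: \<open>c\<close> is the leading coefficient of
    \<open>f\<close>, and \<open>k\<close> arises in the product of the two monomials.\<close>
  define q where "q = inv\<^bsub>R\<^esub> (c \<otimes>\<^bsub>R\<^esub> k) \<odot>\<^bsub>B\<^esub> Lt.mon y"
  have ck: "c \<otimes>\<^bsub>R\<^esub> k \<in> Units R" using c k by (simp add: field_Units integral_iff)
  have qt: "q \<in> Lt.std_terms"
    using ck yS by (auto simp: q_def Lt.std_terms_def)
  have scal: "(s \<odot>\<^bsub>B\<^esub> Lt.mon y) \<otimes>\<^bsub>B\<^esub> pi_lt (LT r f) = (s \<otimes>\<^bsub>R\<^esub> (c \<otimes>\<^bsub>R\<^esub> k)) \<odot>\<^bsub>B\<^esub> l"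
    if "s \<in> carrier R" for s
    using that c k pu u by (simp add: pf Lt.A.smult_assoc2 Lt.A.m_comm[of "Lt.mon y" "c \<odot>\<^bsub>B\<^esub> Lt.mon m"]
        Lt.A.m_comm[of "Lt.mon m" "Lt.mon y"] Lt.A.smult_assoc1)
  have "q \<otimes>\<^bsub>B\<^esub> pi_lt (LT r f) = l"
    using scal[of "inv\<^bsub>R\<^esub> (c \<otimes>\<^bsub>R\<^esub> k)"] ck u by (simp add: q_def)
  moreover have "q' = q" if q': "q' \<in> Lt.std_terms" "q' \<otimes>\<^bsub>B\<^esub> pi_lt (LT r f) = l" for q'
  proof -
    obtain s y' where s: "s \<in> carrier R" "y' \<in> Std" "q' = s \<odot>\<^bsub>B\<^esub> Lt.mon y'"
      using q'(1) by (auto simp: Lt.std_terms_def)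
    have q'l: "l = (s \<otimes>\<^bsub>R\<^esub> c) \<odot>\<^bsub>B\<^esub> (Lt.mon y' \<otimes>\<^bsub>B\<^esub> Lt.mon m)"
      using q'(2) s c by (simp add: pf Lt.A.smult_assoc2 Lt.A.m_comm[of "Lt.mon y'" "c \<odot>\<^bsub>B\<^esub> Lt.mon m"]
          Lt.A.m_comm[of "Lt.mon m" "Lt.mon y'"] Lt.A.smult_assoc1)
    then have "Lt.mon y' \<otimes>\<^bsub>B\<^esub> Lt.mon m \<noteq> \<zero>\<^bsub>B\<^esub>" "s \<otimes>\<^bsub>R\<^esub> c \<noteq> \<zero>\<^bsub>R\<^esub>" using l0 s c by auto
    then obtain k' where k': "k' \<in> carrier R" "k' \<noteq> \<zero>\<^bsub>R\<^esub>" "nz y' m"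
        "Lt.mon y' \<otimes>\<^bsub>B\<^esub> Lt.mon m = k' \<odot>\<^bsub>B\<^esub> Lt.mon (pm y' m)"
      using mult s(2) by blast
    have "Lt.supp l = {pm y' m}"
      unfolding q'l using \<open>s \<otimes>\<^bsub>R\<^esub> c \<noteq> \<zero>\<^bsub>R\<^esub>\<close> s(1) c(1) k'
      by (simp add: Lt.supp_smult Lt.supp_mon pm_Std)
    then have "pm y' m = pm y m" using u Lt.supp_mon pu by auto
    then have y': "y' = y" using pm_cancel[OF s(2) yS m k'(3) k(3)] by simp
    have "(s \<otimes>\<^bsub>R\<^esub> (c \<otimes>\<^bsub>R\<^esub> k)) \<odot>\<^bsub>B\<^esub> Lt.mon u = \<one>\<^bsub>R\<^esub> \<odot>\<^bsub>B\<^esub> Lt.mon u"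
      using scal[OF s(1)] q'(2) s(3) y' u by simp
    then have "Lt.coord ((s \<otimes>\<^bsub>R\<^esub> (c \<otimes>\<^bsub>R\<^esub> k)) \<odot>\<^bsub>B\<^esub> Lt.mon u) u = Lt.coord (\<one>\<^bsub>R\<^esub> \<odot>\<^bsub>B\<^esub> Lt.mon u) u"
      by simp
    then have "s \<otimes>\<^bsub>R\<^esub> (c \<otimes>\<^bsub>R\<^esub> k) = \<one>\<^bsub>R\<^esub>"
      using s c k u(1) by (simp add: Lt.coord_term Lt.coord_mon)
    then have "s = inv\<^bsub>R\<^esub> (c \<otimes>\<^bsub>R\<^esub> k)" using s(1) c(1) k(1) field_inv_unique by simp
    then show ?thesis using s y' by (simp add: q_def)
  qed
  ultimately have "lt_quot l (LT r f) = q" using qt unfolding lt_quot_def by (intro the_equality conjI) blast+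
  then show ?thesis using qt by simp
qed

text \<open>\<open>inv_into\<close> is meaningful only on the image of \<open>pi_lt\<close>. This
  image contains the standard terms, so it contains the quotients.\<close>

lemma S_set_in_ideal:
  assumes "ideal I A" "f \<in> I" "g \<in> I" "x \<in> S_set f g"
  shows "x \<in> I"
proof -
  interpret I: ideal I A by (rule assms(1))
  have fg: "f \<in> carrier A" "g \<in> carrier A" using assms(2,3) I.Icarr by blast+
  have inv: "inv_into (carrier A) pi_lt q \<in> carrier A" if q: "q \<in> Lt.std_terms" for q
  proof (rule inv_into_into)
    show "q \<in> pi_lt ` carrier A"
    proof -
      obtain c m where "c \<in> carrier R" "m \<in> Std" "q = c \<odot>\<^bsub>B\<^esub> Lt.mon m"
        using q unfolding Lt.std_terms_def by blast
      then have "q = pi_lt (c \<odot>\<^bsub>A\<^esub> mon m)" "c \<odot>\<^bsub>A\<^esub> mon m \<in> carrier A"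
        by (simp_all only: pi_lt_term A.smult_closed mon_closed)
      then show ?thesis by blast
    qed
  qed
  obtain l where l: "l \<in> common_multiples f g"
    "x = inv_into (carrier A) pi_lt (lt_quot l (LT r f)) \<otimes>\<^bsub>A\<^esub> f
        \<ominus>\<^bsub>A\<^esub> inv_into (carrier A) pi_lt (lt_quot l (LT r g)) \<otimes>\<^bsub>A\<^esub> g"
    using assms(4) unfolding S_set_def by blast
  then have "lt_quot l (LT r f) \<in> Lt.std_terms" "lt_quot l (LT r g) \<in> Lt.std_terms"
    using lt_quot_closed[OF fg(1), of l] lt_quot_closed[OF fg(2), of l] by (simp_all add: common_multiples_def)
  then show ?thesis
    using l(2) inv assms(2,3) by (simp add: a_minus_def I.I_l_closed I.a_closed I.a_inv_closed)
qed

text \<open>Once every element of the ideal reduces to 0, each closure property asks only for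
  standard expressions of elements of the ideal. For the Groebner property, a divisor of
  \<open>LM(f)\<close> as a multiset is also a divisor in the algebra of leading terms.\<close>

theorem closures:
  assumes W: "set W \<subseteq> carrier A" and G: "set W \<subseteq> Idl\<^bsub>A\<^esub> G" "G \<subseteq> set W"
    and all: "\<And>g w. g \<in> set W \<Longrightarrow> w \<in> Std \<Longrightarrow> reduces W (mon w \<otimes>\<^bsub>A\<^esub> g)"
  shows "Ann_closure G (set W)" and "S_closure G (set W)" and "groebner_basis (Idl\<^bsub>A\<^esub> G) (set W)"
proof -
  let ?I = "Idl\<^bsub>A\<^esub> (set W)"
  have idl: "ideal ?I A" using W by (rule A.genideal_ideal)
  have GI: "Idl\<^bsub>A\<^esub> G = ?I"
  proof
    show "Idl\<^bsub>A\<^esub> G \<subseteq> ?I" using A.subset_Idl_subset[OF W G(2)] .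
    show "?I \<subseteq> Idl\<^bsub>A\<^esub> G" using A.genideal_minimal[OF A.genideal_ideal G(1)] G(2) W by blast
  qed
  have red: "reduces W f" if "f \<in> ?I" for f using reduces_ideal[OF W all that] by blast
  have expr: "\<exists>l. std_expr f (set W) l \<zero>\<^bsub>A\<^esub>" if "f \<in> ?I" for f
    using reduces_std_expr[OF W red[OF that]] .
  have WI: "set W \<subseteq> ?I" using A.genideal_self[OF W] .
  show "S_closure G (set W)"
    unfolding S_closure_def S_closed_def
    using G expr S_set_in_ideal[OF idl] WI by blast
  have mult: "mon m \<otimes>\<^bsub>A\<^esub> g \<in> ?I" if "g \<in> set W" for m g
    using ideal.I_l_closed[OF idl subsetD[OF WI that] mon_closed] .
  \<comment> \<open>The largest possible set is taken: both conditions of \<open>Ann_closed\<close>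
    ask only for the presence of some syzygy at a pair \<open>(n, g)\<close> with \<open>n\<close>
    standard.\<close>
  define S where "S = {z. compatibility_syzygy (set W) z \<or> trivial_syzygy (set W) z}"
  have S: "\<exists>l. (n, g, l) \<in> S" if g: "g \<in> set W" and n: "n \<in> Std" for n g
  proof (cases "compatible_with_LT n g")
    case True
    then have "trivial_syzygy (set W) (n, g, \<lambda>g'. if g' = g then mon n else \<zero>\<^bsub>A\<^esub>)"
      using that by (simp add: trivial_syzygy_def)
    then show ?thesis unfolding S_def by blast
  next
    case False
    obtain l where "std_expr (mon n \<otimes>\<^bsub>A\<^esub> g) (set W) l \<zero>\<^bsub>A\<^esub>" using expr[OF mult[OF g]] by blast
    then have "compatibility_syzygy (set W) (n, g, l)"
      using that False by (simp add: compatibility_syzygy_def)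
    then show ?thesis unfolding S_def by blast
  qed
  have nStd: "n \<in> Std" if "LM r (mon t \<otimes>\<^bsub>A\<^esub> mon m) = Some n" for t m n
  proof -
    have "mon t \<otimes>\<^bsub>A\<^esub> mon m \<noteq> \<zero>\<^bsub>A\<^esub>" using that LM_zero by auto
    then show ?thesis using that LM_eq[of "mon t \<otimes>\<^bsub>A\<^esub> mon m"] lm_Std[of "mon t \<otimes>\<^bsub>A\<^esub> mon m"] by simp
  qed
  have "Ann_closed (set W)"
    unfolding Ann_closed_def
  proof (intro exI[of _ S] conjI ballI)
    show "compatibility_syzygy (set W) z \<or> trivial_syzygy (set W) z" if "z \<in> S" for z
      using that by (simp add: S_def)
    show "\<exists>l. (s, g, l) \<in> S" if "g \<in> set W" "s \<in> min_annihilators g" for g s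
      using S that by (simp add: min_annihilators_def)
    fix g z assume "g \<in> set W"
    then show "case z of (m\<^sub>0, g\<^sub>0, l) \<Rightarrow> \<forall>m\<in>supp (l g). \<forall>t\<in>Std.
        Lt.mon t \<in> min_std_gens (colon (Ann (pi_lt (LT r g))) (Lt.mon m)) \<longrightarrow>
        (\<forall>n. LM r (mon t \<otimes>\<^bsub>A\<^esub> mon m) = Some n \<longrightarrow> (\<exists>l'. (n, g, l') \<in> S))"
      using S nStd by (simp split: prod.split)
  qed
  then show "Ann_closure G (set W)" using G by (simp add: Ann_closure_def)
  have Wm: "(\<lambda>g. pi_lt (LT r g)) ` set W \<subseteq> carrier B"
  proof
    fix y assume "y \<in> (\<lambda>g. pi_lt (LT r g)) ` set W"
    then obtain g where g: "g \<in> carrier A" "y = pi_lt (LT r g)" using W by blast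
    show "y \<in> carrier B"
      using g lc_props[of g] pi_lt_LT[of g] pi_lt_LT_zero by (cases "g = \<zero>\<^bsub>A\<^esub>") auto
  qed
  have "pi_lt (LT r f) \<in> Idl\<^bsub>B\<^esub> ((\<lambda>g. pi_lt (LT r g)) ` set W)" if f: "f \<in> ?I" for f
  proof (cases "f = \<zero>\<^bsub>A\<^esub>")
    case True
    then show ?thesis
      using pi_lt_LT_zero additive_subgroup.zero_closed[OF ideal.axioms(1)[OF Lt.A.genideal_ideal[OF Wm]]] by simp
  next
    case False
    have fc: "f \<in> carrier A" using ideal.Icarr[OF idl f] .
    obtain g where g: "dv W (lm f) = Some g" using reduces_lm[OF W red[OF f] False] by blast
    note gp = dvD[OF g]
    have gc: "g \<in> carrier A" using gp W by blast
    define m where "m = lm f - lm g"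
    have m: "lm f = m + lm g" using gp by (simp add: m_def)
    note cf = lc_props[OF fc False] and cg = lc_props[OF gc]
    \<comment> \<open>This scalar turns the leading coefficient of \<open>g\<close> into that of
      \<open>f\<close>.\<close>
    let ?k = "lc f \<otimes>\<^bsub>R\<^esub> inv\<^bsub>R\<^esub> lc g"
    have inv: "inv\<^bsub>R\<^esub> lc g \<in> carrier R" "inv\<^bsub>R\<^esub> lc g \<otimes>\<^bsub>R\<^esub> lc g = \<one>\<^bsub>R\<^esub>"
      using cg gp field_Units by auto
    have gt: "pi_lt (LT r g) = lc g \<odot>\<^bsub>B\<^esub> Lt.mon (lm g)" using pi_lt_LT[OF gc] gp by blast
    have "(?k \<odot>\<^bsub>B\<^esub> Lt.mon m) \<otimes>\<^bsub>B\<^esub> pi_lt (LT r g) = (?k \<otimes>\<^bsub>R\<^esub> lc g) \<odot>\<^bsub>B\<^esub> (Lt.mon m \<otimes>\<^bsub>B\<^esub> Lt.mon (lm g))"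
      using cf cg gp inv gt by (simp add: Lt.A.smult_assoc2 Lt.A.m_comm[of "Lt.mon m"] Lt.A.smult_assoc1)
    also have "?k \<otimes>\<^bsub>R\<^esub> lc g = lc f" using cf cg gp inv field_assoc[of "lc f" "inv\<^bsub>R\<^esub> lc g" "lc g"] by simp
    finally have "(?k \<odot>\<^bsub>B\<^esub> Lt.mon m) \<otimes>\<^bsub>B\<^esub> pi_lt (LT r g) = pi_lt (LT r f)"
      using pi_lt_LT[OF fc False] m by (simp add: Lt.mon_add)
    moreover have "?k \<odot>\<^bsub>B\<^esub> Lt.mon m \<in> carrier B" using cf inv by simp
    moreover have "pi_lt (LT r g) \<in> Idl\<^bsub>B\<^esub> ((\<lambda>g. pi_lt (LT r g)) ` set W)"
      using Lt.A.genideal_self[OF Wm] gp by blast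
    ultimately show ?thesis
      using ideal.I_l_closed[OF Lt.A.genideal_ideal[OF Wm]] by metis
  qed
  then have sub: "(\<lambda>f. pi_lt (LT r f)) ` ?I \<subseteq> Idl\<^bsub>B\<^esub> ((\<lambda>g. pi_lt (LT r g)) ` set W)" by blast
  have "Idl\<^bsub>B\<^esub> ((\<lambda>f. pi_lt (LT r f)) ` ?I) = Idl\<^bsub>B\<^esub> ((\<lambda>g. pi_lt (LT r g)) ` set W)"
  proof
    show "Idl\<^bsub>B\<^esub> ((\<lambda>f. pi_lt (LT r f)) ` ?I) \<subseteq> Idl\<^bsub>B\<^esub> ((\<lambda>g. pi_lt (LT r g)) ` set W)"
      by (rule Lt.A.genideal_minimal[OF Lt.A.genideal_ideal[OF Wm] sub])
    have "(\<lambda>f. pi_lt (LT r f)) ` ?I \<subseteq> carrier B"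
      using sub ideal.Icarr[OF Lt.A.genideal_ideal[OF Wm]] by blast
    then show "Idl\<^bsub>B\<^esub> ((\<lambda>g. pi_lt (LT r g)) ` set W) \<subseteq> Idl\<^bsub>B\<^esub> ((\<lambda>f. pi_lt (LT r f)) ` ?I)"
      by (rule Lt.A.subset_Idl_subset) (use WI in blast)
  qed
  then show "groebner_basis (Idl\<^bsub>A\<^esub> G) (set W)"
    using idl WI by (simp add: groebner_basis_def GI)
qed

end

section \<open>Programs on lists and monomials\<close>

notation Seq (infixr \<open>;;\<close> 60)
notation Fork (infixr \<open>\<triangle>\<close> 65)

abbreviation "pr1 \<equiv> Prim Fst"
abbreviation "pr2 \<equiv> Prim Snd"
abbreviation "num n \<equiv> Prim (Lit n)"

definition p_if :: "prog \<Rightarrow> prog \<Rightarrow> prog \<Rightarrow> prog"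
  where "p_if b p q = (b \<triangle> Skip) ;; Cond p q"

definition p_not :: "prog \<Rightarrow> prog"
  where "p_not p = p_if p (num 0) (num 1)"

text \<open>Together with \<open>exec_if\<close>, these equations let the simplifier run loop-free
  programs.\<close>

lemma exec_simps [simp]:
  "exec M (Prim x) v w \<longleftrightarrow> run_prim M x v = Some w"
  "exec M Skip v w \<longleftrightarrow> w = v"
  "exec M (p ;; q) v w \<longleftrightarrow> (\<exists>u. exec M p v u \<and> exec M q u w)"
  "exec M (p \<triangle> q) v w \<longleftrightarrow> (\<exists>a b. w = Tup a b \<and> exec M p v a \<and> exec M q v b)"
  "exec M (Cond p q) (Tup b v) w \<longleftrightarrow> (if b = Num 0 then exec M q v w else exec M p v w)"
      apply (blast elim: exec_PrimE intro: exec.Prim)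
     apply (blast elim: exec_SkipE intro: exec.Skip)
    apply (blast elim: exec_SeqE intro: exec.Seq)
   apply (blast elim: exec_ForkE intro: exec.Fork)
  apply (auto elim: exec_CondE intro: exec.Cond_true exec.Cond_false)
  done

lemma exec_if [simp]:
  "exec M (p_if b p q) v w \<longleftrightarrow> (\<exists>c. exec M b v c \<and> (if c = Num 0 then exec M q v w else exec M p v w))"
proof -
  have "exec M (p_if b p q) v w \<longleftrightarrow> (\<exists>c. exec M b v c \<and> exec M (Cond p q) (Tup c v) w)"
    unfolding p_if_def exec_simps(2-4) by blast
  then show ?thesis by (simp only: exec_simps(5))
qed

text \<open>Determinism turns a known run into a rewrite rule for an unknown result, so that
  simplification eliminates the intermediate values of larger programs.\<close>

lemma exec_iff: "exec M p v w \<Longrightarrow> exec M p v w' \<longleftrightarrow> w' = w"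
  by (blast intro: exec_deterministic)

lemma exec_While_simps:
  "exec M (While p) (Tup (Num 0) u) w \<longleftrightarrow> w = Tup (Num 0) u"
  "b \<noteq> Num 0 \<Longrightarrow> exec M (While p) (Tup b u) w \<longleftrightarrow> (\<exists>v. exec M p (Tup b u) v \<and> exec M (While p) v w)"
proof -
  show "exec M (While p) (Tup (Num 0) u) w \<longleftrightarrow> w = Tup (Num 0) u"
    by (blast elim: exec_WhileE intro: exec.While_false)
  assume b: "b \<noteq> Num 0"
  show "exec M (While p) (Tup b u) w \<longleftrightarrow> (\<exists>v. exec M p (Tup b u) v \<and> exec M (While p) v w)"
  proof
    assume "exec M (While p) (Tup b u) w"
    then show "\<exists>v. exec M p (Tup b u) v \<and> exec M (While p) v w"
      by (rule exec_WhileE) (use b in auto)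
  qed (use b exec.While_true in blast)
qed

lemma exec_While_step:
  "b \<noteq> Num 0 \<Longrightarrow> exec M p (Tup b u) v \<Longrightarrow> exec M (While p) (Tup b u) w \<longleftrightarrow> exec M (While p) v w"
  by (simp add: exec_While_simps(2) exec_iff)

abbreviation "truth P \<equiv> Num (if P then 1 else 0 :: nat)"

lemma truth_iff [simp]: "truth P = Num 0 \<longleftrightarrow> \<not> P" "Num 0 = truth P \<longleftrightarrow> \<not> P"
  by auto

lemma exec_not: "exec M p v b \<Longrightarrow> exec M (p_not p) v (truth (b = Num 0))"
  by (auto simp: p_not_def exec_iff)

text \<open>The counter stands first because \<open>While\<close> tests the first component, so the
  argument is the pair \<open>(b, a)\<close> for \<open>a - b\<close>. Truncation at 0 comes from
  \<open>Pred\<close>.\<close>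

definition p_monus :: prog
  where "p_monus = While ((pr1 ;; Prim Pred) \<triangle> (pr2 ;; Prim Pred)) ;; pr2"

definition p_plus :: prog
  where "p_plus = While ((pr1 ;; Prim Pred) \<triangle> (pr2 ;; Prim Succ)) ;; pr2"

lemma exec_monus: "exec M p_monus (Tup (Num b) (Num a)) (Num (a - b))"
proof -
  have "exec M (While ((pr1 ;; Prim Pred) \<triangle> (pr2 ;; Prim Pred))) (Tup (Num b) (Num a)) (Tup (Num 0) (Num (a - b)))"
  proof (induction b arbitrary: a)
    case (Suc b)
    from Suc[of "a - 1"] show ?case by (simp add: exec_While_simps)
  qed (simp add: exec_While_simps)
  then show ?thesis by (simp add: p_monus_def exec_iff)
qed

lemma exec_plus: "exec M p_plus (Tup (Num b) (Num a)) (Num (a + b))"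
proof -
  have "exec M (While ((pr1 ;; Prim Pred) \<triangle> (pr2 ;; Prim Succ))) (Tup (Num b) (Num a)) (Tup (Num 0) (Num (a + b)))"
  proof (induction b arbitrary: a)
    case (Suc b)
    from Suc[of "Suc a"] show ?case by (simp add: exec_While_simps)
  qed (simp add: exec_While_simps)
  then show ?thesis by (simp add: p_plus_def exec_iff)
qed

text \<open>\<open>p_fold p\<close> maps \<open>(list, acc, env)\<close> to the final accumulator, where \<open>p\<close> maps \<open>(x, acc, env)\<close> to the
  next one.\<close>

definition p_fold :: "prog \<Rightarrow> prog"
  where "p_fold p = While ((pr1 ;; pr2) \<triangle> ((((pr1 ;; pr1) \<triangle> pr2) ;; p) \<triangle> (pr2 ;; pr2))) ;; pr2 ;; pr1"

text \<open>The step may use the whole splitting of the list, not just the current element: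
  distinctness of the list, or the position in a second list, is read off from it.\<close>

lemma exec_fold:
  assumes step: "\<And>ys x zs a. xs = ys @ x # zs \<Longrightarrow> J ys a \<Longrightarrow>
      \<exists>a'. exec M p (Tup (e x) (Tup a env)) a' \<and> J (ys @ [x]) a'"
    and init: "J [] a"
  shows "\<exists>a'. exec M (p_fold p) (Tup (enc_list (map e xs)) (Tup a env)) a' \<and> J xs a'"
proof -
  let ?B = "(pr1 ;; pr2) \<triangle> ((((pr1 ;; pr1) \<triangle> pr2) ;; p) \<triangle> (pr2 ;; pr2))"
  have "\<exists>a'. exec M (While ?B) (Tup (enc_list (map e zs)) (Tup a env)) (Tup (Num 0) (Tup a' env)) \<and> J xs a'"
    if "xs = ys @ zs" "J ys a" for ys zs a
    using that
  proof (induction zs arbitrary: ys a)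
    case Nil
    then show ?case by (auto simp: exec_While_simps)
  next
    case (Cons x zs)
    obtain a' where a': "exec M p (Tup (e x) (Tup a env)) a'" "J (ys @ [x]) a'"
      using step[OF Cons.prems] by blast
    obtain a'' where "exec M (While ?B) (Tup (enc_list (map e zs)) (Tup a' env)) (Tup (Num 0) (Tup a'' env))" "J xs a''"
      using Cons.IH[of "ys @ [x]" a'] Cons.prems(1) a'(2) by auto
    then show ?case using a'(1) by (auto simp: exec_While_simps exec_iff)
  qed
  from this[of "[]" xs a] init obtain a' where
    "exec M (While ?B) (Tup (enc_list (map e xs)) (Tup a env)) (Tup (Num 0) (Tup a' env))" "J xs a'"
    by auto
  then show ?thesis by (auto simp: p_fold_def exec_iff)
qed

text \<open>The result is the value of \<open>q\<close> at the first element where it is not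
  \<open>Num 0\<close>, so it is both a truth value and a witness. Universal statements are run as
  failing searches for a counterexample.\<close>

definition p_first :: "prog \<Rightarrow> prog"
  where "p_first q = (pr1 \<triangle> num 0 \<triangle> pr2) ;;
    p_fold (p_if (pr2 ;; pr1) (pr2 ;; pr1) ((pr1 \<triangle> (pr2 ;; pr2)) ;; q))"

text \<open>The splitting records failure on all earlier elements, which identifies the first
  divisor in a list.\<close>

lemma exec_first_split:
  assumes q: "\<And>x. x \<in> set xs \<Longrightarrow> \<exists>v. exec M q (Tup (e x) env) v \<and> P x v"
  shows "\<exists>v. exec M (p_first q) (Tup (enc_list (map e xs)) env) v \<and>
    (v = Num 0 \<and> (\<forall>x\<in>set xs. P x (Num 0)) \<or>
     v \<noteq> Num 0 \<and> (\<exists>ys x zs. xs = ys @ x # zs \<and> P x v \<and> (\<forall>y\<in>set ys. P y (Num 0))))"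
proof -
  let ?p = "p_if (pr2 ;; pr1) (pr2 ;; pr1) ((pr1 \<triangle> (pr2 ;; pr2)) ;; q)"
  let ?J = "\<lambda>us v. v = Num 0 \<and> (\<forall>x\<in>set us. P x (Num 0)) \<or>
     v \<noteq> Num 0 \<and> (\<exists>ys x zs. us = ys @ x # zs \<and> P x v \<and> (\<forall>y\<in>set ys. P y (Num 0)))"
  have "\<exists>v. exec M (p_fold ?p) (Tup (enc_list (map e xs)) (Tup (Num 0) env)) v \<and> ?J xs v"
  proof (rule exec_fold)
    fix ys x zs a
    assume xs: "xs = ys @ x # zs" and J: "?J ys a"
    obtain v where v: "exec M q (Tup (e x) env) v" "P x v" using q[of x] xs by auto
    show "\<exists>a'. exec M ?p (Tup (e x) (Tup a env)) a' \<and> ?J (ys @ [x]) a'"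
    proof (cases "a = Num 0")
      case True
      then have "exec M ?p (Tup (e x) (Tup a env)) v" using v by (simp add: exec_iff)
      moreover have "?J (ys @ [x]) v"
      proof (cases "v = Num 0")
        case False
        then show ?thesis using True J v(2) by (intro disjI2 conjI exI[of _ ys] exI[of _ x] exI[of _ "[]"]) auto
      qed (use True J v(2) in auto)
      ultimately show ?thesis by blast
    next
      case False
      then obtain us y zs where us: "ys = us @ y # zs" "P y a" "\<forall>y\<in>set us. P y (Num 0)" using J by blast
      have "?J (ys @ [x]) a"
        using False us by (intro disjI2 conjI exI[of _ us] exI[of _ y] exI[of _ "zs @ [x]"]) auto
      moreover have "exec M ?p (Tup (e x) (Tup a env)) a" using False by simp
      ultimately show ?thesis by blast
    qed
  qed simp
  then show ?thesis by (simp add: p_first_def)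
qed

lemma exec_first:
  assumes "\<And>x. x \<in> set xs \<Longrightarrow> \<exists>v. exec M q (Tup (e x) env) v \<and> P x v"
  shows "\<exists>v. exec M (p_first q) (Tup (enc_list (map e xs)) env) v \<and>
    (v = Num 0 \<and> (\<forall>x\<in>set xs. P x (Num 0)) \<or> v \<noteq> Num 0 \<and> (\<exists>x\<in>set xs. P x v))"
  using exec_first_split[of xs M q e env P] assms by force

lemma exec_first_ex:
  assumes "\<And>x. x \<in> set xs \<Longrightarrow> \<exists>v. exec M q (Tup (e x) env) v \<and> (v \<noteq> Num 0 \<longleftrightarrow> P x)"
  shows "\<exists>v. exec M (p_first q) (Tup (enc_list (map e xs)) env) v \<and> (v \<noteq> Num 0 \<longleftrightarrow> (\<exists>x\<in>set xs. P x))"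
proof -
  from exec_first[of xs M q e env "\<lambda>x v. v \<noteq> Num 0 \<longleftrightarrow> P x"] assms
  obtain v where "exec M (p_first q) (Tup (enc_list (map e xs)) env) v"
    "v = Num 0 \<and> (\<forall>x\<in>set xs. \<not> P x) \<or> v \<noteq> Num 0 \<and> (\<exists>x\<in>set xs. P x)"
    by auto
  then show ?thesis by blast
qed

definition p_rev :: prog
  where "p_rev = (Skip \<triangle> num 0 \<triangle> num 0) ;; p_fold (pr1 \<triangle> (pr2 ;; pr1))"

lemma exec_rev: "exec M p_rev (enc_list xs) (enc_list (rev xs))"
proof -
  have "\<exists>a. exec M (p_fold (pr1 \<triangle> (pr2 ;; pr1))) (Tup (enc_list (map (\<lambda>x. x) xs)) (Tup (Num 0) (Num 0))) a
      \<and> a = enc_list (rev xs)"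
    by (rule exec_fold) simp_all
  then show ?thesis by (simp add: p_rev_def)
qed

text \<open>The fold runs over one list while the other is consumed inside the accumulator; results
  pile up in reverse order, hence the final \<open>p_rev\<close>.\<close>

definition p_zip :: "prog \<Rightarrow> prog"
  where "p_zip q = (pr1 \<triangle> (pr2 \<triangle> num 0) \<triangle> num 0) ;;
    p_fold ((pr2 ;; pr1 ;; pr1 ;; pr2) \<triangle> ((pr1 \<triangle> (pr2 ;; pr1 ;; pr1 ;; pr1)) ;; q) \<triangle> (pr2 ;; pr1 ;; pr2)) ;;
    pr2 ;; p_rev"

lemma exec_zip:
  assumes q: "\<And>x. x \<in> set xs \<Longrightarrow> exec M q (Tup (f x) (g x)) (h x)"
  shows "exec M (p_zip q) (Tup (enc_list (map f xs)) (enc_list (map g xs))) (enc_list (map h xs))"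
proof -
  let ?p = "(pr2 ;; pr1 ;; pr1 ;; pr2) \<triangle> ((pr1 \<triangle> (pr2 ;; pr1 ;; pr1 ;; pr1)) ;; q) \<triangle> (pr2 ;; pr1 ;; pr2)"
  let ?J = "\<lambda>us a. a = Tup (enc_list (map g (drop (length us) xs))) (enc_list (rev (map h us)))"
  have "\<exists>a. exec M (p_fold ?p) (Tup (enc_list (map f xs)) (Tup (Tup (enc_list (map g xs)) (Num 0)) (Num 0))) a \<and> ?J xs a"
  proof (rule exec_fold[where J = ?J])
    fix ys x zs a
    assume "xs = ys @ x # zs" "?J ys a"
    then show "\<exists>a'. exec M ?p (Tup (f x) (Tup a (Num 0))) a' \<and> ?J (ys @ [x]) a'"
      using q[of x] by (simp add: exec_iff)
  qed simp
  then show ?thesis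
    using exec_rev[of M "rev (map h xs)"] by (simp add: p_zip_def exec_iff)
qed

definition p_mdiff :: prog where "p_mdiff = p_zip p_monus"

definition p_madd :: prog where "p_madd = p_zip p_plus"

text \<open>Containment of \<open>u\<close> in \<open>v\<close> means that the truncated difference
  \<open>u - v\<close> is zero, so a nonzero exponent is searched for; an exponent is itself a truth
  value. The pair is swapped because \<open>p_mdiff\<close> subtracts its first argument from its
  second.\<close>

definition p_mdvd :: prog
  where "p_mdvd = (((pr2 \<triangle> pr1) ;; p_mdiff) \<triangle> num 0) ;; p_not (p_first pr1)"

lemma exec_mdiff: "exec M p_mdiff (Tup (enc_mon hs u) (enc_mon hs v)) (enc_mon hs (v - u))"
  unfolding p_mdiff_def enc_mon_def by (rule exec_zip) (simp add: exec_monus)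

lemma exec_madd: "exec M p_madd (Tup (enc_mon hs u) (enc_mon hs v)) (enc_mon hs (u + v))"
  unfolding p_madd_def enc_mon_def
  by (rule exec_zip) (metis add.commute count_union exec_plus)

lemma exec_mdvd:
  assumes "set_mset u \<subseteq> set hs"
  shows "exec M p_mdvd (Tup (enc_mon hs u) (enc_mon hs v)) (truth (u \<subseteq># v))"
proof -
  have "\<exists>b. exec M (p_first pr1) (Tup (enc_list (map (\<lambda>h. Num (count (u - v) h)) hs)) (Num 0)) b \<and>
      (b \<noteq> Num 0 \<longleftrightarrow> (\<exists>h\<in>set hs. count (u - v) h \<noteq> 0))"
    by (rule exec_first_ex) simp
  then obtain b where b: "exec M (p_first pr1) (Tup (enc_mon hs (u - v)) (Num 0)) b"
      "b \<noteq> Num 0 \<longleftrightarrow> (\<exists>h\<in>set hs. count (u - v) h \<noteq> 0)"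
    unfolding enc_mon_def by blast
  have "u \<subseteq># v \<longleftrightarrow> (\<forall>h. count (u - v) h = 0)" by (simp add: subseteq_mset_def)
  also have "\<dots> \<longleftrightarrow> (\<forall>h\<in>set hs. count (u - v) h = 0)"
    using assms by (metis count_diff count_eq_zero_iff diff_0_eq_0 subsetD)
  finally have "b = Num 0 \<longleftrightarrow> u \<subseteq># v" using b(2) by auto
  then show ?thesis
    using exec_not[OF b(1)] exec_mdiff[of M hs v u] by (simp add: p_mdvd_def exec_iff)
qed

text \<open>The initial pair of zeros encodes the list whose only entry is the empty list. Each of
  \<open>n\<close> rounds prepends the values from \<open>N\<close> down to 0 to every list found so
  far; the inner counter starts at \<open>N + 1\<close> since an entry is one less than the
  counter.\<close>

definition p_box :: prog
  where "p_box = (pr1 \<triangle> (num 0 \<triangle> num 0) \<triangle> pr2) ;;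
    While ((pr1 ;; Prim Pred) \<triangle>
      (((pr2 ;; pr1) \<triangle> num 0 \<triangle> (pr2 ;; pr2)) ;;
        p_fold (((pr2 ;; pr2 ;; Prim Succ) \<triangle> pr1 \<triangle> (pr2 ;; pr1)) ;;
          While ((pr1 ;; Prim Pred) \<triangle> (pr2 ;; pr1) \<triangle> (((pr1 ;; Prim Pred) \<triangle> (pr2 ;; pr1)) \<triangle> (pr2 ;; pr2))) ;;
          pr2 ;; pr2)) \<triangle>
      (pr2 ;; pr2)) ;;
    pr2 ;; pr1"

lemma exec_box:
  fixes M :: "'r machine"
  shows
  "\<exists>xss. exec M p_box (Tup (Num n) (Num N)) (enc_list (map (\<lambda>xs. enc_list (map Num xs)) xss)) \<and>
    set xss = {xs. length xs = n \<and> (\<forall>x\<in>set xs. x \<le> N)}"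
proof -
  define e :: "nat list \<Rightarrow> 'r val" where "e xs = enc_list (map Num xs)" for xs
  have e_simps: "e [] = Num 0" "e (x # xs) = Tup (Num x) (e xs)" for x xs by (simp_all add: e_def)
  let ?W = "While ((pr1 ;; Prim Pred) \<triangle> (pr2 ;; pr1) \<triangle> (((pr1 ;; Prim Pred) \<triangle> (pr2 ;; pr1)) \<triangle> (pr2 ;; pr2)))"
  let ?p = "((pr2 ;; pr2 ;; Prim Succ) \<triangle> pr1 \<triangle> (pr2 ;; pr1)) ;; ?W ;; pr2 ;; pr2"
  let ?V = "While ((pr1 ;; Prim Pred) \<triangle> (((pr2 ;; pr1) \<triangle> num 0 \<triangle> (pr2 ;; pr2)) ;; p_fold ?p) \<triangle> (pr2 ;; pr2))"
  have cons: "\<exists>yss. exec M ?W (Tup (Num k) (Tup (e xs) (enc_list (map e xss))))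
        (Tup (Num 0) (Tup (e xs) (enc_list (map e yss)))) \<and>
      set yss = set xss \<union> (\<lambda>x. x # xs) ` {..<k}" for k xs xss
  proof (induction k arbitrary: xss)
    case 0
    then show ?case by (auto simp: exec_While_simps)
  next
    case (Suc k)
    obtain yss where "exec M ?W (Tup (Num k) (Tup (e xs) (enc_list (map e ((k # xs) # xss)))))
        (Tup (Num 0) (Tup (e xs) (enc_list (map e yss))))"
      "set yss = set ((k # xs) # xss) \<union> (\<lambda>x. x # xs) ` {..<k}"
      using Suc[of "(k # xs) # xss"] by blast
    then show ?case by (intro exI[of _ yss]) (auto simp: exec_While_simps e_simps lessThan_Suc)
  qed
  have fold: "\<exists>a. exec M (p_fold ?p) (Tup (enc_list (map e xss)) (Tup (Num 0) (Num N))) a \<and>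
      (\<exists>yss. a = enc_list (map e yss) \<and> set yss = {x # xs | x xs. x \<le> N \<and> xs \<in> set xss})" for xss
  proof (rule exec_fold)
    fix ys x zs a
    assume "\<exists>yss. a = enc_list (map e yss) \<and> set yss = {x # xs | x xs. x \<le> N \<and> xs \<in> set ys}"
    then obtain yss where yss: "a = enc_list (map e yss)" "set yss = {x # xs | x xs. x \<le> N \<and> xs \<in> set ys}"
      by blast
    obtain uss where "exec M ?W (Tup (Num (Suc N)) (Tup (e x) (enc_list (map e yss))))
        (Tup (Num 0) (Tup (e x) (enc_list (map e uss))))"
      "set uss = set yss \<union> (\<lambda>y. y # x) ` {..<Suc N}"
      using cons by blast
    then show "\<exists>a'. exec M ?p (Tup (e x) (Tup a (Num N))) a' \<and>
        (\<exists>yss. a' = enc_list (map e yss) \<and> set yss = {z # xs | z xs. z \<le> N \<and> xs \<in> set (ys @ [x])})"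
      using yss by (intro exI[of _ "enc_list (map e uss)"] conjI exI[of _ uss]) (auto simp: exec_iff)
  qed auto
  have "\<exists>yss. exec M ?V (Tup (Num k) (Tup (enc_list (map e xss)) (Num N)))
        (Tup (Num 0) (Tup (enc_list (map e yss)) (Num N))) \<and>
      set yss = {us @ xs | us xs. length us = k \<and> (\<forall>x\<in>set us. x \<le> N) \<and> xs \<in> set xss}" for k xss
  proof (induction k arbitrary: xss)
    case 0
    then show ?case by (auto simp: exec_While_simps)
  next
    case (Suc k)
    obtain uss where u: "exec M (p_fold ?p) (Tup (enc_list (map e xss)) (Tup (Num 0) (Num N))) (enc_list (map e uss))"
        "set uss = {x # xs | x xs. x \<le> N \<and> xs \<in> set xss}"
      using fold[of xss] by blast
    obtain yss where y: "exec M ?V (Tup (Num k) (Tup (enc_list (map e uss)) (Num N)))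
        (Tup (Num 0) (Tup (enc_list (map e yss)) (Num N)))"
      "set yss = {us @ xs | us xs. length us = k \<and> (\<forall>x\<in>set us. x \<le> N) \<and> xs \<in> set uss}"
      using Suc[of uss] by blast
    \<comment> \<open>The round performed first acts directly on \<open>xs\<close>, so its entry
      becomes the last one of the prefix.\<close>
    have "set yss = {us @ xs | us xs. length us = Suc k \<and> (\<forall>x\<in>set us. x \<le> N) \<and> xs \<in> set xss}" (is "_ = ?R")
    proof
      show "set yss \<subseteq> ?R"
      proof
        fix z assume "z \<in> set yss"
        then obtain us x xs where "z = (us @ [x]) @ xs" "length us = k" "\<forall>x\<in>set us. x \<le> N" "x \<le> N" "xs \<in> set xss"
          unfolding y(2) u(2) by auto
        then show "z \<in> ?R" by (intro CollectI exI[of _ "us @ [x]"] exI[of _ xs]) auto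
      qed
      show "?R \<subseteq> set yss"
      proof
        fix z assume "z \<in> ?R"
        then obtain us xs where us: "z = us @ xs" "length us = Suc k" "\<forall>x\<in>set us. x \<le> N" "xs \<in> set xss" by blast
        then have "us = butlast us @ [last us]" by (metis append_butlast_last_id length_0_conv nat.distinct(1))
        then have "z = butlast us @ (last us # xs)" using us(1) by (metis append.assoc append_Cons append_Nil)
        moreover have "last us \<le> N" using us(2,3) by (metis last_in_set length_0_conv nat.distinct(1))
        ultimately show "z \<in> set yss" unfolding y(2) u(2) using us
          by (intro CollectI exI[of _ "butlast us"] exI[of _ "last us # xs"]) (auto dest: in_set_butlastD)
      qed
    qed
    then show ?case using u(1) y(1)
      by (intro exI[of _ yss]) (auto simp: exec_While_simps exec_iff)
  qed
  from this[of n "[[]]"] obtain yss where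
    "exec M ?V (Tup (Num n) (Tup (Tup (Num 0) (Num 0)) (Num N))) (Tup (Num 0) (Tup (enc_list (map e yss)) (Num N)))"
    "set yss = {us. length us = n \<and> (\<forall>x\<in>set us. x \<le> N)}"
    by (auto simp: e_simps)
  then show ?thesis
    unfolding e_def[abs_def, symmetric] by (intro exI[of _ yss]) (simp add: p_box_def exec_iff)
qed

section \<open>Programs for arithmetic and division\<close>

text \<open>Equality of monomials is decided through the order, by antisymmetry.\<close>

definition p_meq :: prog
  where "p_meq = p_if (Prim LeStd) ((pr2 \<triangle> pr1) ;; Prim LeStd) (num 0)"

text \<open>The accumulator holds a pending term and the terms already passed. A term with the same
  monomial is absorbed into the pending one, which is finally dropped if its coefficient has become
  zero, as representations list nonzero terms only.\<close>

definition p_addterm :: prog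
  where "p_addterm = (pr2 \<triangle> (pr1 \<triangle> num 0) \<triangle> num 0) ;;
    p_fold (p_if (((pr1 ;; pr1) \<triangle> (pr2 ;; pr1 ;; pr1 ;; pr1)) ;; p_meq)
      (((pr2 ;; pr1 ;; pr1 ;; pr1) \<triangle> (((pr2 ;; pr1 ;; pr1 ;; pr2) \<triangle> (pr1 ;; pr2)) ;; Prim ScalAdd)) \<triangle>
        (pr2 ;; pr1 ;; pr2))
      ((pr2 ;; pr1 ;; pr1) \<triangle> pr1 \<triangle> (pr2 ;; pr1 ;; pr2))) ;;
    p_if (pr1 ;; pr2 ;; Prim ScalIsZero) pr2 Skip"

text \<open>One operation, \<open>f + k w g\<close>, serves two purposes: with \<open>f = 0\<close>
  and \<open>k = 1\<close> it multiplies, with \<open>k\<close> the negative of a quotient of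
  leading coefficients it cancels a leading term.\<close>

definition p_addmul :: prog
  where "p_addmul = ((pr2 ;; pr2 ;; pr1) \<triangle> (pr2 ;; pr2 ;; pr2) \<triangle> pr1 \<triangle> (pr2 ;; pr1)) ;;
    p_fold (((((pr2 ;; pr2 ;; pr1) \<triangle> (pr1 ;; pr1)) ;; Prim MulStd) \<triangle> (pr2 ;; pr1) \<triangle>
        (((pr2 ;; pr2 ;; pr2) \<triangle> (pr1 ;; pr2)) ;; Prim ScalMul)) ;;
      p_fold (((pr1 ;; pr1) \<triangle> (((pr2 ;; pr2) \<triangle> (pr1 ;; pr2)) ;; Prim ScalMul)) \<triangle> (pr2 ;; pr1) ;; p_addterm))"

definition p_mul :: prog
  where "p_mul = (pr1 \<triangle> Prim ScalOne \<triangle> pr2 \<triangle> num 0) ;; p_addmul"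

text \<open>Terms are stored in no particular order, so the leading one is found as a running
  maximum.\<close>

definition p_lead :: prog
  where "p_lead = (Skip \<triangle> num 0 \<triangle> num 0) ;;
    p_fold (p_if (pr2 ;; pr1)
      (p_if (((pr2 ;; pr1 ;; pr1) \<triangle> (pr1 ;; pr1)) ;; Prim LeStd) pr1 (pr2 ;; pr1)) pr1)"

abbreviation "p_lm \<equiv> p_lead ;; pr1"
abbreviation "p_lc \<equiv> p_lead ;; pr2"

definition p_divisor :: prog
  where "p_divisor = (pr2 \<triangle> pr1) ;;
    p_first (p_if pr1 (p_if (((pr1 ;; p_lm) \<triangle> pr2) ;; p_mdvd) pr1 (num 0)) (num 0))"

text \<open>The divisor found doubles as the loop condition of \<open>p_nf\<close>: it is nonzero,
  so its representation is not \<open>Num 0\<close>.\<close>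

definition p_test :: prog
  where "p_test = p_if pr2 (((pr2 ;; p_lm) \<triangle> pr1) ;; p_divisor) (num 0)"

definition p_cancel :: prog
  where "p_cancel = ((((pr1 ;; p_lm) \<triangle> (pr2 ;; pr2 ;; p_lm)) ;; p_mdiff) \<triangle>
    ((((pr2 ;; pr2 ;; p_lc) \<triangle> (pr1 ;; p_lc ;; Prim ScalInv)) ;; Prim ScalMul) ;; Prim ScalNeg) \<triangle>
    pr1 \<triangle> (pr2 ;; pr2)) ;; p_addmul"

text \<open>Only leading terms are cancelled. This suffices to recognise reduction to 0 and
  otherwise ends with a leading monomial that has no divisor.\<close>

definition p_nf :: prog
  where "p_nf = (p_test \<triangle> Skip) ;;
    While (((pr2 ;; pr1) \<triangle> p_cancel) ;; (p_test \<triangle> Skip)) ;; pr2 ;; pr2"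

definition p_std :: prog
  where "p_std = p_not ((pr2 \<triangle> pr1) ;; p_first p_mdvd)"

section \<open>Elements as lists of terms\<close>

context pseudo_ASL
begin

text \<open>Evaluates partial term lists too, as the loop invariants require.\<close>

definition lsum :: "('h multiset \<times> 'r) list \<Rightarrow> 'a"
  where "lsum ts = foldr (\<lambda>t a. snd t \<odot>\<^bsub>A\<^esub> mon (fst t) \<oplus>\<^bsub>A\<^esub> a) ts \<zero>\<^bsub>A\<^esub>"

definition lists_terms :: "'a \<Rightarrow> ('h multiset \<times> 'r) list \<Rightarrow> bool"
  where "lists_terms f ts \<longleftrightarrow> distinct ts \<and> set ts = {(m, coord f m) | m. coord f m \<noteq> \<zero>\<^bsub>R\<^esub>}"

lemma lsum_closed: "\<forall>t\<in>set ts. snd t \<in> carrier R \<Longrightarrow> lsum ts \<in> carrier A"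
  by (induction ts) (auto simp: lsum_def)

lemma lsum_snoc:
  "\<forall>t\<in>set (ts @ [t]). snd t \<in> carrier R \<Longrightarrow> lsum (ts @ [t]) = lsum ts \<oplus>\<^bsub>A\<^esub> snd t \<odot>\<^bsub>A\<^esub> mon (fst t)"
proof (induction ts)
  case (Cons s ts)
  then show ?case using lsum_closed[of ts] by (simp add: lsum_def A.M.a_assoc)
qed (simp add: lsum_def)

lemma coord_lsum:
  assumes "distinct (map fst ts)" "\<forall>t\<in>set ts. fst t \<in> Std \<and> snd t \<in> carrier R"
  shows "((m, c) \<in> set ts \<longrightarrow> coord (lsum ts) m = c) \<and> (m \<notin> fst ` set ts \<longrightarrow> coord (lsum ts) m = \<zero>\<^bsub>R\<^esub>)"
  using assms
proof (induction ts)
  case Nil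
  then show ?case by (simp add: lsum_def coord_zero)
next
  case (Cons t ts)
  have ts: "lsum ts \<in> carrier A" using Cons.prems(2) by (intro lsum_closed) auto
  have "lsum (t # ts) = snd t \<odot>\<^bsub>A\<^esub> mon (fst t) \<oplus>\<^bsub>A\<^esub> lsum ts" by (simp add: lsum_def)
  then have eq: "coord (lsum (t # ts)) m = (if m = fst t then snd t else \<zero>\<^bsub>R\<^esub>) \<oplus>\<^bsub>R\<^esub> coord (lsum ts) m"
    using Cons.prems(2) ts by (simp add: coord_add coord_term)
  show ?case
  proof (cases "m = fst t")
    case True
    then have "m \<notin> fst ` set ts" using Cons.prems(1) by auto
    then have "coord (lsum ts) m = \<zero>\<^bsub>R\<^esub>" using Cons by simp
    then have "coord (lsum (t # ts)) m = snd t" using eq True Cons.prems(2) by simp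
    moreover have "(m, c) \<in> set (t # ts) \<longrightarrow> c = snd t" using \<open>m \<notin> fst ` set ts\<close> by force
    ultimately show ?thesis using True by auto
  next
    case False
    then have "coord (lsum (t # ts)) m = coord (lsum ts) m" using eq ts by simp
    then show ?thesis using False Cons by auto
  qed
qed

lemma lists_terms_props:
  assumes "f \<in> carrier A" "lists_terms f ts"
  shows lists_terms_distinct: "distinct (map fst ts)"
    and lists_terms_closed: "\<forall>t\<in>set ts. fst t \<in> Std \<and> snd t \<in> carrier R"
    and lists_terms_supp: "fst ` set ts = supp f"
    and lists_terms_lsum: "lsum ts = f"
proof -
  have set: "set ts = {(m, coord f m) | m. coord f m \<noteq> \<zero>\<^bsub>R\<^esub>}" and d: "distinct ts"
    using assms(2) by (auto simp: lists_terms_def)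
  show dist: "distinct (map fst ts)"
    using d set by (auto simp: distinct_map inj_on_def)
  show supp: "fst ` set ts = supp f"
    unfolding set supp_def by force
  show cl: "\<forall>t\<in>set ts. fst t \<in> Std \<and> snd t \<in> carrier R"
    using supp_Std[OF assms(1)] assms(1) unfolding set supp_def by auto
  have "coord (lsum ts) m = coord f m" for m
  proof (cases "m \<in> supp f")
    case True
    then have "(m, coord f m) \<in> set ts" unfolding set supp_def by blast
    then show ?thesis using coord_lsum[OF dist cl, of m] by blast
  next
    case False
    then show ?thesis using coord_lsum[OF dist cl, of m] supp by (auto simp: supp_def)
  qed
  then show "lsum ts = f" using cl by (intro coord_inj lsum_closed assms(1)) auto
qed

end

section \<open>A single division step\<close>

context leading_term_algebra
begin

text \<open>In the multiple of \<open>g\<close> that is subtracted, only the leading term of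
  \<open>g\<close> contributes at \<open>lm f\<close>, since products with its smaller terms lie
  strictly below. So the coefficient there is \<open>lc g\<close>, and the coordinate at
  \<open>lm f\<close> cancels.\<close>

lemma lm_term_add_less:
  assumes W: "set W \<subseteq> carrier A" and f: "f \<in> carrier A" "f \<noteq> \<zero>\<^bsub>A\<^esub>" and g: "dv W (lm f) = Some g"
  defines "f' \<equiv> f \<oplus>\<^bsub>A\<^esub> (\<ominus>\<^bsub>R\<^esub> (lc f \<otimes>\<^bsub>R\<^esub> inv\<^bsub>R\<^esub> lc g)) \<odot>\<^bsub>A\<^esub> (mon (lm f - lm g) \<otimes>\<^bsub>A\<^esub> g)"
  shows "f' \<in> carrier A" and "\<And>v. v \<in> supp f' \<Longrightarrow> v \<prec> lm f"
    and "reduces W f' \<Longrightarrow> reduces W f"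
    and "ideal I A \<Longrightarrow> set W \<subseteq> I \<Longrightarrow> f \<in> I \<Longrightarrow> f' \<in> I"
proof -
  note gp = dvD[OF g]
  have gc: "g \<in> carrier A" using gp W by blast
  have dv: "dv W (lm f) \<noteq> None" by (simp add: g)
  define k where "k = lc f \<otimes>\<^bsub>R\<^esub> inv\<^bsub>R\<^esub> lc g"
  note cf = lc_props[OF f] and cg = lc_props[OF gc]
  have inv: "inv\<^bsub>R\<^esub> lc g \<in> carrier R" "inv\<^bsub>R\<^esub> lc g \<noteq> \<zero>\<^bsub>R\<^esub>" "inv\<^bsub>R\<^esub> lc g \<otimes>\<^bsub>R\<^esub> lc g = \<one>\<^bsub>R\<^esub>"
    using cg gp field_Units by auto
  have k: "k \<in> carrier R" "k \<noteq> \<zero>\<^bsub>R\<^esub>" using cf inv by (auto simp: k_def integral_iff)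
  define p where "p = red W (lm f)"
  have p: "p = mon (lm f - lm g) \<otimes>\<^bsub>A\<^esub> g" by (simp add: p_def red_def g)
  note pp = red_props[OF W lm_Std[OF f] dv, folded p_def]
  have f': "f' = f \<oplus>\<^bsub>A\<^esub> (\<ominus>\<^bsub>R\<^esub> k) \<odot>\<^bsub>A\<^esub> p" unfolding f'_def k_def p ..
  show f'c: "f' \<in> carrier A" unfolding f' using f k pp by simp
  \<comment> \<open>Read backwards, \<open>f\<close> is one division step plus \<open>f'\<close>,
    which is the form of the introduction rule of \<open>reduces\<close>.\<close>
  have "f = k \<odot>\<^bsub>A\<^esub> p \<oplus>\<^bsub>A\<^esub> f'"
    unfolding f' using f k pp by (simp add: A.smult_l_minus A.M.a_lcomm A.M.r_neg)
  note feq = this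
  have m: "(lm f - lm g) + lm g = lm f" using gp by simp
  have mS: "lm f - lm g \<in> Std" using m lm_Std[OF f] Std_addD by metis
  have "coord p (lm f) = lc g"
  proof -
    obtain b where b: "b \<in> carrier A" "g = lc g \<odot>\<^bsub>A\<^esub> mon (lm g) \<oplus>\<^bsub>A\<^esub> b" "\<And>v. v \<in> supp b \<Longrightarrow> v \<prec> lm g"
      using split_lm[OF gc] gp unfolding lc_def by blast
    have "p = lc g \<odot>\<^bsub>A\<^esub> (mon (lm f - lm g) \<otimes>\<^bsub>A\<^esub> mon (lm g)) \<oplus>\<^bsub>A\<^esub> mon (lm f - lm g) \<otimes>\<^bsub>A\<^esub> b"
      using mult_term_add[of "mon (lm f - lm g)" "lc g" "mon (lm g)" b] b(1) cg gp
      by (simp add: p flip: b(2))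
    also have "mon (lm f - lm g) \<otimes>\<^bsub>A\<^esub> mon (lm g) = mon (lm f)" by (simp add: m flip: mon_add)
    finally have "coord p (lm f) = lc g \<oplus>\<^bsub>R\<^esub> coord (mon (lm f - lm g) \<otimes>\<^bsub>A\<^esub> b) (lm f)"
      using b(1) cg gp lm_Std[OF f] by (simp add: coord_add coord_term)
    moreover have "lm f \<notin> supp (mon (lm f - lm g) \<otimes>\<^bsub>A\<^esub> b)"
    proof
      assume "lm f \<in> supp (mon (lm f - lm g) \<otimes>\<^bsub>A\<^esub> b)"
      then obtain y where y: "y \<in> supp b" "lm f \<in> supp (mon (lm f - lm g) \<otimes>\<^bsub>A\<^esub> mon y)"
        using supp_mult[OF mon_closed b(1)] by blast
      have "lm f \<preceq> pm (lm f - lm g) y" "nz (lm f - lm g) y" using pm_max[OF y(2)] by auto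
      moreover have "pm (lm f - lm g) y \<prec> pm (lm f - lm g) (lm g)"
        using calculation(2) b(3)[OF y(1)] m lm_Std[OF f] le_refl[OF mS] nz_add[of "lm f - lm g" "lm g"]
        by (intro pm_le_less) auto
      ultimately show False
        using pm_add[of "lm f - lm g" "lm g"] m lm_Std[OF f] le_lt_trans lt_irrefl by metis
    qed
    ultimately show ?thesis using cg gp b(1) by (simp add: supp_def)
  qed
  then have "coord f (lm f) = k \<otimes>\<^bsub>R\<^esub> lc g \<oplus>\<^bsub>R\<^esub> coord f' (lm f)"
    using feq k pp f'c by (metis coord_add coord_smult A.smult_closed)
  moreover have "k \<otimes>\<^bsub>R\<^esub> lc g = lc f"
    using cf inv cg gp field_assoc[of "lc f" "inv\<^bsub>R\<^esub> lc g" "lc g"] by (simp add: k_def)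
  ultimately have "coord f' (lm f) = \<zero>\<^bsub>R\<^esub>"
    using field_add_cancel[of "lc f" "coord f' (lm f)"] cf f'c by (simp add: lc_def)
  moreover have "supp f' \<subseteq> supp f \<union> supp p"
    unfolding f' using supp_add[OF f(1), of "(\<ominus>\<^bsub>R\<^esub> k) \<odot>\<^bsub>A\<^esub> p"] supp_smult_subset[of "\<ominus>\<^bsub>R\<^esub> k" p] k pp by auto
  ultimately show less: "v \<prec> lm f" if "v \<in> supp f'" for v
    using that lm_max[OF f, of v] lm_max[OF pp(1,2), of v] pp(3) le_eq_or_lt[of v "lm f"]
    by (auto simp: supp_def)
  show "reduces W f" if "reduces W f'"
  proof -
    have "reduces W (k \<odot>\<^bsub>A\<^esub> red W (lm f) \<oplus>\<^bsub>A\<^esub> f')"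
      by (rule reduces.step[OF lm_Std[OF f] dv k that]) (use less in blast)
    then show ?thesis by (simp only: p_def[symmetric] feq[symmetric])
  qed
  show "f' \<in> I" if I: "ideal I A" "set W \<subseteq> I" "f \<in> I"
  proof -
    interpret I: ideal I A by (rule I(1))
    have "((\<ominus>\<^bsub>R\<^esub> k) \<odot>\<^bsub>A\<^esub> mon (lm f - lm g)) \<otimes>\<^bsub>A\<^esub> g \<in> I"
      using I gp k by (intro I.I_l_closed) auto
    then have "(\<ominus>\<^bsub>R\<^esub> k) \<odot>\<^bsub>A\<^esub> p \<in> I" using k gc by (simp add: p A.smult_assoc2)
    then show ?thesis unfolding f' using I(3) by (simp add: I.a_closed)
  qed
qed

end

section \<open>Correctness of the arithmetic programs\<close>

locale leading_term_machine = leading_term_algebra R A gen H \<Sigma> r B gen_lt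
  for R :: "'r ring" (structure) and A :: "('r, 'a) module" (structure)
    and gen :: "'h \<Rightarrow> 'a" and H :: "'h set" and \<Sigma> :: "'h multiset set"
    and r :: "'h multiset rel"
    and B :: "('r, 'b) module" (structure) and gen_lt :: "'h \<Rightarrow> 'b" +
  fixes hs :: "'h list" and M :: "'r machine" and Ts :: "'h multiset list"
  assumes hs: "distinct hs" "set hs = H" and M: "machine_for hs M" and Ts: "generates_\<Sigma> (set Ts)"
begin

abbreviation em :: "'h multiset \<Rightarrow> 'r val"
  where "em \<equiv> enc_mon hs"

definition et :: "'h multiset \<times> 'r \<Rightarrow> 'r val"
  where "et t = Tup (em (fst t)) (Scal (snd t))"

definition rp :: "'a \<Rightarrow> 'r val \<Rightarrow> bool"
  where "rp f v \<longleftrightarrow> f \<in> carrier A \<and> repr_elem hs f v"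

lemma rp_iff: "rp f v \<longleftrightarrow> f \<in> carrier A \<and> (\<exists>ts. lists_terms f ts \<and> v = enc_list (map et ts))"
proof -
  have "(\<lambda>(m, x). Tup (em m) (Scal x)) = et" by (auto simp: et_def)
  then show ?thesis
    unfolding rp_def repr_elem_def repr_terms_def lists_terms_def by auto
qed

lemma rp_zero: "rp \<zero>\<^bsub>A\<^esub> (Num 0)"
  by (auto simp: rp_iff lists_terms_def coord_zero intro: exI[of _ "[]"])

lemma rp_eq_zero: "rp f v \<Longrightarrow> v = Num 0 \<longleftrightarrow> f = \<zero>\<^bsub>A\<^esub>"
proof -
  assume "rp f v"
  then obtain ts where ts: "f \<in> carrier A" "lists_terms f ts" "v = enc_list (map et ts)" by (auto simp: rp_iff)
  then have "v = Num 0 \<longleftrightarrow> supp f = {}" using lists_terms_supp[OF ts(1,2)] by (cases ts) auto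
  then show ?thesis using supp_empty_iff ts(1) by simp
qed

lemma scalars_M: "scalars M = R"
  using M by (simp add: machine_for_def)

lemma le_M: "m \<in> Std \<Longrightarrow> m' \<in> Std \<Longrightarrow> le_std M (Tup (em m) (em m')) = truth (m \<preceq> m')"
  using M by (simp add: machine_for_def le_def)

lemma mul_M: "m \<in> Std \<Longrightarrow> m' \<in> Std \<Longrightarrow> rp (mon m \<otimes>\<^bsub>A\<^esub> mon m') (mul_std M (Tup (em m) (em m')))"
  using M by (simp add: machine_for_def rp_def repr_elem_def)

lemma exec_meq:
  "m \<in> Std \<Longrightarrow> m' \<in> Std \<Longrightarrow> exec M p_meq (Tup (em m) (em m')) (truth (m = m'))"
  using le_antisym[of m m'] le_refl[of m] by (auto simp: p_meq_def le_M)

lemma exec_addterm: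
  assumes m: "m \<in> Std" and x: "x \<in> carrier R" and v: "rp f v"
  shows "\<exists>w. exec M p_addterm (Tup (Tup (em m) (Scal x)) v) w \<and> rp (x \<odot>\<^bsub>A\<^esub> mon m \<oplus>\<^bsub>A\<^esub> f) w"
proof -
  obtain ts where f: "f \<in> carrier A" and ts: "lists_terms f ts" "v = enc_list (map et ts)"
    using v by (auto simp: rp_iff)
  note tsp = lists_terms_props[OF f ts(1)]
  let ?step = "p_if (((pr1 ;; pr1) \<triangle> (pr2 ;; pr1 ;; pr1 ;; pr1)) ;; p_meq)
      (((pr2 ;; pr1 ;; pr1 ;; pr1) \<triangle> (((pr2 ;; pr1 ;; pr1 ;; pr2) \<triangle> (pr1 ;; pr2)) ;; Prim ScalAdd)) \<triangle>
        (pr2 ;; pr1 ;; pr2))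
      ((pr2 ;; pr1 ;; pr1) \<triangle> pr1 \<triangle> (pr2 ;; pr1 ;; pr2))"
  \<comment> \<open>The amount absorbed so far: zero until \<open>m\<close> is met, and distinctness
    of the monomials means that \<open>m\<close> is met at most once.\<close>
  define c where "c us = (if m \<in> fst ` set us then coord f m else \<zero>\<^bsub>R\<^esub>)" for us :: "('h multiset \<times> 'r) list"
  define out where "out us = rev (filter (\<lambda>t. fst t \<noteq> m) us)" for us :: "('h multiset \<times> 'r) list"
  let ?J = "\<lambda>us a. a = Tup (Tup (em m) (Scal (x \<oplus>\<^bsub>R\<^esub> c us))) (enc_list (map et (out us)))"
  have "\<exists>a. exec M (p_fold ?step) (Tup (enc_list (map et ts)) (Tup (Tup (Tup (em m) (Scal x)) (Num 0)) (Num 0))) a \<and> ?J ts a"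
  proof (rule exec_fold[where J = ?J])
    fix ys t zs a
    assume split: "ts = ys @ t # zs" and a: "?J ys a"
    have "t \<in> set ts" using split by simp
    then have "snd t = coord f (fst t)" using ts(1) unfolding lists_terms_def by auto
    then have t: "fst t \<in> Std" "snd t \<in> carrier R" "snd t = coord f (fst t)" "fst t \<notin> fst ` set ys"
      using tsp(1,2) split by auto
    note meq = exec_meq[OF t(1) m]
    show "\<exists>a'. exec M ?step (Tup (et t) (Tup a (Num 0))) a' \<and> ?J (ys @ [t]) a'"
    proof (cases "fst t = m")
      case True
      then have "c (ys @ [t]) = snd t" "c ys = \<zero>\<^bsub>R\<^esub>" "out (ys @ [t]) = out ys"
        using t by (auto simp: c_def out_def)
      then show ?thesis using a meq x True by (simp add: et_def exec_iff scalars_M)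
    next
      case False
      then have "c (ys @ [t]) = c ys" "out (ys @ [t]) = t # out ys"
        by (auto simp: c_def out_def)
      then show ?thesis using a meq False by (simp add: et_def exec_iff)
    qed
  qed (simp add: c_def out_def x)
  then have fold: "exec M (p_fold ?step) (Tup v (Tup (Tup (Tup (em m) (Scal x)) (Num 0)) (Num 0)))
      (Tup (Tup (em m) (Scal (x \<oplus>\<^bsub>R\<^esub> c ts))) (enc_list (map et (out ts))))"
    using ts(2) by simp
  have c: "c ts = coord f m"
    using tsp(3) by (simp add: c_def supp_def)
  let ?g = "x \<odot>\<^bsub>A\<^esub> mon m \<oplus>\<^bsub>A\<^esub> f"
  have g: "?g \<in> carrier A" using x f by simp
  have coord: "coord ?g u = (if u = m then x \<oplus>\<^bsub>R\<^esub> coord f m else coord f u)" for u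
    using x m f by (simp add: coord_add coord_term)
  define us where "us = (if x \<oplus>\<^bsub>R\<^esub> coord f m = \<zero>\<^bsub>R\<^esub> then out ts else (m, x \<oplus>\<^bsub>R\<^esub> coord f m) # out ts)"
  have "lists_terms ?g us"
    using ts(1) unfolding lists_terms_def us_def out_def coord by (auto split: if_splits)
  moreover have "exec M p_addterm (Tup (Tup (em m) (Scal x)) v) (enc_list (map et us))"
    using fold by (simp add: p_addterm_def exec_iff scalars_M us_def c et_def)
  ultimately show ?thesis using g by (auto simp: rp_iff)
qed

lemma exec_addmul:
  assumes w: "w \<in> Std" and k: "k \<in> carrier R" and g: "rp g vg" and f: "rp f vf"
  shows "\<exists>v. exec M p_addmul (Tup (em w) (Tup (Scal k) (Tup vg vf))) v \<and>
    rp (f \<oplus>\<^bsub>A\<^esub> k \<odot>\<^bsub>A\<^esub> (mon w \<otimes>\<^bsub>A\<^esub> g)) v"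
proof -
  obtain ts where gc: "g \<in> carrier A" and ts: "lists_terms g ts" "vg = enc_list (map et ts)"
    using g by (auto simp: rp_iff)
  have fc: "f \<in> carrier A" using f by (simp add: rp_iff)
  note tsp = lists_terms_props[OF gc ts(1)]
  let ?inner = "((pr1 ;; pr1) \<triangle> (((pr2 ;; pr2) \<triangle> (pr1 ;; pr2)) ;; Prim ScalMul)) \<triangle> (pr2 ;; pr1) ;; p_addterm"
  let ?outer = "((((pr2 ;; pr2 ;; pr1) \<triangle> (pr1 ;; pr1)) ;; Prim MulStd) \<triangle> (pr2 ;; pr1) \<triangle>
        (((pr2 ;; pr2 ;; pr2) \<triangle> (pr1 ;; pr2)) ;; Prim ScalMul)) ;; p_fold ?inner"
  \<comment> \<open>The inner fold adds \<open>l h\<close> for any represented \<open>h\<close>; it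
    is later applied with \<open>h\<close> the product of \<open>w\<close> and a monomial of
    \<open>g\<close>, whose expansion \<open>MulStd\<close> supplies.\<close>
  have inner: "\<exists>b. exec M (p_fold ?inner) (Tup vh (Tup a (Scal l))) b \<and> rp (F \<oplus>\<^bsub>A\<^esub> l \<odot>\<^bsub>A\<^esub> h) b"
    if l: "l \<in> carrier R" and h: "rp h vh" and F: "rp F a" for l h vh F a
  proof -
    obtain us where hc: "h \<in> carrier A" and us: "lists_terms h us" "vh = enc_list (map et us)"
      using h by (auto simp: rp_iff)
    have Fc: "F \<in> carrier A" using F by (simp add: rp_iff)
    note usp = lists_terms_props[OF hc us(1)]
    have "\<exists>b. exec M (p_fold ?inner) (Tup (enc_list (map et us)) (Tup a (Scal l))) b \<and> rp (F \<oplus>\<^bsub>A\<^esub> l \<odot>\<^bsub>A\<^esub> lsum us) b"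
    proof (rule exec_fold[where J = "\<lambda>us b. rp (F \<oplus>\<^bsub>A\<^esub> l \<odot>\<^bsub>A\<^esub> lsum us) b"])
      fix ys t zs b
      assume split: "us = ys @ t # zs" and b: "rp (F \<oplus>\<^bsub>A\<^esub> l \<odot>\<^bsub>A\<^esub> lsum ys) b"
      have t: "fst t \<in> Std" "snd t \<in> carrier R" and ys: "\<forall>t\<in>set (ys @ [t]). snd t \<in> carrier R"
        using usp(2) split by auto
      have yc: "lsum ys \<in> carrier A" using ys by (intro lsum_closed) auto
      obtain b' where b': "exec M p_addterm (Tup (Tup (em (fst t)) (Scal (l \<otimes>\<^bsub>R\<^esub> snd t))) b) b'"
          "rp ((l \<otimes>\<^bsub>R\<^esub> snd t) \<odot>\<^bsub>A\<^esub> mon (fst t) \<oplus>\<^bsub>A\<^esub> (F \<oplus>\<^bsub>A\<^esub> l \<odot>\<^bsub>A\<^esub> lsum ys)) b'"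
        using exec_addterm[OF t(1) _ b, of "l \<otimes>\<^bsub>R\<^esub> snd t"] l t(2) by auto
      have "(l \<otimes>\<^bsub>R\<^esub> snd t) \<odot>\<^bsub>A\<^esub> mon (fst t) \<oplus>\<^bsub>A\<^esub> (F \<oplus>\<^bsub>A\<^esub> l \<odot>\<^bsub>A\<^esub> lsum ys) = F \<oplus>\<^bsub>A\<^esub> l \<odot>\<^bsub>A\<^esub> lsum (ys @ [t])"
        using l t(2) yc Fc lsum_snoc[OF ys] by (simp add: A.smult_assoc1 A.smult_r_distr A.M.a_ac)
      then show "\<exists>b'. exec M ?inner (Tup (et t) (Tup b (Scal l))) b' \<and> rp (F \<oplus>\<^bsub>A\<^esub> l \<odot>\<^bsub>A\<^esub> lsum (ys @ [t])) b'"
        using b' by (auto simp: et_def scalars_M)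
    next
      show "rp (F \<oplus>\<^bsub>A\<^esub> l \<odot>\<^bsub>A\<^esub> lsum []) a" using F Fc l by (simp add: lsum_def)
    qed
    then show ?thesis using us(2) usp(4) by simp
  qed
  have "\<exists>a. exec M (p_fold ?outer) (Tup (enc_list (map et ts)) (Tup vf (Tup (em w) (Scal k)))) a \<and>
      rp (f \<oplus>\<^bsub>A\<^esub> k \<odot>\<^bsub>A\<^esub> (mon w \<otimes>\<^bsub>A\<^esub> lsum ts)) a"
  proof (rule exec_fold[where J = "\<lambda>ts b. rp (f \<oplus>\<^bsub>A\<^esub> k \<odot>\<^bsub>A\<^esub> (mon w \<otimes>\<^bsub>A\<^esub> lsum ts)) b"])
    fix ys t zs a
    assume split: "ts = ys @ t # zs" and a: "rp (f \<oplus>\<^bsub>A\<^esub> k \<odot>\<^bsub>A\<^esub> (mon w \<otimes>\<^bsub>A\<^esub> lsum ys)) a"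
    have t: "fst t \<in> Std" "snd t \<in> carrier R" and ys: "\<forall>t\<in>set (ys @ [t]). snd t \<in> carrier R"
      using tsp(2) split by auto
    have yc: "lsum ys \<in> carrier A" using ys by (intro lsum_closed) auto
    obtain b where b: "exec M (p_fold ?inner) (Tup (mul_std M (Tup (em w) (em (fst t)))) (Tup a (Scal (k \<otimes>\<^bsub>R\<^esub> snd t)))) b"
      "rp ((f \<oplus>\<^bsub>A\<^esub> k \<odot>\<^bsub>A\<^esub> (mon w \<otimes>\<^bsub>A\<^esub> lsum ys)) \<oplus>\<^bsub>A\<^esub> (k \<otimes>\<^bsub>R\<^esub> snd t) \<odot>\<^bsub>A\<^esub> (mon w \<otimes>\<^bsub>A\<^esub> mon (fst t))) b"
      using inner[OF _ mul_M[OF w t(1)] a, of "k \<otimes>\<^bsub>R\<^esub> snd t"] k t(2) by auto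
    have "mon w \<otimes>\<^bsub>A\<^esub> lsum (ys @ [t]) = snd t \<odot>\<^bsub>A\<^esub> (mon w \<otimes>\<^bsub>A\<^esub> mon (fst t)) \<oplus>\<^bsub>A\<^esub> mon w \<otimes>\<^bsub>A\<^esub> lsum ys"
      using t(2) yc lsum_snoc[OF ys] mult_term_add[of "mon w" "snd t" "mon (fst t)" "lsum ys"] by (simp add: A.M.a_comm)
    then have "(f \<oplus>\<^bsub>A\<^esub> k \<odot>\<^bsub>A\<^esub> (mon w \<otimes>\<^bsub>A\<^esub> lsum ys)) \<oplus>\<^bsub>A\<^esub> (k \<otimes>\<^bsub>R\<^esub> snd t) \<odot>\<^bsub>A\<^esub> (mon w \<otimes>\<^bsub>A\<^esub> mon (fst t)) =
        f \<oplus>\<^bsub>A\<^esub> k \<odot>\<^bsub>A\<^esub> (mon w \<otimes>\<^bsub>A\<^esub> lsum (ys @ [t]))"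
      using k t(2) yc fc by (simp add: A.smult_assoc1 A.smult_r_distr A.M.a_ac)
    then show "\<exists>a'. exec M ?outer (Tup (et t) (Tup a (Tup (em w) (Scal k)))) a' \<and>
        rp (f \<oplus>\<^bsub>A\<^esub> k \<odot>\<^bsub>A\<^esub> (mon w \<otimes>\<^bsub>A\<^esub> lsum (ys @ [t]))) a'"
      using b by (auto simp: et_def scalars_M)
  next
    show "rp (f \<oplus>\<^bsub>A\<^esub> k \<odot>\<^bsub>A\<^esub> (mon w \<otimes>\<^bsub>A\<^esub> lsum [])) vf" using f fc k by (simp add: lsum_def)
  qed
  then obtain a where "exec M (p_fold ?outer) (Tup vg (Tup vf (Tup (em w) (Scal k)))) a"
      "rp (f \<oplus>\<^bsub>A\<^esub> k \<odot>\<^bsub>A\<^esub> (mon w \<otimes>\<^bsub>A\<^esub> g)) a"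
    using ts(2) tsp(4) by auto
  then show ?thesis by (auto simp: p_addmul_def)
qed

lemma exec_mul:
  assumes "w \<in> Std" "rp g vg"
  shows "\<exists>v. exec M p_mul (Tup (em w) vg) v \<and> rp (mon w \<otimes>\<^bsub>A\<^esub> g) v"
proof -
  have "\<one>\<^bsub>R\<^esub> \<in> carrier R" "g \<in> carrier A" using assms(2) by (auto simp: rp_iff)
  then show ?thesis
    using exec_addmul[OF assms(1) _ assms(2) rp_zero, of "\<one>\<^bsub>R\<^esub>"] by (auto simp: p_mul_def scalars_M)
qed

lemma exec_lead:
  assumes v: "rp f v" and f: "f \<noteq> \<zero>\<^bsub>A\<^esub>"
  shows "exec M p_lead v (Tup (em (lm f)) (Scal (lc f)))"
proof -
  obtain ts where fc: "f \<in> carrier A" and ts: "lists_terms f ts" "v = enc_list (map et ts)"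
    using v by (auto simp: rp_iff)
  note tsp = lists_terms_props[OF fc ts(1)]
  let ?step = "p_if (pr2 ;; pr1)
      (p_if (((pr2 ;; pr1 ;; pr1) \<triangle> (pr1 ;; pr1)) ;; Prim LeStd) pr1 (pr2 ;; pr1)) pr1"
  let ?J = "\<lambda>us a. us = [] \<and> a = Num 0 \<or> (\<exists>t\<in>set us. a = et t \<and> (\<forall>s\<in>set us. fst s \<preceq> fst t))"
  have "\<exists>a. exec M (p_fold ?step) (Tup (enc_list (map et ts)) (Tup (Num 0) (Num 0))) a \<and> ?J ts a"
  proof (rule exec_fold[where J = ?J])
    fix ys t zs a
    assume split: "ts = ys @ t # zs" and a: "?J ys a"
    have t: "fst t \<in> Std" using tsp(2) split by auto
    consider "ys = []" "a = Num 0" | s where "s \<in> set ys" "a = et s" "\<forall>u\<in>set ys. fst u \<preceq> fst s" "fst s \<in> Std"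
      using a tsp(2) split by auto
    then show "\<exists>a'. exec M ?step (Tup (et t) (Tup a (Num 0))) a' \<and> ?J (ys @ [t]) a'"
    proof cases
      case 1
      then show ?thesis using le_refl[OF t] by simp
    next
      case 2
      show ?thesis
      proof (cases "fst s \<preceq> fst t")
        case True
        then have "\<forall>u\<in>set (ys @ [t]). fst u \<preceq> fst t" using 2(3) le_trans le_refl[OF t] by auto
        then show ?thesis using 2 t True by (intro exI[of _ "et t"]) (auto simp: et_def le_M)
      next
        case False
        then have "fst t \<preceq> fst s" using le_total[OF 2(4) t] lt_le by blast
        then have "\<forall>u\<in>set (ys @ [t]). fst u \<preceq> fst s" using 2(3) by auto
        then show ?thesis using 2 t False by (intro exI[of _ "et s"]) (auto simp: et_def le_M)
      qed
    qed
  qed simp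
  moreover have "ts \<noteq> []" using rp_eq_zero[OF v] f ts(2) by auto
  ultimately obtain t where t: "exec M (p_fold ?step) (Tup v (Tup (Num 0) (Num 0))) (et t)"
      "t \<in> set ts" "\<forall>s\<in>set ts. fst s \<preceq> fst t"
    using ts(2) by auto
  have "lm f = fst t"
    using t(2,3) unfolding tsp(3)[symmetric] by (intro lm_eqI fc) (auto simp: tsp(3)[symmetric])
  moreover have "snd t = coord f (fst t)" using t(2) ts(1) by (auto simp: lists_terms_def)
  ultimately show ?thesis using t(1) by (simp add: p_lead_def et_def lc_def)
qed

end

text \<open>The programs below work in the environment \<open>(N, W, n, T)\<close> with \<open>n\<close> the number of variables,
  preceded by the variables of the enclosing searches: \<open>p_good\<close> receives \<open>w\<^sub>0, w, g\<close> and the list of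
  the monomials with exponents up to \<open>N\<close> before it, and \<open>p_pad\<close> moreover the product \<open>w\<^sub>0 g\<close>.\<close>

definition p_pass :: prog
  where "p_pass = ((((pr2 ;; pr2 ;; pr1) \<triangle> pr1) ;; p_box) \<triangle> Skip) ;;
    p_first (p_if ((pr1 \<triangle> (pr2 ;; pr2 ;; pr2 ;; pr2)) ;; p_std)
      (((pr2 ;; pr2 ;; pr1) \<triangle> Skip) ;;
        p_first (((pr2 ;; pr2 ;; pr2 ;; pr1) \<triangle> (((pr2 ;; pr1) \<triangle> pr1) ;; p_mul)) ;; p_nf))
      (num 0))"

text \<open>A box is closed under divisors, so a monomial belongs to it exactly if it is contained
  in one of its members.\<close>

definition p_small :: prog
  where "p_small = (pr2 \<triangle> pr1) ;; p_first ((pr2 \<triangle> pr1) ;; p_mdvd)"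

text \<open>With \<open>u = LM(w\<^sub>0 g) + (w - w\<^sub>0)\<close>, the test is that
  \<open>u\<close> is standard and that the leading monomial of its first divisor is already
  contained in \<open>LM(w\<^sub>0 g)\<close>; by \<open>dv_eq_iff\<close> this amounts to equality
  of first divisors.\<close>

definition p_pad :: prog
  where "p_pad = ((((pr1 ;; p_lm) \<triangle> (((pr2 ;; pr1) \<triangle> (pr2 ;; pr2 ;; pr1)) ;; p_mdiff)) ;; p_madd) \<triangle>
      (pr1 ;; p_lm) \<triangle> pr2) ;;
    p_if ((pr1 \<triangle> (pr2 ;; pr2 ;; pr2 ;; pr2 ;; pr2 ;; pr2 ;; pr2 ;; pr2 ;; pr2)) ;; p_std)
      ((((pr1 \<triangle> (pr2 ;; pr2 ;; pr2 ;; pr2 ;; pr2 ;; pr2 ;; pr2 ;; pr1)) ;; p_divisor ;; p_lm) \<triangle> (pr2 ;; pr1)) ;; p_mdvd)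
      (num 0)"

definition p_good :: prog
  where "p_good = p_if ((pr1 \<triangle> (pr2 ;; pr2 ;; pr2 ;; pr2 ;; pr2 ;; pr2 ;; pr2)) ;; p_std)
    (p_if ((pr1 \<triangle> (pr2 ;; pr1)) ;; p_mdvd)
      ((((pr1 \<triangle> (pr2 ;; pr2 ;; pr1)) ;; p_mul) \<triangle> Skip) ;; p_if pr1 p_pad (num 1))
      (num 0))
    (num 0)"

definition p_badmon :: prog
  where "p_badmon = p_if ((pr1 \<triangle> (pr2 ;; pr2 ;; pr2 ;; pr2 ;; pr2 ;; pr2)) ;; p_std)
    (p_not (((pr2 ;; pr2 ;; pr1) \<triangle> Skip) ;; p_first p_good)) (num 0)"

definition p_badelem :: prog
  where "p_badelem = ((pr2 ;; pr2 ;; (((pr2 ;; pr2 ;; pr1) \<triangle> ((pr1 \<triangle> pr1) ;; p_plus)) ;; p_box)) \<triangle> Skip) ;;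
    p_first p_badmon"

text \<open>The value \<open>num 1\<close> signals a violation, because all three searches stand
  under one negation: for a generator of \<Sigma> outside the box, for a leading monomial outside
  it, and for a standard \<open>w\<close> in the doubled box that nothing pads.\<close>

definition p_ok :: prog
  where "p_ok = ((((pr2 ;; pr2 ;; pr1) \<triangle> pr1) ;; p_box) \<triangle> Skip) ;;
    p_not (p_if (((pr2 ;; pr2 ;; pr2 ;; pr2) \<triangle> pr1) ;; p_first (p_not p_small)) (num 1)
      (p_if (((pr2 ;; pr2 ;; pr1) \<triangle> pr1) ;; p_first (p_if pr1 (((pr1 ;; p_lm) \<triangle> pr2) ;; p_not p_small) (num 0))) (num 1)
        (((pr2 ;; pr2 ;; pr1) \<triangle> Skip) ;; p_first p_badelem)))"

text \<open>A new remainder is put in front of \<open>W\<close> and the same \<open>N\<close> is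
  tried again, because first divisors may have changed; \<open>N\<close> grows only when the box is
  reduced but not certified.\<close>

definition p_step :: prog
  where "p_step = pr2 ;; (p_pass \<triangle> Skip) ;;
    p_if pr1 (num 1 \<triangle> (pr2 ;; pr1) \<triangle> (pr1 \<triangle> (pr2 ;; pr2 ;; pr1)) \<triangle> (pr2 ;; pr2 ;; pr2))
      (p_if (pr2 ;; p_ok) (num 0 \<triangle> pr2) (num 1 \<triangle> (pr2 ;; pr1 ;; Prim Succ) \<triangle> (pr2 ;; pr2)))"

definition p_main :: prog
  where "p_main = (num 1 \<triangle> num 0 \<triangle> (pr2 ;; pr2 ;; pr2) \<triangle> pr1 \<triangle> (pr2 ;; pr1)) ;; While p_step ;;
    pr2 ;; pr2 ;; pr1"

lemma find_split: "(\<forall>y\<in>set ys. \<not> P y) \<Longrightarrow> P x \<Longrightarrow> find P (ys @ x # zs) = Some x"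
  by (induction ys) auto

section \<open>Correctness of the searches\<close>

context leading_term_machine
begin

lemma Mon_hs: "u \<in> Mon \<Longrightarrow> set_mset u \<subseteq> set hs"
  using hs by (simp add: Mon_iff)

lemma Ts_eq: "{t + u | t u. t \<in> set Ts \<and> u \<in> Mon} = \<Sigma>"
  using Ts by (simp add: generates_\<Sigma>_def)

lemma Ts_Mon: "t \<in> set Ts \<Longrightarrow> t \<in> Mon"
proof -
  assume "t \<in> set Ts"
  moreover have "{#} \<in> Mon" by (simp add: Mon_iff)
  ultimately have "t + {#} \<in> {t + u | t u. t \<in> set Ts \<and> u \<in> Mon}" by blast
  then show ?thesis unfolding Ts_eq using \<Sigma>_monomials by auto
qed

lemma Std_iff: "u \<in> Std \<longleftrightarrow> u \<in> Mon \<and> \<not> (\<exists>t\<in>set Ts. t \<subseteq># u)"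
proof -
  have "u \<in> \<Sigma> \<longleftrightarrow> (\<exists>t\<in>set Ts. t \<subseteq># u)" if u: "u \<in> Mon"
  proof
    assume "u \<in> \<Sigma>"
    then obtain t v where "t \<in> set Ts" "u = t + v" unfolding Ts_eq[symmetric] by blast
    then show "\<exists>t\<in>set Ts. t \<subseteq># u" by (metis mset_subset_eq_add_left)
  next
    assume "\<exists>t\<in>set Ts. t \<subseteq># u"
    then obtain t where t: "t \<in> set Ts" "u = t + (u - t)" by auto
    moreover have "u - t \<in> Mon" using Mon_subset[OF diff_subset_eq_self u] .
    ultimately show "u \<in> \<Sigma>" unfolding Ts_eq[symmetric] by blast
  qed
  then show ?thesis by (auto simp: Std_def)
qed

abbreviation "vT \<equiv> enc_list (map em Ts)"

lemma exec_std:
  assumes "u \<in> Mon"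
  shows "exec M p_std (Tup (em u) vT) (truth (u \<in> Std))"
proof -
  have "\<exists>v. exec M (p_first p_mdvd) (Tup vT (em u)) v \<and> (v \<noteq> Num 0 \<longleftrightarrow> (\<exists>t\<in>set Ts. t \<subseteq># u))"
    by (rule exec_first_ex) (auto intro!: exI exec_mdvd Mon_hs Ts_Mon)
  then obtain v where v: "exec M (p_first p_mdvd) (Tup vT (em u)) v" "v \<noteq> Num 0 \<longleftrightarrow> (\<exists>t\<in>set Ts. t \<subseteq># u)"
    by blast
  have "exec M ((pr2 \<triangle> pr1) ;; p_first p_mdvd) (Tup (em u) vT) v" using v(1) by simp
  moreover have "v = Num 0 \<longleftrightarrow> u \<in> Std" using v(2) assms Std_iff by auto
  ultimately show ?thesis using exec_not by (metis p_std_def)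
qed

lemma mdvd_M: "u \<in> Mon \<Longrightarrow> exec M p_mdvd (Tup (em u) (em v)) w \<longleftrightarrow> w = truth (u \<subseteq># v)"
  by (rule exec_iff[OF exec_mdvd[OF Mon_hs]])

lemma mdiff_M: "exec M p_mdiff (Tup (em u) (em v)) w \<longleftrightarrow> w = em (v - u)"
  by (rule exec_iff[OF exec_mdiff])

lemma madd_M: "exec M p_madd (Tup (em u) (em v)) w \<longleftrightarrow> w = em (u + v)"
  by (rule exec_iff[OF exec_madd])

lemma std_M: "u \<in> Mon \<Longrightarrow> exec M p_std (Tup (em u) vT) w \<longleftrightarrow> w = truth (u \<in> Std)"
  by (rule exec_iff[OF exec_std])

lemma lead_M:
  "rp f v \<Longrightarrow> f \<noteq> \<zero>\<^bsub>A\<^esub> \<Longrightarrow> exec M p_lead v w \<longleftrightarrow> w = Tup (em (lm f)) (Scal (lc f))"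
  by (rule exec_iff[OF exec_lead])

text \<open>Exponent vectors correspond to monomials because \<open>hs\<close> enumerates
  \<open>H\<close> without repetition; \<open>mk\<close> inverts the encoding.\<close>

lemma exec_box_mon:
  "\<exists>ws. exec M p_box (Tup (Num (length hs)) (Num N)) (enc_list (map em ws)) \<and> set ws = box N"
proof -
  obtain xss where xss: "exec M p_box (Tup (Num (length hs)) (Num N)) (enc_list (map (\<lambda>xs. enc_list (map Num xs)) xss))"
      "set xss = {xs. length xs = length hs \<and> (\<forall>x\<in>set xs. x \<le> N)}"
    using exec_box by blast
  define mk where "mk xs = (\<Sum>i<length hs. replicate_mset (xs ! i) (hs ! i))" for xs
  have count: "count (mk xs) (hs ! j) = xs ! j" if "j < length hs" for xs j
  proof -
    have "count (mk xs) (hs ! j) = (\<Sum>i<length hs. if i = j then xs ! i else 0)"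
      unfolding mk_def count_sum using that hs(1) by (intro sum.cong) (auto simp: nth_eq_iff_index_eq)
    then show ?thesis using that by simp
  qed
  have count0: "count (mk xs) h = 0" if "h \<notin> set hs" for xs h
    unfolding mk_def count_sum using that by (intro sum.neutral) auto
  have enc: "em (mk xs) = enc_list (map Num xs)" if "length xs = length hs" for xs
  proof -
    have "map (\<lambda>h. Num (count (mk xs) h)) hs = (map Num xs :: 'r val list)"
      using that count by (intro nth_equalityI) auto
    then show ?thesis by (simp add: enc_mon_def)
  qed
  have "map (\<lambda>xs. enc_list (map Num xs)) xss = map em (map mk xss)"
    using enc xss(2) by simp
  moreover have "set (map mk xss) = box N"
  proof
    show "set (map mk xss) \<subseteq> box N"
    proof
      fix w assume "w \<in> set (map mk xss)"
      then obtain xs where xs: "w = mk xs" "length xs = length hs" "\<forall>x\<in>set xs. x \<le> N"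
        using xss(2) by auto
      have "count w h \<le> N" for h
      proof (cases "h \<in> set hs")
        case True
        then obtain j where "j < length hs" "h = hs ! j" by (auto simp: in_set_conv_nth)
        then show ?thesis using count xs by simp
      qed (simp add: count0 xs(1))
      moreover have "set_mset w \<subseteq> set hs" using count0[of _ xs] xs(1) by (metis count_eq_zero_iff subsetI)
      ultimately show "w \<in> box N" using hs by (simp add: box_def Mon_iff)
    qed
    show "box N \<subseteq> set (map mk xss)"
    proof
      fix w assume w: "w \<in> box N"
      define xs where "xs = map (count w) hs"
      have "xs \<in> set xss" using w unfolding xss(2) by (auto simp: xs_def box_def)
      moreover have "mk xs = w"
      proof (rule multiset_eqI)
        fix h
        show "count (mk xs) h = count w h"
        proof (cases "h \<in> set hs")
          case True
          then obtain j where "j < length hs" "h = hs ! j" by (auto simp: in_set_conv_nth)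
          then show ?thesis using count by (simp add: xs_def)
        next
          case False
          then have "h \<notin># w" using w Mon_hs by (auto simp: box_def)
          then show ?thesis using count0[OF False] by (simp add: not_in_iff)
        qed
      qed
      ultimately show "w \<in> set (map mk xss)" by force
    qed
  qed
  ultimately show ?thesis using xss(1) by metis
qed

definition env :: "'r val list \<Rightarrow> nat \<Rightarrow> 'r val"
  where "env vs N = Tup (Num N) (Tup (enc_list vs) (Tup (Num (length hs)) vT))"

definition reduced :: "'a list \<Rightarrow> nat \<Rightarrow> bool"
  where "reduced W N \<longleftrightarrow> (\<forall>g\<in>set W. \<forall>w\<in>Std \<inter> box N. reduces W (mon w \<otimes>\<^bsub>A\<^esub> g))"

text \<open>The finite data from which \<open>pads_box\<close> extends padding from the doubled box
  to all standard monomials.\<close>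

definition certified :: "'a list \<Rightarrow> nat \<Rightarrow> bool"
  where "certified W N \<longleftrightarrow> set Ts \<subseteq> box N \<and> (\<forall>g\<in>set W. g \<noteq> \<zero>\<^bsub>A\<^esub> \<longrightarrow> lm g \<in> box N) \<and>
    (\<forall>g\<in>set W. \<forall>w\<in>Std \<inter> box (N + N). \<exists>w\<^sub>0\<in>Std \<inter> box N. pads W g w\<^sub>0 w)"

context
  fixes W :: "'a list" and vs :: "'r val list"
  assumes Wvs: "list_all2 rp W vs"
begin

lemma W_carrier: "set W \<subseteq> carrier A"
  using Wvs by (auto simp: list_all2_conv_all_nth rp_def in_set_conv_nth)

text \<open>An element can have several representations, as its terms come in any order; so loops
  over \<open>W\<close> are analysed on pairs of an element and its representation.\<close>

lemma vs_zip: "enc_list vs = enc_list (map snd (zip W vs))"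
  using list_all2_lengthD[OF Wvs] by simp

lemma in_zip: "p \<in> set (zip W vs) \<Longrightarrow> rp (fst p) (snd p) \<and> fst p \<in> set W"
  using Wvs by (cases p) (auto simp: list_all2_iff dest: set_zip_leftD)

lemma fst_zip: "fst ` set (zip W vs) = set W"
  using list_all2_lengthD[OF Wvs] by (metis list.set_map map_fst_zip)

lemma exec_divisor:
  "\<exists>v. exec M p_divisor (Tup (em u) (enc_list vs)) v \<and>
    (case dv W u of None \<Rightarrow> v = Num 0 | Some g \<Rightarrow> rp g v)"
proof -
  let ?q = "p_if pr1 (p_if (((pr1 ;; p_lm) \<triangle> pr2) ;; p_mdvd) pr1 (num 0)) (num 0)"
  let ?D = "\<lambda>g. g \<noteq> \<zero>\<^bsub>A\<^esub> \<and> lm g \<subseteq># u"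
  let ?P = "\<lambda>p v. v = (if ?D (fst p) then snd p else Num 0)"
  have "\<exists>v. exec M ?q (Tup (snd p) (em u)) v \<and> ?P p v" if p: "p \<in> set (zip W vs)" for p
  proof (cases "fst p = \<zero>\<^bsub>A\<^esub>")
    case True
    then have "snd p = Num 0" using in_zip[OF p] rp_eq_zero[of "fst p" "snd p"] by simp
    then show ?thesis by simp
  next
    case False
    have g: "rp (fst p) (snd p)" "fst p \<in> carrier A" using in_zip[OF p] W_carrier by auto
    have "lm (fst p) \<in> Mon" using lm_Std[OF g(2) False] Std_Mon by blast
    then show ?thesis using False rp_eq_zero[OF g(1)] lead_M[OF g(1) False] by (simp add: mdvd_M)
  qed
  then obtain v where v: "exec M (p_first ?q) (Tup (enc_list (map snd (zip W vs))) (em u)) v"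
    "v = Num 0 \<and> (\<forall>p\<in>set (zip W vs). ?P p (Num 0)) \<or>
     v \<noteq> Num 0 \<and> (\<exists>ys p zs. zip W vs = ys @ p # zs \<and> ?P p v \<and> (\<forall>y\<in>set ys. ?P y (Num 0)))"
    using exec_first_split[of "zip W vs" M ?q snd "em u" ?P] by blast
  \<comment> \<open>A divisor is nonzero, so its representation is not \<open>Num 0\<close>; the
    value \<open>Num 0\<close> thus means that the element is no divisor.\<close>
  have nD: "\<not> ?D (fst p)" if "p \<in> set (zip W vs)" "?P p (Num 0)" for p
    using that in_zip[OF that(1)] rp_eq_zero by (auto split: if_splits)
  from v(2) have "case dv W u of None \<Rightarrow> v = Num 0 | Some g \<Rightarrow> rp g v"
  proof
    assume v0: "v = Num 0 \<and> (\<forall>p\<in>set (zip W vs). ?P p (Num 0))"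
    then have "\<forall>g\<in>fst ` set (zip W vs). \<not> ?D g" using nD by blast
    then have "dv W u = None" unfolding fst_zip dv_None_iff by blast
    then show ?thesis using v0 by simp
  next
    assume "v \<noteq> Num 0 \<and> (\<exists>ys p zs. zip W vs = ys @ p # zs \<and> ?P p v \<and> (\<forall>y\<in>set ys. ?P y (Num 0)))"
    then obtain ys p zs where z: "v \<noteq> Num 0" "zip W vs = ys @ p # zs" "?P p v" "\<forall>y\<in>set ys. ?P y (Num 0)"
      by blast
    have D: "?D (fst p)" "v = snd p" using z(1,3) by (auto split: if_splits)
    have "\<not> ?D (fst y)" if "y \<in> set ys" for y using nD[of y] z(2,4) that by auto
    then have "\<forall>g\<in>set (map fst ys). \<not> ?D g" by (simp only: list.set_map ball_simps) blast
    then have "find ?D (map fst ys @ fst p # map fst zs) = Some (fst p)" using D(1) by (rule find_split)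
    moreover have "W = map fst (zip W vs)" using list_all2_lengthD[OF Wvs] by simp
    then have "W = map fst ys @ fst p # map fst zs" unfolding z(2) by simp
    ultimately have "dv W u = Some (fst p)" by (simp only: dv_def)
    then show ?thesis using D(2) in_zip[of p] z(2) by simp
  qed
  then show ?thesis using v(1) by (auto simp: p_divisor_def vs_zip)
qed

lemma exec_test:
  assumes f: "rp f vf"
  shows "\<exists>b. exec M p_test (Tup (enc_list vs) vf) b \<and>
    ((f = \<zero>\<^bsub>A\<^esub> \<or> dv W (lm f) = None) \<and> b = Num 0 \<or>
     f \<noteq> \<zero>\<^bsub>A\<^esub> \<and> b \<noteq> Num 0 \<and> (\<exists>g. dv W (lm f) = Some g \<and> rp g b))"
proof (cases "f = \<zero>\<^bsub>A\<^esub>")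
  case True
  then show ?thesis using rp_eq_zero[OF f] by (auto simp: p_test_def)
next
  case False
  note lead = lead_M[OF f False]
  obtain v where v: "exec M p_divisor (Tup (em (lm f)) (enc_list vs)) v"
      "case dv W (lm f) of None \<Rightarrow> v = Num 0 | Some g \<Rightarrow> rp g v"
    using exec_divisor by blast
  have "exec M p_test (Tup (enc_list vs) vf) v"
    using v(1) False rp_eq_zero[OF f] by (simp add: p_test_def lead)
  moreover have "v \<noteq> Num 0" if "dv W (lm f) = Some g" for g
    using v(2) that dvD[OF that] rp_eq_zero[of g v] by simp
  ultimately show ?thesis using v(2) False by (intro exI[of _ v]) (auto split: option.splits)
qed

lemma exec_cancel:
  assumes f: "rp f vf" "f \<noteq> \<zero>\<^bsub>A\<^esub>" and g: "dv W (lm f) = Some g" "rp g vg"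
  shows "\<exists>v. exec M p_cancel (Tup vg (Tup (enc_list vs) vf)) v \<and>
    rp (f \<oplus>\<^bsub>A\<^esub> (\<ominus>\<^bsub>R\<^esub> (lc f \<otimes>\<^bsub>R\<^esub> inv\<^bsub>R\<^esub> lc g)) \<odot>\<^bsub>A\<^esub> (mon (lm f - lm g) \<otimes>\<^bsub>A\<^esub> g)) v"
proof -
  have fc: "f \<in> carrier A" and gc: "g \<in> carrier A" and g0: "g \<noteq> \<zero>\<^bsub>A\<^esub>"
    using f g dvD[OF g(1)] by (auto simp: rp_def)
  note cf = lc_props[OF fc f(2)] and cg = lc_props[OF gc g0]
  have inv: "inv\<^bsub>R\<^esub> lc g \<in> carrier R" using cg field_Units by auto
  let ?k = "\<ominus>\<^bsub>R\<^esub> (lc f \<otimes>\<^bsub>R\<^esub> inv\<^bsub>R\<^esub> lc g)"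
  have S: "lm f - lm g \<in> Std" using Std_subset[OF diff_subset_eq_self lm_Std[OF fc f(2)]] .
  have k: "?k \<in> carrier R" using cf inv by simp
  obtain v where v: "exec M p_addmul (Tup (em (lm f - lm g)) (Tup (Scal ?k) (Tup vg vf))) v"
      "rp (f \<oplus>\<^bsub>A\<^esub> ?k \<odot>\<^bsub>A\<^esub> (mon (lm f - lm g) \<otimes>\<^bsub>A\<^esub> g)) v"
    using exec_addmul[OF S k g(2) f(1)] by blast
  then show ?thesis
    by (intro exI[of _ v]) (simp add: p_cancel_def lead_M[OF f] lead_M[OF g(2) g0] mdiff_M scalars_M cg)
qed

text \<open>Termination is induction on the leading monomial, which each cancellation lowers. Ideals
  are quantified over, so that the remainder can be placed in the ideal generated by the input
  without mentioning it here.\<close>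

lemma exec_nf:
  assumes f: "rp f vf"
  shows "\<exists>h v. exec M p_nf (Tup (enc_list vs) vf) v \<and> rp h v \<and> (h = \<zero>\<^bsub>A\<^esub> \<longrightarrow> reduces W f) \<and>
    (h \<noteq> \<zero>\<^bsub>A\<^esub> \<longrightarrow> dv W (lm h) = None) \<and> (\<forall>I. ideal I A \<longrightarrow> set W \<subseteq> I \<longrightarrow> f \<in> I \<longrightarrow> h \<in> I)"
proof -
  let ?body = "((pr2 ;; pr1) \<triangle> p_cancel) ;; (p_test \<triangle> Skip)"
  let ?w = "enc_list vs"
  let ?Q = "\<lambda>f h. (h = \<zero>\<^bsub>A\<^esub> \<longrightarrow> reduces W f) \<and> (h \<noteq> \<zero>\<^bsub>A\<^esub> \<longrightarrow> dv W (lm h) = None) \<and>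
      (\<forall>I. ideal I A \<longrightarrow> set W \<subseteq> I \<longrightarrow> f \<in> I \<longrightarrow> h \<in> I)"
  \<comment> \<open>Zero has no leading monomial, so it is handled outside the induction, together
    with elements whose leading monomial has no divisor.\<close>
  have stop: "\<exists>h v. exec M (While ?body) (Tup b (Tup ?w vf)) (Tup (Num 0) (Tup ?w v)) \<and> rp h v \<and> ?Q f h"
    if "rp f vf" "exec M p_test (Tup ?w vf) b" "f = \<zero>\<^bsub>A\<^esub> \<or> dv W (lm f) = None" for f vf b
  proof -
    have "b = Num 0" using exec_test[OF that(1)] that(2,3) exec_iff[OF that(2)] by auto
    then have "exec M (While ?body) (Tup b (Tup ?w vf)) (Tup (Num 0) (Tup ?w vf))" by (simp add: exec_While_simps)
    moreover have "?Q f f" using that(3) reduces.zero by blast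
    ultimately show ?thesis using that(1) by blast
  qed
  have loop: "\<exists>h v. exec M (While ?body) (Tup b (Tup ?w vf)) (Tup (Num 0) (Tup ?w v)) \<and> rp h v \<and> ?Q f h"
    if "rp f vf" "exec M p_test (Tup ?w vf) b" "f \<noteq> \<zero>\<^bsub>A\<^esub>" "lm f = l" for f vf b l
    using that
  proof (induction l arbitrary: f vf b rule: wfp_induct_rule[OF wf_lt])
    case (1 l)
    show ?case
    proof (cases "dv W (lm f) = None")
      case True
      then show ?thesis using stop 1 by blast
    next
      case False
      obtain g where g: "dv W (lm f) = Some g" "rp g b" "b \<noteq> Num 0"
        using exec_test[OF "1.prems"(1)] exec_iff[OF "1.prems"(2)] False "1.prems"(3) by auto
      have fc: "f \<in> carrier A" using "1.prems"(1) by (simp add: rp_def)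
      define f' where "f' = f \<oplus>\<^bsub>A\<^esub> (\<ominus>\<^bsub>R\<^esub> (lc f \<otimes>\<^bsub>R\<^esub> inv\<^bsub>R\<^esub> lc g)) \<odot>\<^bsub>A\<^esub> (mon (lm f - lm g) \<otimes>\<^bsub>A\<^esub> g)"
      note f' = lm_term_add_less[OF W_carrier fc "1.prems"(3) g(1), folded f'_def]
      obtain vf' where vf': "exec M p_cancel (Tup b (Tup ?w vf)) vf'" "rp f' vf'"
        using exec_cancel[OF "1.prems"(1,3) g(1,2)] unfolding f'_def by blast
      obtain b' where b': "exec M p_test (Tup ?w vf') b'" using exec_test[OF vf'(2)] by blast
      have "\<exists>h v. exec M (While ?body) (Tup b' (Tup ?w vf')) (Tup (Num 0) (Tup ?w v)) \<and> rp h v \<and> ?Q f' h"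
      proof (cases "f' = \<zero>\<^bsub>A\<^esub>")
        case True
        then show ?thesis using stop[OF vf'(2) b'] by blast
      next
        case False
        then have "lm f' \<prec> l" using f'(2)[OF lm_supp[OF f'(1)]] "1.prems"(4) by simp
        then show ?thesis using "1.IH"[OF _ vf'(2) b' False] by blast
      qed
      then obtain h v where h: "exec M (While ?body) (Tup b' (Tup ?w vf')) (Tup (Num 0) (Tup ?w v))" "rp h v" "?Q f' h"
        by blast
      have "exec M ?body (Tup b (Tup ?w vf)) (Tup b' (Tup ?w vf'))" using vf'(1) b' by simp
      then have "exec M (While ?body) (Tup b (Tup ?w vf)) (Tup (Num 0) (Tup ?w v))"
        using h(1) g(3) exec_While_simps(2) by blast
      moreover have "?Q f h" using h(3) f'(3,4) by blast
      ultimately show ?thesis using h(2) by blast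
    qed
  qed
  obtain b where b: "exec M p_test (Tup ?w vf) b" using exec_test[OF f] by blast
  obtain h v where "exec M (While ?body) (Tup b (Tup ?w vf)) (Tup (Num 0) (Tup ?w v))" "rp h v" "?Q f h"
    using stop[OF f b] loop[OF f b] by blast
  moreover have "exec M p_nf (Tup ?w vf) v" by (simp add: p_nf_def exec_iff[OF b] exec_iff[OF calculation(1)])
  ultimately show ?thesis by blast
qed

lemma exec_first_W:
  assumes "\<And>g vg. g \<in> set W \<Longrightarrow> rp g vg \<Longrightarrow> \<exists>v. exec M q (Tup vg e) v \<and> P g v"
  shows "\<exists>v. exec M (p_first q) (Tup (enc_list vs) e) v \<and>
    (v = Num 0 \<and> (\<forall>g\<in>set W. P g (Num 0)) \<or> v \<noteq> Num 0 \<and> (\<exists>g\<in>set W. P g v))"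
proof -
  have "\<exists>v. exec M (p_first q) (Tup (enc_list (map snd (zip W vs))) e) v \<and>
    (v = Num 0 \<and> (\<forall>p\<in>set (zip W vs). P (fst p) (Num 0)) \<or> v \<noteq> Num 0 \<and> (\<exists>p\<in>set (zip W vs). P (fst p) v))"
    by (rule exec_first) (use assms in_zip in blast)
  then show ?thesis unfolding vs_zip[symmetric] fst_zip[symmetric] by blast
qed

lemma exec_pass:
  "\<exists>v. exec M p_pass (env vs N) v \<and>
    (v = Num 0 \<and> reduced W N \<or>
     v \<noteq> Num 0 \<and> (\<exists>h. rp h v \<and> h \<noteq> \<zero>\<^bsub>A\<^esub> \<and> dv W (lm h) = None \<and>
      (\<forall>I. ideal I A \<longrightarrow> set W \<subseteq> I \<longrightarrow> h \<in> I)))"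
proof -
  obtain ws where ws: "exec M p_box (Tup (Num (length hs)) (Num N)) (enc_list (map em ws))" "set ws = box N"
    using exec_box_mon by blast
  let ?q2 = "((pr2 ;; pr2 ;; pr2 ;; pr1) \<triangle> (((pr2 ;; pr1) \<triangle> pr1) ;; p_mul)) ;; p_nf"
  let ?q1 = "p_if ((pr1 \<triangle> (pr2 ;; pr2 ;; pr2 ;; pr2)) ;; p_std) (((pr2 ;; pr2 ;; pr1) \<triangle> Skip) ;; p_first ?q2) (num 0)"
  let ?H = "\<lambda>v. \<exists>h. rp h v \<and> h \<noteq> \<zero>\<^bsub>A\<^esub> \<and> dv W (lm h) = None \<and> (\<forall>I. ideal I A \<longrightarrow> set W \<subseteq> I \<longrightarrow> h \<in> I)"
  let ?P2 = "\<lambda>w g v. v = Num 0 \<and> reduces W (mon w \<otimes>\<^bsub>A\<^esub> g) \<or>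
    v \<noteq> Num 0 \<and> ?H v"
  have q2: "\<exists>v. exec M ?q2 (Tup vg (Tup (em w) (env vs N))) v \<and> ?P2 w g v"
    if w: "w \<in> Std" and g: "g \<in> set W" "rp g vg" for w g vg
  proof -
    obtain x where x: "exec M p_mul (Tup (em w) vg) x" "rp (mon w \<otimes>\<^bsub>A\<^esub> g) x" using exec_mul[OF w g(2)] by blast
    obtain h v where h: "exec M p_nf (Tup (enc_list vs) x) v" "rp h v"
        "h = \<zero>\<^bsub>A\<^esub> \<longrightarrow> reduces W (mon w \<otimes>\<^bsub>A\<^esub> g)" "h \<noteq> \<zero>\<^bsub>A\<^esub> \<longrightarrow> dv W (lm h) = None"
        "\<forall>I. ideal I A \<longrightarrow> set W \<subseteq> I \<longrightarrow> mon w \<otimes>\<^bsub>A\<^esub> g \<in> I \<longrightarrow> h \<in> I"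
      using exec_nf[OF x(2)] by blast
    have "exec M ?q2 (Tup vg (Tup (em w) (env vs N))) v"
      using x(1) h(1) by (auto simp: env_def)
    moreover have "\<forall>I. ideal I A \<longrightarrow> set W \<subseteq> I \<longrightarrow> h \<in> I"
      using h(5) ideal.I_l_closed[OF _ subsetD[OF _ g(1)] mon_closed] by simp
    ultimately show ?thesis using h rp_eq_zero[OF h(2)] by blast
  qed
  let ?P1 = "\<lambda>w v. v = Num 0 \<and> (w \<in> Std \<longrightarrow> (\<forall>g\<in>set W. reduces W (mon w \<otimes>\<^bsub>A\<^esub> g))) \<or>
    v \<noteq> Num 0 \<and> ?H v"
  have q1: "\<exists>v. exec M ?q1 (Tup (em w) (env vs N)) v \<and> ?P1 w v" if "w \<in> set ws" for w
  proof -
    have "w \<in> Mon" using that ws(2) by (simp add: box_def)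
    note std = std_M[OF this]
    show ?thesis
    proof (cases "w \<in> Std")
      case True
      obtain v where v: "exec M (p_first ?q2) (Tup (enc_list vs) (Tup (em w) (env vs N))) v"
          "v = Num 0 \<and> (\<forall>g\<in>set W. ?P2 w g (Num 0)) \<or> v \<noteq> Num 0 \<and> (\<exists>g\<in>set W. ?P2 w g v)"
        using exec_first_W[of ?q2 "Tup (em w) (env vs N)" "?P2 w"] q2[OF True] by blast
      have "exec M ?q1 (Tup (em w) (env vs N)) v" using v(1) True std by (simp add: env_def)
      then show ?thesis using v(2) True by blast
    next
      case False
      then have "exec M ?q1 (Tup (em w) (env vs N)) (Num 0)" using std by (simp add: env_def)
      then show ?thesis using False by blast
    qed
  qed
  obtain v where v: "exec M (p_first ?q1) (Tup (enc_list (map em ws)) (env vs N)) v"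
      "v = Num 0 \<and> (\<forall>w\<in>set ws. ?P1 w (Num 0)) \<or> v \<noteq> Num 0 \<and> (\<exists>w\<in>set ws. ?P1 w v)"
    using exec_first[of ws M ?q1 em "env vs N" ?P1] q1 by blast
  have "exec M p_pass (env vs N) v"
    using v(1) ws(1) by (auto simp: p_pass_def env_def)
  moreover have "v = Num 0 \<and> reduced W N \<or> v \<noteq> Num 0 \<and> ?H v"
    using v(2) unfolding ws(2) reduced_def by blast
  ultimately show ?thesis by blast
qed

lemma exec_small:
  assumes "m \<in> Mon" "set ws = box N"
  shows "\<exists>v. exec M p_small (Tup (em m) (enc_list (map em ws))) v \<and> (v \<noteq> Num 0 \<longleftrightarrow> m \<in> box N)"
proof -
  have "\<exists>v. exec M (p_first ((pr2 \<triangle> pr1) ;; p_mdvd)) (Tup (enc_list (map em ws)) (em m)) v \<and>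
      (v \<noteq> Num 0 \<longleftrightarrow> (\<exists>w\<in>set ws. m \<subseteq># w))"
    by (rule exec_first_ex) (simp add: mdvd_M[OF assms(1)])
  moreover have "(\<exists>w\<in>box N. m \<subseteq># w) \<longleftrightarrow> m \<in> box N"
    using assms(1) by (auto simp: box_def subseteq_mset_def intro: order_trans)
  ultimately show ?thesis by (simp add: p_small_def assms(2))
qed

text \<open>That \<open>x\<close> reduces to 0 provides a divisor of \<open>lm x\<close>, hence of
  the padded monomial. Without one the program could try to read a leading monomial off
  \<open>Num 0\<close> and get stuck; the certificate is therefore tested only after a successful
  pass.\<close>

lemma exec_pad:
  assumes x: "rp x vx" "x \<noteq> \<zero>\<^bsub>A\<^esub>" "reduces W x" and w0: "w0 \<subseteq># w" "w \<in> Mon"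
  shows "\<exists>b. exec M p_pad (Tup vx (Tup (em w0) (Tup (em w) (Tup vg (Tup b1 (env vs N)))))) b \<and>
    (b \<noteq> Num 0 \<longleftrightarrow> lm x + (w - w0) \<in> Std \<and> dv W (lm x + (w - w0)) = dv W (lm x))"
proof -
  have xc: "x \<in> carrier A" using x(1) by (simp add: rp_def)
  define u where "u = lm x + (w - w0)"
  have u: "u \<in> Mon"
    using Std_Mon[OF lm_Std[OF xc x(2)]] Mon_subset[OF diff_subset_eq_self w0(2)] by (simp add: u_def Mon_add)
  have sub: "lm x \<subseteq># u" by (simp add: u_def)
  have dvx: "dv W (lm x) \<noteq> None" using reduces_lm[OF W_carrier x(3,2)] by blast
  then obtain g1 where g1: "dv W (lm x) = Some g1" by blast
  have "lm g1 \<subseteq># u" using dvD[OF g1] sub subset_mset.order_trans by blast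
  then have "dv W u \<noteq> None" using dvD[OF g1] dv_None_iff[of W u] by blast
  then obtain g where g: "dv W u = Some g" by blast
  note gp = dvD[OF g]
  have gc: "g \<in> carrier A" using gp W_carrier by blast
  obtain v where v: "exec M p_divisor (Tup (em u) (enc_list vs)) v" "rp g v"
    using exec_divisor[of u] g by auto
  have gm: "lm g \<in> Mon" using Std_Mon lm_Std[OF gc] gp by blast
  note e = lead_M[OF x(1,2)] mdiff_M madd_M[of "lm x" "w - w0", folded u_def] std_M[OF u] exec_iff[OF v(1)]
    lead_M[OF v(2)] mdvd_M[OF gm]
  have "exec M p_pad (Tup vx (Tup (em w0) (Tup (em w) (Tup vg (Tup b1 (env vs N))))))
      (if u \<in> Std then truth (lm g \<subseteq># lm x) else Num 0)"
    using gp by (simp add: p_pad_def e env_def)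
  moreover have "dv W u = dv W (lm x) \<longleftrightarrow> lm g \<subseteq># lm x" by (rule dv_eq_iff[OF g sub dvx])
  ultimately show ?thesis unfolding u_def[symmetric]
    by (intro exI[of _ "if u \<in> Std then truth (lm g \<subseteq># lm x) else Num 0"]) simp
qed

lemma exec_good:
  assumes red: "reduced W N" and w0: "w0 \<in> box N" and w: "w \<in> Mon" and g: "g \<in> set W" "rp g vg"
  shows "\<exists>b. exec M p_good (Tup (em w0) (Tup (em w) (Tup vg (Tup b1 (env vs N))))) b \<and>
    (b \<noteq> Num 0 \<longleftrightarrow> w0 \<in> Std \<and> pads W g w0 w)"
proof -
  have w0M: "w0 \<in> Mon" using w0 by (simp add: box_def)
  let ?e = "Tup (em w0) (Tup (em w) (Tup vg (Tup b1 (env vs N))))"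
  note e = std_M[OF w0M] mdvd_M[OF w0M]
  show ?thesis
  proof (cases "w0 \<in> Std \<and> w0 \<subseteq># w")
    case True
    obtain x where x: "exec M p_mul (Tup (em w0) vg) x" "rp (mon w0 \<otimes>\<^bsub>A\<^esub> g) x"
      using exec_mul[OF _ g(2)] True by blast
    have r: "reduces W (mon w0 \<otimes>\<^bsub>A\<^esub> g)" using red True w0 g(1) by (auto simp: reduced_def)
    have good: "exec M p_good ?e b \<longleftrightarrow> exec M (p_if pr1 p_pad (num 1)) (Tup x ?e) b" for b
      using True by (simp add: p_good_def e env_def exec_iff[OF x(1)] del: exec_if(1)) (simp add: e env_def exec_iff[OF x(1)])
    show ?thesis
    proof (cases "mon w0 \<otimes>\<^bsub>A\<^esub> g = \<zero>\<^bsub>A\<^esub>")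
      case zero: True
      then have "exec M p_good ?e (Num 1)" using good rp_eq_zero[OF x(2)] by simp
      then show ?thesis using True zero by (intro exI[of _ "Num 1"]) (simp add: pads_def)
    next
      case False
      obtain b where "exec M p_pad (Tup x ?e) b"
          "b \<noteq> Num 0 \<longleftrightarrow> lm (mon w0 \<otimes>\<^bsub>A\<^esub> g) + (w - w0) \<in> Std \<and>
            dv W (lm (mon w0 \<otimes>\<^bsub>A\<^esub> g) + (w - w0)) = dv W (lm (mon w0 \<otimes>\<^bsub>A\<^esub> g))"
        using exec_pad[OF x(2) False r _ w, of w0] True by blast
      then show ?thesis using good rp_eq_zero[OF x(2)] False True
        by (intro exI[of _ b]) (simp add: pads_def)
    qed
  next
    case False
    then have "exec M p_good ?e (Num 0)" by (auto simp: p_good_def e env_def)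
    then show ?thesis using False by (intro exI[of _ "Num 0"]) (auto simp: pads_def)
  qed
qed

lemma exec_ok:
  assumes red: "reduced W N"
  shows "\<exists>b. exec M p_ok (env vs N) b \<and> (b \<noteq> Num 0 \<longleftrightarrow> certified W N)"
proof -
  obtain ws where ws: "exec M p_box (Tup (Num (length hs)) (Num N)) (enc_list (map em ws))" "set ws = box N"
    using exec_box_mon by blast
  obtain us where us: "exec M p_box (Tup (Num (length hs)) (Num (N + N))) (enc_list (map em us))" "set us = box (N + N)"
    using exec_box_mon by blast
  let ?b1 = "enc_list (map em ws)"
  let ?E = "Tup ?b1 (env vs N)"
  have small: "\<exists>v. exec M (p_not p_small) (Tup (em m) ?b1) v \<and> (v \<noteq> Num 0 \<longleftrightarrow> m \<notin> box N)" if m: "m \<in> Mon" for m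
  proof -
    obtain v where v: "exec M p_small (Tup (em m) ?b1) v" "v \<noteq> Num 0 \<longleftrightarrow> m \<in> box N"
      using exec_small[OF m ws(2)] by blast
    show ?thesis using v(2) by (intro exI[of _ "truth (v = Num 0)"] conjI exec_not[OF v(1)]) auto
  qed
  have "\<exists>v. exec M (p_first (p_not p_small)) (Tup vT ?b1) v \<and> (v \<noteq> Num 0 \<longleftrightarrow> (\<exists>t\<in>set Ts. t \<notin> box N))"
    by (rule exec_first_ex) (use small Ts_Mon in blast)
  then obtain v1 where v1: "exec M (p_first (p_not p_small)) (Tup vT ?b1) v1" "v1 \<noteq> Num 0 \<longleftrightarrow> (\<exists>t\<in>set Ts. t \<notin> box N)"
    by blast
  let ?q = "p_if pr1 (((pr1 ;; p_lm) \<triangle> pr2) ;; p_not p_small) (num 0)"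
  have "\<exists>v. exec M ?q (Tup vg ?b1) v \<and> (v \<noteq> Num 0 \<longleftrightarrow> g \<noteq> \<zero>\<^bsub>A\<^esub> \<and> lm g \<notin> box N)"
    if g: "g \<in> set W" "rp g vg" for g vg
  proof (cases "g = \<zero>\<^bsub>A\<^esub>")
    case True
    then show ?thesis using rp_eq_zero[OF g(2)] by simp
  next
    case False
    have "lm g \<in> Mon" using Std_Mon[OF lm_Std[OF _ False]] g(1) W_carrier by blast
    then obtain v where v: "exec M (p_not p_small) (Tup (em (lm g)) ?b1) v" "v \<noteq> Num 0 \<longleftrightarrow> lm g \<notin> box N"
      using small by blast
    have "exec M ?q (Tup vg ?b1) v"
      using False rp_eq_zero[OF g(2)] lead_M[OF g(2) False] v(1) by simp
    then show ?thesis using v(2) False by blast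
  qed
  then obtain v2 where v2: "exec M (p_first ?q) (Tup (enc_list vs) ?b1) v2"
      "v2 \<noteq> Num 0 \<longleftrightarrow> (\<exists>g\<in>set W. g \<noteq> \<zero>\<^bsub>A\<^esub> \<and> lm g \<notin> box N)"
    using exec_first_W[of ?q ?b1 "\<lambda>g v. v \<noteq> Num 0 \<longleftrightarrow> g \<noteq> \<zero>\<^bsub>A\<^esub> \<and> lm g \<notin> box N"] by blast
  let ?bad = "\<lambda>g w. w \<in> Std \<and> \<not> (\<exists>w0\<in>Std \<inter> box N. pads W g w0 w)"
  have badmon: "\<exists>v. exec M p_badmon (Tup (em w) (Tup vg ?E)) v \<and> (v \<noteq> Num 0 \<longleftrightarrow> ?bad g w)"
    if g: "g \<in> set W" "rp g vg" and w: "w \<in> Mon" for g vg w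
  proof -
    note std = std_M[OF w]
    have "\<exists>v. exec M (p_first p_good) (Tup ?b1 (Tup (em w) (Tup vg ?E))) v \<and>
        (v \<noteq> Num 0 \<longleftrightarrow> (\<exists>w0\<in>set ws. w0 \<in> Std \<and> pads W g w0 w))"
      by (rule exec_first_ex) (use exec_good[OF red _ w g] ws(2) in blast)
    then obtain v where v: "exec M (p_first p_good) (Tup ?b1 (Tup (em w) (Tup vg ?E))) v"
        "v \<noteq> Num 0 \<longleftrightarrow> (\<exists>w0\<in>Std \<inter> box N. pads W g w0 w)"
      using ws(2) by blast
    have "exec M (((pr2 ;; pr2 ;; pr1) \<triangle> Skip) ;; p_first p_good) (Tup (em w) (Tup vg ?E)) v"
      using v(1) by simp
    note not = exec_not[OF this]
    show ?thesis
    proof (cases "w \<in> Std")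
      case True
      have "exec M p_badmon (Tup (em w) (Tup vg ?E)) (truth (v = Num 0))"
        unfolding p_badmon_def exec_if
        by (rule exI[of _ "Num 1"]) (use not True std in \<open>simp add: env_def\<close>)
      then show ?thesis using v(2) True by (intro exI[of _ "truth (v = Num 0)"]) auto
    next
      case False
      then have "exec M p_badmon (Tup (em w) (Tup vg ?E)) (Num 0)"
        using std by (simp add: p_badmon_def env_def)
      then show ?thesis using False by blast
    qed
  qed
  have badelem: "\<exists>v. exec M p_badelem (Tup vg ?E) v \<and> (v \<noteq> Num 0 \<longleftrightarrow> (\<exists>w\<in>box (N + N). ?bad g w))"
    if g: "g \<in> set W" "rp g vg" for g vg
  proof -
    have "\<exists>v. exec M (p_first p_badmon) (Tup (enc_list (map em us)) (Tup vg ?E)) v \<and>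
        (v \<noteq> Num 0 \<longleftrightarrow> (\<exists>w\<in>set us. ?bad g w))"
      by (rule exec_first_ex) (use badmon[OF g] us(2) box_def in blast)
    then show ?thesis
      using us(2) by (auto simp: p_badelem_def env_def exec_iff[OF exec_plus] exec_iff[OF us(1)])
  qed
  then obtain v3 where v3: "exec M (p_first p_badelem) (Tup (enc_list vs) ?E) v3"
      "v3 \<noteq> Num 0 \<longleftrightarrow> (\<exists>g\<in>set W. \<exists>w\<in>box (N + N). ?bad g w)"
    using exec_first_W[of p_badelem ?E "\<lambda>g v. v \<noteq> Num 0 \<longleftrightarrow> (\<exists>w\<in>box (N + N). ?bad g w)"] by blast
  let ?v = "if v1 \<noteq> Num 0 then Num 1 else if v2 \<noteq> Num 0 then Num 1 else v3"
  let ?p = "p_if (((pr2 ;; pr2 ;; pr2 ;; pr2) \<triangle> pr1) ;; p_first (p_not p_small)) (num 1)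
      (p_if (((pr2 ;; pr2 ;; pr1) \<triangle> pr1) ;; p_first ?q) (num 1) (((pr2 ;; pr2 ;; pr1) \<triangle> Skip) ;; p_first p_badelem))"
  have "exec M ?p ?E ?v"
    using v1(1) v2(1) v3(1) by (simp add: env_def exec_iff[OF v1(1)] exec_iff[OF v2(1)] exec_iff[OF v3(1)[unfolded env_def]] del: exec_if)
      (auto simp: exec_iff[OF v1(1)] exec_iff[OF v2(1)] exec_iff[OF v3(1)[unfolded env_def]])
  from exec_not[OF this] have "exec M p_ok (env vs N) (truth (?v = Num 0))"
    unfolding p_ok_def exec_simps(3) using ws(1) by (intro exI[of _ ?E] conjI) (simp_all add: env_def)
  moreover have "?v = Num 0 \<longleftrightarrow> certified W N"
  proof -
    have c1: "v1 = Num 0 \<longleftrightarrow> set Ts \<subseteq> box N" using v1(2) by blast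
    have c2: "v2 = Num 0 \<longleftrightarrow> (\<forall>g\<in>set W. g \<noteq> \<zero>\<^bsub>A\<^esub> \<longrightarrow> lm g \<in> box N)" using v2(2) by blast
    have c3: "v3 = Num 0 \<longleftrightarrow>
        (\<forall>g\<in>set W. \<forall>w\<in>Std \<inter> box (N + N). \<exists>w\<^sub>0\<in>Std \<inter> box N. pads W g w\<^sub>0 w)"
      using v3(2) by blast
    have "?v = Num 0 \<longleftrightarrow> v1 = Num 0 \<and> v2 = Num 0 \<and> v3 = Num 0" by simp
    then show ?thesis by (simp only: certified_def c1 c2 c3)
  qed
  ultimately show ?thesis by (intro exI[of _ "truth (?v = Num 0)"]) simp
qed

end

end

section \<open>Termination\<close>

context leading_term_machine
begin

text \<open>In an infinite run Dickson's lemma gives two added elements, the leading monomial of the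
  earlier contained in that of the later; but then the earlier one was a divisor when the later was
  added.\<close>

lemma wf_grow:
  "wf {(h # W, W) | h W. h \<in> carrier A \<and> h \<noteq> \<zero>\<^bsub>A\<^esub> \<and> dv W (lm h) = None}"
  unfolding wf_iff_no_infinite_down_chain
proof
  assume "\<exists>f. \<forall>i. (f (Suc i), f i) \<in> {(h # W, W) | h W. h \<in> carrier A \<and> h \<noteq> \<zero>\<^bsub>A\<^esub> \<and> dv W (lm h) = None}"
  then obtain f where f: "\<And>i. \<exists>h. f (Suc i) = h # f i \<and> h \<in> carrier A \<and> h \<noteq> \<zero>\<^bsub>A\<^esub> \<and> dv (f i) (lm h) = None"
    by blast
  define h where "h i = hd (f (Suc i))" for i
  have h: "f (Suc i) = h i # f i" "h i \<in> carrier A" "h i \<noteq> \<zero>\<^bsub>A\<^esub>" "dv (f i) (lm (h i)) = None" for i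
    using f[of i] by (auto simp: h_def)
  have mem: "h i \<in> set (f j)" if "i < j" for i j
    using that
  proof (induction j)
    case (Suc j)
    then show ?case using h(1)[of j] by (auto simp: less_Suc_eq)
  qed simp
  have H: "set_mset (lm (h i)) \<subseteq> H" for i
    using Std_Mon[OF lm_Std[OF h(2,3)]] by (simp add: Mon_iff)
  obtain \<phi> where \<phi>: "strict_mono (\<phi> :: nat \<Rightarrow> nat)" "\<And>i j. i \<le> j \<Longrightarrow> lm (h (\<phi> i)) \<subseteq># lm (h (\<phi> j))"
    using dickson_subseq[OF finite_H, of "\<lambda>i. lm (h i)"] H by blast
  have "h (\<phi> 0) \<in> set (f (\<phi> 1))" using \<phi>(1) by (intro mem) (simp add: strict_mono_less)
  then show False
    using h(3)[of "\<phi> 0"] h(4)[of "\<phi> 1"] \<phi>(2)[of 0 1] by (simp add: dv_None_iff)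
qed

lemma box_mono: "N \<le> N' \<Longrightarrow> box N \<subseteq> box N'"
  by (auto simp: box_def intro: order_trans)

lemma finite_subset_box:
  assumes "finite F" "F \<subseteq> Mon"
  shows "\<exists>N. F \<subseteq> box N"
proof (intro exI subsetI)
  fix u assume u: "u \<in> F"
  then have "size u \<le> (\<Sum>v\<in>F. size v)" using assms(1) by (intro member_le_sum) auto
  then have "count u h \<le> (\<Sum>v\<in>F. size v)" for h using count_le_size[of u h] by linarith
  then show "u \<in> box (\<Sum>v\<in>F. size v)" using u assms(2) by (auto simp: box_def)
qed

text \<open>If one box is not reduced, no larger one is, and the claim is vacuous. Otherwise all
  products reduce to 0, and every box containing the finite bases, the generators of \<Sigma> and
  the leading monomials is certified. The program never computes this bound.\<close>

lemma eventually_certified: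
  assumes W: "set W \<subseteq> carrier A"
  shows "\<exists>N\<^sub>0. \<forall>N\<ge>N\<^sub>0. reduced W N \<longrightarrow> certified W N"
proof (cases "\<forall>N. reduced W N")
  case False
  then obtain N0 where "\<not> reduced W N0" by blast
  then have "\<not> reduced W N" if "N0 \<le> N" for N using box_mono[OF that] unfolding reduced_def by blast
  then show ?thesis by blast
next
  case True
  have all: "reduces W (mon w \<otimes>\<^bsub>A\<^esub> g)" if g: "g \<in> set W" and w: "w \<in> Std" for g w
  proof -
    obtain N where "{w} \<subseteq> box N" using finite_subset_box[of "{w}"] Std_Mon[OF w] by auto
    then show ?thesis using True g w by (auto simp: reduced_def)
  qed
  have "\<forall>g\<in>set W. \<exists>F. finite F \<and> F \<subseteq> Std \<and> (\<forall>w\<in>Std. \<exists>w\<^sub>0\<in>F. pads W g w\<^sub>0 w)"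
    using pads_finite_basis[OF W all] by blast
  then obtain F where F: "\<And>g. g \<in> set W \<Longrightarrow> finite (F g) \<and> F g \<subseteq> Std \<and> (\<forall>w\<in>Std. \<exists>w\<^sub>0\<in>F g. pads W g w\<^sub>0 w)"
    by (metis bchoice)
  let ?L = "lm ` {g \<in> set W. g \<noteq> \<zero>\<^bsub>A\<^esub>}"
  have fin: "finite ((\<Union>g\<in>set W. F g) \<union> set Ts \<union> ?L)" using F by auto
  have "(\<Union>g\<in>set W. F g) \<union> set Ts \<union> ?L \<subseteq> Mon"
    using F Std_Mon Ts_Mon lm_Std W by blast
  from finite_subset_box[OF fin this] obtain N0 where N0: "(\<Union>g\<in>set W. F g) \<union> set Ts \<union> ?L \<subseteq> box N0" ..
  have "certified W N" if "N \<ge> N0" for N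
  proof -
    have sub: "(\<Union>g\<in>set W. F g) \<union> set Ts \<union> ?L \<subseteq> box N" using N0 box_mono[OF that] by blast
    show ?thesis
      unfolding certified_def
    proof (intro conjI ballI impI)
      fix g w assume gw: "g \<in> set W" "w \<in> Std \<inter> box (N + N)"
      then obtain w0 where w0: "w0 \<in> F g" "pads W g w0 w" using F[OF gw(1)] by blast
      moreover have "w0 \<in> box N" using w0(1) gw(1) sub by blast
      ultimately show "\<exists>w\<^sub>0\<in>Std \<inter> box N. pads W g w\<^sub>0 w" using F[OF gw(1)] by blast
    qed (use sub in blast)+
  qed
  then show ?thesis by blast
qed

lemma certified_reduces:
  assumes W: "set W \<subseteq> carrier A" and N: "reduced W N" "certified W N"
    and g: "g \<in> set W" and w: "w \<in> Std"
  shows "reduces W (mon w \<otimes>\<^bsub>A\<^esub> g)"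
proof (rule reduces_multiples[OF W _ g w])
  fix g w assume gw: "g \<in> set W" "w \<in> Std"
  have "\<exists>w\<^sub>0\<in>Std \<inter> box N. pads W g w\<^sub>0 w"
    by (rule pads_box[OF Ts_eq]) (use N(2) gw W in \<open>auto simp: certified_def\<close>)
  then show "\<exists>w\<^sub>0. pads W g w\<^sub>0 w \<and> reduces W (mon w\<^sub>0 \<otimes>\<^bsub>A\<^esub> g)"
    using N(1) gw(1) by (auto simp: reduced_def)
qed

text \<open>Two nested inductions: on \<open>W\<close> along \<open>wf_grow\<close> when an element
  is added, and for fixed \<open>W\<close> on the distance from \<open>N\<close> to the bound of
  \<open>eventually_certified\<close>.\<close>

lemma exec_loop:
  assumes "list_all2 rp W vs"
  shows "\<exists>W' vs' N'. exec M (While p_step) (Tup (Num 1) (env vs N)) (Tup (Num 0) (env vs' N')) \<and>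
    list_all2 rp W' vs' \<and> set W \<subseteq> set W' \<and> (\<forall>I. ideal I A \<longrightarrow> set W \<subseteq> I \<longrightarrow> set W' \<subseteq> I) \<and>
    (\<forall>g\<in>set W'. \<forall>w\<in>Std. reduces W' (mon w \<otimes>\<^bsub>A\<^esub> g))"
  using assms
proof (induction W arbitrary: vs N rule: wf_induct_rule[OF wf_grow])
  case (1 W)
  let ?goal = "\<lambda>N. \<exists>W' vs' N'. exec M (While p_step) (Tup (Num 1) (env vs N)) (Tup (Num 0) (env vs' N')) \<and>
    list_all2 rp W' vs' \<and> set W \<subseteq> set W' \<and> (\<forall>I. ideal I A \<longrightarrow> set W \<subseteq> I \<longrightarrow> set W' \<subseteq> I) \<and>
    (\<forall>g\<in>set W'. \<forall>w\<in>Std. reduces W' (mon w \<otimes>\<^bsub>A\<^esub> g))"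
  note Wvs = "1.prems"
  note W = W_carrier[OF Wvs]
  \<comment> \<open>The run from \<open>N\<close> is settled once the run from \<open>Suc N\<close>
    is, and the latter matters only if the box is reduced but uncertified.\<close>
  have step: "?goal N" if more: "\<not> certified W N \<Longrightarrow> reduced W N \<Longrightarrow> ?goal (Suc N)" for N
  proof -
    obtain v where v: "exec M p_pass (env vs N) v"
      "v = Num 0 \<and> reduced W N \<or> v \<noteq> Num 0 \<and> (\<exists>h. rp h v \<and> h \<noteq> \<zero>\<^bsub>A\<^esub> \<and> dv W (lm h) = None \<and>
        (\<forall>I. ideal I A \<longrightarrow> set W \<subseteq> I \<longrightarrow> h \<in> I))"
      using exec_pass[OF Wvs, of N] by blast
    from v(2) show ?thesis
    proof
      assume v0: "v = Num 0 \<and> reduced W N"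
      obtain b where b: "exec M p_ok (env vs N) b" "b \<noteq> Num 0 \<longleftrightarrow> certified W N"
        using exec_ok[OF Wvs] v0 by blast
      show ?thesis
      proof (cases "certified W N")
        case True
        have "exec M p_step (Tup (Num 1) (env vs N)) (Tup (Num 0) (env vs N))"
          using True b v0 by (simp add: p_step_def exec_iff[OF v(1)] exec_iff[OF b(1)])
        then have "exec M (While p_step) (Tup (Num 1) (env vs N)) (Tup (Num 0) (env vs N))"
          by (simp add: exec_While_simps exec_iff)
        then show ?thesis using Wvs certified_reduces[OF W _ True] v0 by blast
      next
        case False
        have "exec M p_step (Tup (Num 1) (env vs N)) (Tup (Num 1) (env vs (Suc N)))"
          using False b v0 by (simp add: p_step_def exec_iff[OF v(1)] exec_iff[OF b(1)]) (simp add: env_def)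
        then have "exec M (While p_step) (Tup (Num 1) (env vs N)) w \<longleftrightarrow>
            exec M (While p_step) (Tup (Num 1) (env vs (Suc N))) w" for w
          by (intro exec_While_step) simp_all
        then show ?thesis using more[OF False] v0 by simp
      qed
    next
      assume "v \<noteq> Num 0 \<and> (\<exists>h. rp h v \<and> h \<noteq> \<zero>\<^bsub>A\<^esub> \<and> dv W (lm h) = None \<and>
        (\<forall>I. ideal I A \<longrightarrow> set W \<subseteq> I \<longrightarrow> h \<in> I))"
      then obtain h where h: "v \<noteq> Num 0" "rp h v" "h \<noteq> \<zero>\<^bsub>A\<^esub>" "dv W (lm h) = None"
          "\<forall>I. ideal I A \<longrightarrow> set W \<subseteq> I \<longrightarrow> h \<in> I"
        by blast
      have "exec M p_step (Tup (Num 1) (env vs N)) (Tup (Num 1) (env (v # vs) N))"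
        using h(1) by (simp add: p_step_def exec_iff[OF v(1)]) (simp add: env_def)
      then have eq: "exec M (While p_step) (Tup (Num 1) (env vs N)) w \<longleftrightarrow>
          exec M (While p_step) (Tup (Num 1) (env (v # vs) N)) w" for w
        by (intro exec_While_step) simp_all
      have "(h # W, W) \<in> {(h # W, W) | h W. h \<in> carrier A \<and> h \<noteq> \<zero>\<^bsub>A\<^esub> \<and> dv W (lm h) = None}"
        using h by (simp add: rp_def)
      moreover have "list_all2 rp (h # W) (v # vs)" using Wvs h(2) by simp
      ultimately obtain W' vs' N' where
        "exec M (While p_step) (Tup (Num 1) (env (v # vs) N)) (Tup (Num 0) (env vs' N'))"
        "list_all2 rp W' vs'" "set (h # W) \<subseteq> set W'"
        "\<forall>I. ideal I A \<longrightarrow> set (h # W) \<subseteq> I \<longrightarrow> set W' \<subseteq> I"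
        "\<forall>g\<in>set W'. \<forall>w\<in>Std. reduces W' (mon w \<otimes>\<^bsub>A\<^esub> g)"
        using "1.IH"[of "h # W" "v # vs" N] by blast
      then show ?thesis using h(5) unfolding eq
        by (intro exI[of _ W'] exI[of _ vs'] exI[of _ N']) simp
    qed
  qed
  obtain N0 where N0: "\<And>N. N \<ge> N0 \<Longrightarrow> reduced W N \<Longrightarrow> certified W N"
    using eventually_certified[OF W] by blast
  show ?case
  proof (induction "N0 - N" arbitrary: N)
    case 0
    \<comment> \<open>From \<open>N0\<close> on, a reduced box is certified, so the premise
      \<open>more\<close> is vacuous.\<close>
    then show ?case using step[of N] N0[of N] by simp
  next
    case (Suc k)
    have "?goal (Suc N)" using Suc.hyps(1)[of "Suc N"] Suc.hyps(2) by simp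
    then show ?case using step[of N] by blast
  qed
qed

theorem exec_main:
  assumes G: "finite G" "G \<subseteq> carrier A" and W: "set W = G" "list_all2 rp W vs"
  shows "\<exists>W' vs'. exec M p_main (Tup (Num (length hs)) (Tup vT (Tup vF (enc_list vs)))) (enc_list vs') \<and>
    list_all2 rp W' vs' \<and> Ann_closure G (set W') \<and> S_closure G (set W') \<and> groebner_basis (Idl\<^bsub>A\<^esub> G) (set W')"
proof -
  obtain W' vs' N where l: "exec M (While p_step) (Tup (Num 1) (env vs 0)) (Tup (Num 0) (env vs' N))"
      "list_all2 rp W' vs'" "set W \<subseteq> set W'" "\<forall>I. ideal I A \<longrightarrow> set W \<subseteq> I \<longrightarrow> set W' \<subseteq> I"
      "\<forall>g\<in>set W'. \<forall>w\<in>Std. reduces W' (mon w \<otimes>\<^bsub>A\<^esub> g)"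
    using exec_loop[OF W(2), of 0] by blast
  have "exec M p_main (Tup (Num (length hs)) (Tup vT (Tup vF (enc_list vs)))) (enc_list vs')"
    using exec_iff[OF l(1)] by (simp add: p_main_def env_def)
  \<comment> \<open>The invariant about ideals is used for the ideal generated by
    \<open>G\<close>.\<close>
  moreover have "set W' \<subseteq> Idl\<^bsub>A\<^esub> G"
    using l(4) A.genideal_ideal[OF G(2)] A.genideal_self[OF G(2)] W(1) by blast
  ultimately show ?thesis
    using closures[OF W_carrier[OF l(2)], of G] l W(1) by blast
qed

end

theorem theorem6p11:
  shows "\<exists>p :: prog.
    \<forall>(R :: 'r ring) (A :: ('r, 'a) module) (gen :: 'h \<Rightarrow> 'a) (H :: 'h set)
      (\<Sigma> :: 'h multiset set) (r :: 'h multiset rel) (B :: ('r, 'b) module) (gen_lt :: 'h \<Rightarrow> 'b)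
      (hs :: 'h list) (M :: 'r machine) (G :: 'a set) (v :: 'r val).
      leading_term_algebra R A gen H \<Sigma> r B gen_lt \<and>
      distinct hs \<and> set hs = H \<and>
      leading_term_algebra.machine_for R A gen H \<Sigma> r B gen_lt hs M \<and>
      finite G \<and> G \<subseteq> carrier A \<and>
      leading_term_algebra.input_for R A gen H \<Sigma> B gen_lt hs G v \<longrightarrow>
      (\<exists>G' w. exec M p v w \<and>
        repr_set (leading_term_algebra.repr_elem R A gen H \<Sigma> hs) G' w \<and>
        leading_term_algebra.Ann_closure R A gen H \<Sigma> r B gen_lt G G' \<and>
        leading_term_algebra.S_closure R A gen H \<Sigma> r B gen_lt G G' \<and>
        (domain A \<longrightarrow>
          leading_term_algebra.groebner_basis R A gen H \<Sigma> r B gen_lt (Idl\<^bsub>A\<^esub> G) G'))"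
proof (intro exI[of _ p_main] allI impI, elim conjE)
  fix R :: "'r ring" and A :: "('r, 'a) module" and gen :: "'h \<Rightarrow> 'a" and H :: "'h set"
    and \<Sigma> :: "'h multiset set" and r :: "'h multiset rel" and B :: "('r, 'b) module" and gen_lt :: "'h \<Rightarrow> 'b"
    and hs :: "'h list" and M :: "'r machine" and G :: "'a set" and v :: "'r val"
  assume lta: "leading_term_algebra R A gen H \<Sigma> r B gen_lt"
    and hs: "distinct hs" "set hs = H"
    and M: "leading_term_algebra.machine_for R A gen H \<Sigma> r B gen_lt hs M"
    and G: "finite G" "G \<subseteq> carrier A"
    and input: "leading_term_algebra.input_for R A gen H \<Sigma> B gen_lt hs G v"
  interpret L: leading_term_algebra R A gen H \<Sigma> r B gen_lt by (rule lta)
  obtain T F vT vF vG where T: "L.generates_\<Sigma> T" "repr_set (\<lambda>m w. w = enc_mon hs m) T vT"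
      and vG: "repr_set (L.repr_elem hs) G vG"
      and v: "v = Tup (Num (length hs)) (Tup vT (Tup vF vG))"
    using input unfolding L.input_for_def by blast
  obtain Ts ws where Ts: "set Ts = T" "list_all2 (\<lambda>m w. w = enc_mon hs m) Ts ws" "vT = enc_list ws"
    using T(2) unfolding repr_set_def by blast
  \<comment> \<open>A monomial has only one encoding, so the encoded generators are determined by
    \<open>Ts\<close>.\<close>
  have ws: "ws = map (enc_mon hs) Ts"
    using Ts(2) by (induction rule: list_all2_induct) auto
  interpret L: leading_term_machine R A gen H \<Sigma> r B gen_lt hs M Ts
    using hs M T(1) Ts(1) by unfold_locales auto
  obtain W vs where W: "set W = G" "list_all2 (L.repr_elem hs) W vs" "vG = enc_list vs"
    using vG unfolding repr_set_def by blast
  have rp: "list_all2 L.rp W vs"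
    using W(2) G(2) W(1) by (auto simp: list_all2_conv_all_nth L.rp_def)
  obtain W' vs' where m: "exec M p_main v (enc_list vs')" "list_all2 L.rp W' vs'"
      "L.Ann_closure G (set W')" "L.S_closure G (set W')" "L.groebner_basis (Idl\<^bsub>A\<^esub> G) (set W')"
    using L.exec_main[OF G W(1) rp, of vF] unfolding v Ts(3) ws W(3) by blast
  have "list_all2 (L.repr_elem hs) W' vs'"
    using m(2) by (auto simp: list_all2_conv_all_nth L.rp_def)
  then have "repr_set (L.repr_elem hs) (set W') (enc_list vs')"
    unfolding repr_set_def by blast
  with m show "\<exists>G' w. exec M p_main v w \<and>
        repr_set (L.repr_elem hs) G' w \<and>
        L.Ann_closure G G' \<and> L.S_closure G G' \<and> (domain A \<longrightarrow> L.groebner_basis (Idl\<^bsub>A\<^esub> G) G')"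
    by blast
qed

end
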